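(* Let $\mathrm{WSys}(F_S\curvearrowright X)$ and $\mathrm{WSys}(F_T\curvearrowright Y)$ be two warped systems. Suppose that there exist increasing unbounded sequences $(t_k)_{k\in\mathbb{N}}$ and $(s_k)_{k\in\mathbb{N}}$ in $[1,\infty)$ such that the families $(X,\delta_S^{t_k})_{k\in\mathbb{N}}$ and $(Y,\delta_T^{s_k})_{k\in\mathbb{N}}$ are coarsely equivalent, and that $\mathrm{WSys}(F_S\curvearrowright X)$ has stable discrete fundamental group. Then $\mathrm{WSys}(F_T\curvearrowright Y)$ also has stable discrete fundamental group and $$\pi_{1,\infty}(F_S\curvearrowright X)\cong\pi_{1,\infty}(F_T\curvearrowright Y).$$
   Context: Coarse equivalence. A map $f\colon Z\to W$ of metric spaces is $(L,A)$-coarsely Lipschitz if $d_W(f(z),f(z'))\le L\,d_Z(z,z')+A$; it is an $(L,A)$-quasi-isometry if it is $(L,A)$-coarsely Lipschitz and there is an $(L,A)$-coarsely Lipschitz $\bar f\colon W\to Z$ with $f\circ\bar f$ and $\bar f\circ f$ at distance at most $A$ from the identities. Two sequences $(Z_k)$, $(W_k)$ of metric spaces are coarsely equivalent if there are $L,A$ such that $Z_k$ and $W_k$ are $(L,A)$-quasi-isometric for every $k$. Warped systems. Given a finite set $S$ of homeomorphisms of a metric space $(X,d)$, $F_S$ is the free group on $S$, and for $t\ge1$, $\delta_S^t$ is the largest metric on $X$ with $\delta_S^t\le t\cdot d$ and $\delta_S^t(x,s(x))\le1$ for all $x\in X,s\in S$. The warped system $\mathrm{WSys}(F_S\curvearrowright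 X)$ is the family $\{(X,\delta_S^t)\}_{t\ge1}$ together with $S$. A jumping-path is a sequence of continuous paths $\gamma_0,\dots,\gamma_n$ in $X$ and $\vec s_1,\dots,\vec s_n\in S\cup S^{-1}$ with $\gamma_i(0)=\vec s_i\gamma_{i-1}(1)$; its length at scale $t$ is $n+\sum_i t\|\gamma_i\|$, where $\|\gamma_i\|$ is the length in $(X,d)$. $(X,\delta_S^t)$ is jumping-geodesic if $(X,d)$ is geodesic and any two points $x,y$ are joined by a jumping-path of length exactly $\delta_S^t(x,y)$ at scale $t$. Standing assumption on all warped systems: $(X,d)$ is compact, path-connected, locally path-connected, semi-locally simply connected, every continuous path in $X$ is homotopic (rel endpoints) to one of finite length, and $(X,\delta_S^t)$ is jumping-geodesic for all $t$ large enough. Discrete fundamental group. For a metric space $(Z,\rho)$ and $\theta>0$, a $\theta$-path is a sequence $(z_0,\dots,z_n)$ with $\rho(z_i,z_{i+1})\le\theta$. Lazifications are obtained by repeating values; a $\theta$-grid homotopy between $\theta$-paths of length $n$ with the same endpoints is a $\theta$-Lipschitz map $\{0,\dots,n\}\times\{0,\dots,m\}\to Z$ ($\ell^1$ metric on the source) restricting to the two paths on the bottom and top rows and constant on the left and right sides. $\pi_{1,\theta}(Z)$ is the group of closed $\theta$-paths at a base point modulo the equivalence relation generated by lazifications and $\theta$-grid homotopies, with concatenation. Limit group. Fix $x_0\in X$ and, for $s\in S$, a continuous path $\alpha_s$ from $x_0$ to $s x_0$; put $\alpha_{s^{-1}}=s^{-1}(\alpha_s^* )$ ($^*$ denotes reversal)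 and $\alpha_{\vec s_1\cdots\vec s_n}=\alpha_{\vec s_1}\vec s_1(\alpha_{\vec s_2})\cdots(\vec s_1\cdots\vec s_{n-1})(\alpha_{\vec s_n})$. Let $\phi_S\colon F_S\to\mathrm{Aut}(\pi_1(X,x_0))$, $\phi_S(w)[\gamma]=[\alpha_w w(\gamma)\alpha_w^*]$. For integer $\theta\ge1$ let $K_\theta$ be the set of $([\beta w(\beta^* )\alpha_w^*],w)$ with $w\in F_S$ of reduced length $\le4\theta$ and $\mathrm{Fix}(w)\neq\emptyset$, and $\beta$ a path from $x_0$ to a point of $\mathrm{Fix}(w)$. For all $t$ large enough (depending on $\theta$) $\pi_{1,\theta}(X,\delta_S^t)$ is isomorphic to $(\pi_1(X,x_0)\rtimes_{\phi_S}F_S)/\langle\langle K_\theta\rangle\rangle$; this group is denoted $\pi_{1,\theta}(F_S\curvearrowright X)$. For $\theta<\theta'$ the identity of $X$ induces the natural quotient map $\pi_{1,\theta}(F_S\curvearrowright X)\to\pi_{1,\theta'}(F_S\curvearrowright X)$, and $\pi_{1,\infty}(F_S\curvearrowright X)=\varinjlim_\theta\pi_{1,\theta}(F_S\curvearrowright X)$. The warped system has stable discrete fundamental group if for some $\theta$ the natural surjection $\pi_{1,\theta}(F_S\curvearrowright X)\to\pi_{1,\infty}(F_S\curvearrowright X)$ is an isomorphism. *)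

theory Defs
  imports "HOL-Analysis.Analysis" "HOL-Algebra.Coset"
begin

section \<open>Coarse equivalence\<close>

definition coarsely_Lipschitz ::
  "real \<Rightarrow> real \<Rightarrow> 'a metric \<Rightarrow> 'b metric \<Rightarrow> ('a \<Rightarrow> 'b) \<Rightarrow> bool"
where
  "coarsely_Lipschitz L A Z W f \<longleftrightarrow>
     f \<in> mspace Z \<rightarrow> mspace W \<and>
     (\<forall>z\<in>mspace Z. \<forall>z'\<in>mspace Z. mdist W (f z) (f z') \<le> L * mdist Z z z' + A)"

definition quasi_isometry ::
  "real \<Rightarrow> real \<Rightarrow> 'a metric \<Rightarrow> 'b metric \<Rightarrow> ('a \<Rightarrow> 'b) \<Rightarrow> bool"
where
  "quasi_isometry L A Z W f \<longleftrightarrow>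
     coarsely_Lipschitz L A Z W f \<and>
     (\<exists>f'. coarsely_Lipschitz L A W Z f' \<and>
        (\<forall>w\<in>mspace W. mdist W (f (f' w)) w \<le> A) \<and>
        (\<forall>z\<in>mspace Z. mdist Z (f' (f z)) z \<le> A))"

definition coarsely_equivalent :: "(nat \<Rightarrow> 'a metric) \<Rightarrow> (nat \<Rightarrow> 'b metric) \<Rightarrow> bool"
where
  "coarsely_equivalent Z W \<longleftrightarrow> (\<exists>L A. \<forall>k. \<exists>f. quasi_isometry L A (Z k) (W k) f)"


section \<open>The warped metric\<close>

text \<open>A metric space is a set \<open>X\<close> in a type of class \<^class>\<open>metric_space\<close>, with metric
  \<^const>\<open>dist\<close>.\<close>

definition warped_metrics ::
  "'a::metric_space set \<Rightarrow> ('a \<Rightarrow> 'a) set \<Rightarrow> real \<Rightarrow> ('a \<Rightarrow> 'a \<Rightarrow> real) set"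
where
  "warped_metrics X S t =
     {\<rho>. Metric_space X \<rho> \<and>
        (\<forall>x\<in>X. \<forall>y\<in>X. \<rho> x y \<le> t * dist x y) \<and>
        (\<forall>x\<in>X. \<forall>s\<in>S. \<rho> x (s x) \<le> 1)}"

text \<open>The largest element of \<^const>\<open>warped_metrics\<close>, obtained as the pointwise supremum; see
  \<open>warped_dist_in_warped_metrics\<close> and \<open>warped_dist_greatest\<close> below.  The value off \<open>X\<close> is irrelevant;
  it is fixed because \<^locale>\<open>Metric_space\<close> asks for symmetry and nonnegativity everywhere.\<close>

definition warped_dist ::
  "'a::metric_space set \<Rightarrow> ('a \<Rightarrow> 'a) set \<Rightarrow> real \<Rightarrow> 'a \<Rightarrow> 'a \<Rightarrow> real"
where
  "warped_dist X S t x y =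
     (if x \<in> X \<and> y \<in> X then (SUP \<rho>\<in>warped_metrics X S t. \<rho> x y) else 0)"

definition warped_metric ::
  "'a::metric_space set \<Rightarrow> ('a \<Rightarrow> 'a) set \<Rightarrow> real \<Rightarrow> 'a metric"
where
  "warped_metric X S t = metric (X, warped_dist X S t)"

lemma warped_dist_greatest:
  assumes "\<rho> \<in> warped_metrics X S t" "x \<in> X" "y \<in> X"
  shows "\<rho> x y \<le> warped_dist X S t x y"
proof -
  have "bdd_above ((\<lambda>\<rho>. \<rho> x y) ` warped_metrics X S t)"
    using assms by (intro bdd_aboveI[of _ "t * dist x y"]) (auto simp: warped_metrics_def)
  with assms show ?thesis
    by (auto simp: warped_dist_def intro: cSUP_upper)
qed

lemma min_in_warped_metrics:
  assumes "t > 0"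
  shows "(\<lambda>x y. min 1 (t * dist x y)) \<in> warped_metrics X S t"
proof -
  have tri: "min 1 (t * dist x z) \<le> min 1 (t * dist x y) + min 1 (t * dist y z)" for x y z :: 'a
  proof -
    have "t * dist x z \<le> t * dist x y + t * dist y z"
      using assms by (metis dist_triangle distrib_left mult_le_cancel_left_pos)
    moreover have "0 \<le> t * dist x y" "0 \<le> t * dist y z"
      using assms by auto
    ultimately show ?thesis by linarith
  qed
  have "Metric_space X (\<lambda>x y. min 1 (t * dist x y))"
  proof
    fix x y :: 'a
    show "0 \<le> min 1 (t * dist x y)" "min 1 (t * dist x y) = min 1 (t * dist y x)"
      using assms by (auto simp: dist_commute)
    show "min 1 (t * dist x y) = 0 \<longleftrightarrow> x = y"
      using assms by (auto simp: min_def)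
  qed (rule tri)
  then show ?thesis
    by (auto simp: warped_metrics_def)
qed

lemma warped_dist_in_warped_metrics:
  assumes "t > 0" and S: "\<And>s x. s \<in> S \<Longrightarrow> x \<in> X \<Longrightarrow> s x \<in> X"
  shows "warped_dist X S t \<in> warped_metrics X S t"
proof -
  let ?M = "warped_metrics X S t"
  have ne: "?M \<noteq> {}"
    using min_in_warped_metrics[OF \<open>t > 0\<close>] by blast
  have least: "warped_dist X S t x y \<le> b"
    if "x \<in> X" "y \<in> X" "\<And>\<rho>. \<rho> \<in> ?M \<Longrightarrow> \<rho> x y \<le> b" for x y b
    using that ne by (auto simp: warped_dist_def intro: cSUP_least)
  have lower: "min 1 (t * dist x y) \<le> warped_dist X S t x y" if "x \<in> X" "y \<in> X" for x y
    using warped_dist_greatest[OF min_in_warped_metrics[OF \<open>t > 0\<close>] that] .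
  have M: "Metric_space X \<rho>" if "\<rho> \<in> ?M" for \<rho>
    using that by (simp add: warped_metrics_def)
  have "Metric_space X (warped_dist X S t)"
  proof
    fix x y :: 'a
    show "0 \<le> warped_dist X S t x y"
    proof (cases "x \<in> X \<and> y \<in> X")
      case True
      have "0 \<le> min 1 (t * dist x y)"
        using \<open>t > 0\<close> by simp
      with True show ?thesis
        using lower order.trans by blast
    qed (auto simp: warped_dist_def)
    have "(\<lambda>\<rho>. \<rho> x y) ` ?M = (\<lambda>\<rho>. \<rho> y x) ` ?M"
      using M by (intro image_cong refl) (rule Metric_space.commute)
    then show "warped_dist X S t x y = warped_dist X S t y x"
      by (auto simp: warped_dist_def)
  next
    fix x y assume xy: "x \<in> X" "y \<in> X"
    show "warped_dist X S t x y = 0 \<longleftrightarrow> x = y"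
    proof
      assume "warped_dist X S t x y = 0"
      then have "t * dist x y \<le> 0"
        using lower[OF xy] by (auto simp: min_def split: if_splits)
      with \<open>t > 0\<close> show "x = y"
        by (simp add: mult_le_0_iff)
    next
      assume "x = y"
      have "\<rho> x y \<le> 0" if "\<rho> \<in> ?M" for \<rho>
        using Metric_space.zero[OF M[OF that] xy] \<open>x = y\<close> by simp
      then have "warped_dist X S t x y \<le> 0"
        using least xy by blast
      moreover have "0 \<le> warped_dist X S t x y"
        using lower[OF xy] \<open>x = y\<close> by simp
      ultimately show "warped_dist X S t x y = 0" by simp
    qed
  next
    fix x y z assume xyz: "x \<in> X" "y \<in> X" "z \<in> X"
    show "warped_dist X S t x z \<le> warped_dist X S t x y + warped_dist X S t y z"
    proof (rule least)
      fix \<rho> assume \<rho>: "\<rho> \<in> ?M"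
      then have "\<rho> x z \<le> \<rho> x y + \<rho> y z"
        using Metric_space.triangle[OF M xyz] by blast
      also have "\<dots> \<le> warped_dist X S t x y + warped_dist X S t y z"
        using \<rho> xyz by (intro add_mono warped_dist_greatest)
      finally show "\<rho> x z \<le> warped_dist X S t x y + warped_dist X S t y z" .
    qed (use xyz in auto)
  qed
  then show ?thesis
    using S by (auto simp: warped_metrics_def intro!: least)
qed


section \<open>Words and the free group\<close>

text \<open>The letter \<open>(s, True)\<close> stands for \<open>s\<close> and \<open>(s, False)\<close> for its formal inverse.\<close>

type_synonym 'g letter = "'g \<times> bool"

definition inv_letter :: "'g letter \<Rightarrow> 'g letter"
  where "inv_letter l = (fst l, \<not> snd l)"

definition reduced :: "'g letter list \<Rightarrow> bool"
  where "reduced w \<longleftrightarrow> successively (\<lambda>l m. m \<noteq> inv_letter l) w"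

definition cancel_Cons :: "'g letter \<Rightarrow> 'g letter list \<Rightarrow> 'g letter list"
  where "cancel_Cons l w =
    (case w of [] \<Rightarrow> [l] | m # v \<Rightarrow> if m = inv_letter l then v else l # w)"

definition free_group :: "'g set \<Rightarrow> 'g letter list monoid"
  where "free_group S =
    \<lparr>carrier = {w. set w \<subseteq> S \<times> UNIV \<and> reduced w},
     mult = foldr cancel_Cons,
     one = []\<rparr>"

lemma inv_letter_inv_letter [simp]: "inv_letter (inv_letter l) = l"
  by (simp add: inv_letter_def)

lemma reduced_Nil [simp]: "reduced []"
  by (simp add: reduced_def)

lemma reduced_Cons: "reduced (l # w) \<longleftrightarrow> (w = [] \<or> hd w \<noteq> inv_letter l) \<and> reduced w"
  by (auto simp: reduced_def successively_Cons)

lemma reduced_cancel_Cons: "reduced w \<Longrightarrow> reduced (cancel_Cons l w)"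
  by (cases w) (auto simp: cancel_Cons_def reduced_Cons)

lemma reduced_foldr_cancel_Cons: "reduced w \<Longrightarrow> reduced (foldr cancel_Cons u w)"
  by (induction u) (auto intro: reduced_cancel_Cons)

lemma set_cancel_Cons: "set (cancel_Cons l w) \<subseteq> insert l (set w)"
  by (auto simp: cancel_Cons_def split: list.splits if_splits)

lemma set_foldr_cancel_Cons: "set (foldr cancel_Cons u w) \<subseteq> set u \<union> set w"
  by (induction u) (use set_cancel_Cons in fastforce)+

lemma cancel_Cons_inverse: "reduced w \<Longrightarrow> cancel_Cons l (cancel_Cons (inv_letter l) w) = w"
  by (auto simp: cancel_Cons_def reduced_Cons split: list.splits if_splits)

lemma foldr_cancel_Cons_Cons:
  assumes "reduced u" "reduced w"
  shows "foldr cancel_Cons (cancel_Cons l u) w = cancel_Cons l (foldr cancel_Cons u w)"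
proof (cases u)
  case (Cons m v)
  with assms show ?thesis
    by (auto simp: cancel_Cons_def[of l "m # v"] cancel_Cons_inverse reduced_foldr_cancel_Cons)
qed (simp add: cancel_Cons_def)

lemma foldr_cancel_Cons_Nil: "reduced u \<Longrightarrow> foldr cancel_Cons u [] = u"
proof (induction u)
  case (Cons l u)
  then show ?case
    by (cases u) (auto simp: cancel_Cons_def reduced_Cons)
qed simp

lemma group_free_group: "group (free_group S)"
proof (rule groupI)
  fix u v assume "u \<in> carrier (free_group S)" "v \<in> carrier (free_group S)"
  then show "u \<otimes>\<^bsub>free_group S\<^esub> v \<in> carrier (free_group S)"
    using set_foldr_cancel_Cons[of u v] by (auto simp: free_group_def reduced_foldr_cancel_Cons)
next
  fix u v w
  assume "u \<in> carrier (free_group S)" "v \<in> carrier (free_group S)" "w \<in> carrier (free_group S)"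
  then have v: "reduced v" and w: "reduced w"
    by (auto simp: free_group_def)
  have "foldr cancel_Cons (foldr cancel_Cons u v) w = foldr cancel_Cons u (foldr cancel_Cons v w)"
    by (induction u) (use v w in \<open>auto simp: foldr_cancel_Cons_Cons reduced_foldr_cancel_Cons\<close>)
  then show "u \<otimes>\<^bsub>free_group S\<^esub> v \<otimes>\<^bsub>free_group S\<^esub> w = u \<otimes>\<^bsub>free_group S\<^esub> (v \<otimes>\<^bsub>free_group S\<^esub> w)"
    by (simp add: free_group_def)
next
  fix u assume "u \<in> carrier (free_group S)"
  then have u: "set u \<subseteq> S \<times> UNIV" "reduced u"
    by (auto simp: free_group_def)
  define v where "v = foldr cancel_Cons (rev (map inv_letter u)) []"
  have "reduced v"
    unfolding v_def by (intro reduced_foldr_cancel_Cons) simp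
  moreover have "set v \<subseteq> S \<times> UNIV"
    using set_foldr_cancel_Cons[of "rev (map inv_letter u)" "[]"] u(1)
    by (fastforce simp: v_def inv_letter_def)
  moreover have "foldr cancel_Cons v u = []"
  proof -
    have *: "foldr cancel_Cons (foldr cancel_Cons x []) u = foldr cancel_Cons x u" for x
      by (induction x)
         (auto simp: foldr_cancel_Cons_Cons reduced_foldr_cancel_Cons u(2))
    have "foldr cancel_Cons (rev (map inv_letter u)) u = []"
      using u(2) by (induction u) (auto simp: cancel_Cons_def reduced_Cons)
    with * show ?thesis by (simp add: v_def)
  qed
  ultimately show "\<exists>v\<in>carrier (free_group S). v \<otimes>\<^bsub>free_group S\<^esub> u = \<one>\<^bsub>free_group S\<^esub>"
    by (auto simp: free_group_def)
qed (auto simp: free_group_def)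

definition letter_act :: "'a set \<Rightarrow> ('a \<Rightarrow> 'a) letter \<Rightarrow> 'a \<Rightarrow> 'a"
  where "letter_act X l = (if snd l then fst l else inv_into X (fst l))"

definition word_act :: "'a set \<Rightarrow> ('a \<Rightarrow> 'a) letter list \<Rightarrow> 'a \<Rightarrow> 'a"
  where "word_act X = foldr (letter_act X)"

definition Fix :: "'a set \<Rightarrow> ('a \<Rightarrow> 'a) letter list \<Rightarrow> 'a set"
  where "Fix X w = {x \<in> X. word_act X w x = x}"


section \<open>Warped systems\<close>

definition path_length :: "(real \<Rightarrow> 'a::metric_space) \<Rightarrow> ennreal"
where
  "path_length \<gamma> =
     (SUP (n, u) \<in> {(n :: nat, u). mono_on {..n} u \<and> u ` {..n} \<subseteq> {0..1}}.
        \<Sum>i<n. ennreal (dist (\<gamma> (u i)) (\<gamma> (u (Suc i)))))"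

definition path_in :: "'a::topological_space set \<Rightarrow> (real \<Rightarrow> 'a) \<Rightarrow> 'a \<Rightarrow> 'a \<Rightarrow> bool"
where
  "path_in X p x y \<longleftrightarrow> path p \<and> path_image p \<subseteq> X \<and> pathstart p = x \<and> pathfinish p = y"

text \<open>A jumping-path is given by \<open>n\<close>, the paths \<open>\<gamma> 0, \<dots>, \<gamma> n\<close> and the letters
  \<open>l 1, \<dots>, l n\<close>; other values of \<open>\<gamma>\<close> and \<open>l\<close> are irrelevant.\<close>

definition jumping_path ::
  "'a::metric_space set \<Rightarrow> ('a \<Rightarrow> 'a) set \<Rightarrow> nat \<Rightarrow> (nat \<Rightarrow> real \<Rightarrow> 'a) \<Rightarrow>
   (nat \<Rightarrow> ('a \<Rightarrow> 'a) letter) \<Rightarrow> bool"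
where
  "jumping_path X S n \<gamma> l \<longleftrightarrow>
     (\<forall>i\<le>n. path (\<gamma> i) \<and> path_image (\<gamma> i) \<subseteq> X) \<and>
     (\<forall>i\<in>{1..n}. fst (l i) \<in> S \<and>
        pathstart (\<gamma> i) = letter_act X (l i) (pathfinish (\<gamma> (i - 1))))"

definition jumping_path_length :: "real \<Rightarrow> nat \<Rightarrow> (nat \<Rightarrow> real \<Rightarrow> 'a::metric_space) \<Rightarrow> ennreal"
where
  "jumping_path_length t n \<gamma> = of_nat n + (\<Sum>i\<le>n. ennreal t * path_length (\<gamma> i))"

definition geodesic_set :: "'a::metric_space set \<Rightarrow> bool"
where
  "geodesic_set X \<longleftrightarrow>
     (\<forall>x\<in>X. \<forall>y\<in>X. \<exists>g :: real \<Rightarrow> 'a. g 0 = x \<and> g (dist x y) = y \<and>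
        g ` {0..dist x y} \<subseteq> X \<and>
        (\<forall>a\<in>{0..dist x y}. \<forall>b\<in>{0..dist x y}. dist (g a) (g b) = \<bar>a - b\<bar>))"

definition jumping_geodesic :: "'a::metric_space set \<Rightarrow> ('a \<Rightarrow> 'a) set \<Rightarrow> real \<Rightarrow> bool"
where
  "jumping_geodesic X S t \<longleftrightarrow>
     geodesic_set X \<and>
     (\<forall>x\<in>X. \<forall>y\<in>X. \<exists>n \<gamma> l. jumping_path X S n \<gamma> l \<and>
        pathstart (\<gamma> 0) = x \<and> pathfinish (\<gamma> n) = y \<and>
        jumping_path_length t n \<gamma> = ennreal (mdist (warped_metric X S t) x y))"

definition semilocally_simply_connected :: "'a::topological_space set \<Rightarrow> bool"
where
  "semilocally_simply_connected X \<longleftrightarrow>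
     (\<forall>x\<in>X. \<exists>U. openin (top_of_set X) U \<and> x \<in> U \<and>
        (\<forall>p. path_in U p x x \<longrightarrow> homotopic_paths X p (\<lambda>_. x)))"

text \<open>The generators are \<^const>\<open>extensional\<close> functions, so that distinct elements of \<open>S\<close> are
  distinct as self-maps of \<open>X\<close>.\<close>

locale warped_system =
  fixes X :: "'a::metric_space set" and S :: "('a \<Rightarrow> 'a) set"
  assumes finite_S: "finite S"
    and S_extensional: "S \<subseteq> extensional X"
    and S_homeomorphism: "\<And>s. s \<in> S \<Longrightarrow> \<exists>s'. homeomorphism X X s s'"
    and compact: "compact X"
    and path_connected: "path_connected X"
    and locally_path_connected: "locally path_connected X"
    and semilocally_simply_connected: "semilocally_simply_connected X"
    and finite_length:
      "\<And>p. path p \<Longrightarrow> path_image p \<subseteq> X \<Longrightarrow> \<exists>q. homotopic_paths X p q \<and> path_length q < \<infinity>"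
    and jumping_geodesic: "\<forall>\<^sub>F t in at_top. jumping_geodesic X S t"


section \<open>Group constructions\<close>

definition normal_closure :: "('a, 'b) monoid_scheme \<Rightarrow> 'a set \<Rightarrow> 'a set"
  where "normal_closure G K = \<Inter>{N. N \<lhd> G \<and> K \<subseteq> N}"

definition semidirect_product ::
  "('a, 'c) monoid_scheme \<Rightarrow> ('b, 'd) monoid_scheme \<Rightarrow> ('b \<Rightarrow> 'a \<Rightarrow> 'a) \<Rightarrow> ('a \<times> 'b) monoid"
where
  "semidirect_product N H \<phi> =
     \<lparr>carrier = carrier N \<times> carrier H,
      mult = (\<lambda>(n, h) (n', h'). (n \<otimes>\<^bsub>N\<^esub> \<phi> h n', h \<otimes>\<^bsub>H\<^esub> h')),
      one = (\<one>\<^bsub>N\<^esub>, \<one>\<^bsub>H\<^esub>)\<rparr>"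

definition direct_limit_rel ::
  "'i::linorder set \<Rightarrow> ('i \<Rightarrow> ('a, 'b) monoid_scheme) \<Rightarrow> ('i \<Rightarrow> 'i \<Rightarrow> 'a \<Rightarrow> 'a) \<Rightarrow>
   (('i \<times> 'a) \<times> ('i \<times> 'a)) set"
where
  "direct_limit_rel I G f =
     {((i, x), (j, y)). (i, x) \<in> Sigma I (\<lambda>i. carrier (G i)) \<and> (j, y) \<in> Sigma I (\<lambda>i. carrier (G i)) \<and>
        (\<exists>k\<in>I. i \<le> k \<and> j \<le> k \<and> f i k x = f j k y)}"

definition direct_limit ::
  "'i::linorder set \<Rightarrow> ('i \<Rightarrow> ('a, 'b) monoid_scheme) \<Rightarrow> ('i \<Rightarrow> 'i \<Rightarrow> 'a \<Rightarrow> 'a) \<Rightarrow>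
   ('i \<times> 'a) set monoid"
where
  "direct_limit I G f =
     \<lparr>carrier = Sigma I (\<lambda>i. carrier (G i)) // direct_limit_rel I G f,
      mult = (\<lambda>a b. direct_limit_rel I G f ``
        {(k, f i k x \<otimes>\<^bsub>G k\<^esub> f j k y) | i x j y k.
           (i, x) \<in> a \<and> (j, y) \<in> b \<and> k \<in> I \<and> i \<le> k \<and> j \<le> k}),
      one = direct_limit_rel I G f `` {(i, \<one>\<^bsub>G i\<^esub>) | i. i \<in> I}\<rparr>"

definition direct_limit_map ::
  "'i::linorder set \<Rightarrow> ('i \<Rightarrow> ('a, 'b) monoid_scheme) \<Rightarrow> ('i \<Rightarrow> 'i \<Rightarrow> 'a \<Rightarrow> 'a) \<Rightarrow>
   'i \<Rightarrow> 'a \<Rightarrow> ('i \<times> 'a) set"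
where
  "direct_limit_map I G f i x = direct_limit_rel I G f `` {(i, x)}"


section \<open>The fundamental group\<close>

definition path_class :: "'a::topological_space set \<Rightarrow> (real \<Rightarrow> 'a) \<Rightarrow> (real \<Rightarrow> 'a) set"
  where "path_class X p = {q. homotopic_paths X p q}"

definition fundamental_group ::
  "'a::topological_space set \<Rightarrow> 'a \<Rightarrow> (real \<Rightarrow> 'a) set monoid"
where
  "fundamental_group X x\<^sub>0 =
     \<lparr>carrier = {path_class X p | p. path_in X p x\<^sub>0 x\<^sub>0},
      mult = (\<lambda>a b. \<Union>p\<in>a. \<Union>q\<in>b. path_class X (p +++ q)),
      one = path_class X (\<lambda>_. x\<^sub>0)\<rparr>"


section \<open>The limit group\<close>

definition connecting_paths ::
  "'a::topological_space set \<Rightarrow> ('a \<Rightarrow> 'a) set \<Rightarrow> 'a \<Rightarrow> (('a \<Rightarrow> 'a) \<Rightarrow> real \<Rightarrow> 'a) \<Rightarrow> bool"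
where
  "connecting_paths X S x\<^sub>0 \<alpha> \<longleftrightarrow> x\<^sub>0 \<in> X \<and> (\<forall>s\<in>S. path_in X (\<alpha> s) x\<^sub>0 (s x\<^sub>0))"

definition letter_path ::
  "'a::topological_space set \<Rightarrow> (('a \<Rightarrow> 'a) \<Rightarrow> real \<Rightarrow> 'a) \<Rightarrow> ('a \<Rightarrow> 'a) letter \<Rightarrow> real \<Rightarrow> 'a"
where
  "letter_path X \<alpha> l =
     (if snd l then \<alpha> (fst l) else letter_act X l \<circ> reversepath (\<alpha> (fst l)))"

text \<open>The path \<open>\<alpha>\<^sub>w\<close>.  It only matters up to homotopy, so the bracketing of the
  concatenation and the trailing constant path are harmless.\<close>

fun word_path ::
  "'a::topological_space set \<Rightarrow> 'a \<Rightarrow> (('a \<Rightarrow> 'a) \<Rightarrow> real \<Rightarrow> 'a) \<Rightarrow> ('a \<Rightarrow> 'a) letter list \<Rightarrow>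
   real \<Rightarrow> 'a"
where
  "word_path X x\<^sub>0 \<alpha> [] = (\<lambda>_. x\<^sub>0)"
| "word_path X x\<^sub>0 \<alpha> (l # w) = letter_path X \<alpha> l +++ (letter_act X l \<circ> word_path X x\<^sub>0 \<alpha> w)"

definition conj_action ::
  "'a::topological_space set \<Rightarrow> 'a \<Rightarrow> (('a \<Rightarrow> 'a) \<Rightarrow> real \<Rightarrow> 'a) \<Rightarrow> ('a \<Rightarrow> 'a) letter list \<Rightarrow>
   (real \<Rightarrow> 'a) set \<Rightarrow> (real \<Rightarrow> 'a) set"
where
  "conj_action X x\<^sub>0 \<alpha> w c =
     (\<Union>\<gamma>\<in>c. path_class X
        (word_path X x\<^sub>0 \<alpha> w +++ (word_act X w \<circ> \<gamma>) +++ reversepath (word_path X x\<^sub>0 \<alpha> w)))"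

definition jumping_group ::
  "'a::topological_space set \<Rightarrow> ('a \<Rightarrow> 'a) set \<Rightarrow> 'a \<Rightarrow> (('a \<Rightarrow> 'a) \<Rightarrow> real \<Rightarrow> 'a) \<Rightarrow>
   ((real \<Rightarrow> 'a) set \<times> ('a \<Rightarrow> 'a) letter list) monoid"
where
  "jumping_group X S x\<^sub>0 \<alpha> =
     semidirect_product (fundamental_group X x\<^sub>0) (free_group S) (conj_action X x\<^sub>0 \<alpha>)"

definition K_set ::
  "'a::topological_space set \<Rightarrow> ('a \<Rightarrow> 'a) set \<Rightarrow> 'a \<Rightarrow> (('a \<Rightarrow> 'a) \<Rightarrow> real \<Rightarrow> 'a) \<Rightarrow> nat \<Rightarrow>
   ((real \<Rightarrow> 'a) set \<times> ('a \<Rightarrow> 'a) letter list) set"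
where
  "K_set X S x\<^sub>0 \<alpha> \<theta> =
     {(path_class X (\<beta> +++ (word_act X w \<circ> reversepath \<beta>) +++ reversepath (word_path X x\<^sub>0 \<alpha> w)), w)
       | \<beta> w x. w \<in> carrier (free_group S) \<and> length w \<le> 4 * \<theta> \<and>
                x \<in> Fix X w \<and> path_in X \<beta> x\<^sub>0 x}"

definition pi1_theta ::
  "'a::topological_space set \<Rightarrow> ('a \<Rightarrow> 'a) set \<Rightarrow> 'a \<Rightarrow> (('a \<Rightarrow> 'a) \<Rightarrow> real \<Rightarrow> 'a) \<Rightarrow> nat \<Rightarrow>
   ((real \<Rightarrow> 'a) set \<times> ('a \<Rightarrow> 'a) letter list) set monoid"
where
  "pi1_theta X S x\<^sub>0 \<alpha> \<theta> =
     jumping_group X S x\<^sub>0 \<alpha> Mod normal_closure (jumping_group X S x\<^sub>0 \<alpha>) (K_set X S x\<^sub>0 \<alpha> \<theta>)"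

text \<open>For \<open>\<theta> \<le> \<theta>'\<close>, the natural map between the quotients by \<open>N \<subseteq> N'\<close>: it sends
  the coset \<open>N g\<close> to \<open>N' (N g) = N' g\<close>.\<close>

definition pi1_quot_map ::
  "'a::topological_space set \<Rightarrow> ('a \<Rightarrow> 'a) set \<Rightarrow> 'a \<Rightarrow> (('a \<Rightarrow> 'a) \<Rightarrow> real \<Rightarrow> 'a) \<Rightarrow> nat \<Rightarrow> nat \<Rightarrow>
   ((real \<Rightarrow> 'a) set \<times> ('a \<Rightarrow> 'a) letter list) set \<Rightarrow>
   ((real \<Rightarrow> 'a) set \<times> ('a \<Rightarrow> 'a) letter list) set"
where
  "pi1_quot_map X S x\<^sub>0 \<alpha> \<theta> \<theta>' C =
     normal_closure (jumping_group X S x\<^sub>0 \<alpha>) (K_set X S x\<^sub>0 \<alpha> \<theta>') <#>\<^bsub>jumping_group X S x\<^sub>0 \<alpha>\<^esub> C"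

definition pi1_infinity ::
  "'a::topological_space set \<Rightarrow> ('a \<Rightarrow> 'a) set \<Rightarrow> 'a \<Rightarrow> (('a \<Rightarrow> 'a) \<Rightarrow> real \<Rightarrow> 'a) \<Rightarrow>
   (nat \<times> ((real \<Rightarrow> 'a) set \<times> ('a \<Rightarrow> 'a) letter list) set) set monoid"
where
  "pi1_infinity X S x\<^sub>0 \<alpha> =
     direct_limit {1..} (pi1_theta X S x\<^sub>0 \<alpha>) (pi1_quot_map X S x\<^sub>0 \<alpha>)"

definition stable_discrete_fundamental_group ::
  "'a::topological_space set \<Rightarrow> ('a \<Rightarrow> 'a) set \<Rightarrow> 'a \<Rightarrow> (('a \<Rightarrow> 'a) \<Rightarrow> real \<Rightarrow> 'a) \<Rightarrow> bool"
where
  "stable_discrete_fundamental_group X S x\<^sub>0 \<alpha> \<longleftrightarrow>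
     (\<exists>\<theta>\<ge>1. direct_limit_map {1..} (pi1_theta X S x\<^sub>0 \<alpha>) (pi1_quot_map X S x\<^sub>0 \<alpha>) \<theta>
              \<in> iso (pi1_theta X S x\<^sub>0 \<alpha> \<theta>) (pi1_infinity X S x\<^sub>0 \<alpha>))"

end

theory Submission
  imports Defs
begin

text \<open>A warped system has a groupoid of morphisms \<open>(p, w) : x \<rightarrow> y\<close>, where \<open>w\<close> is a word and \<open>p\<close> a
  homotopy class of paths from \<open>x\<close> to \<open>w y\<close>; its vertex group at the base point is
  \<open>\<pi>\<^sub>1(X) \<rtimes> F\<^sub>S\<close>.  A \<open>\<theta>\<close>-cocycle on \<open>(X, \<delta>\<^sup>t)\<close> assigns group elements to the pairs of points at
  distance at most \<open>\<theta>\<close>, so that the product around every quadrilateral with such sides is trivial.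
  Multiplying along subdivided paths turns a \<open>\<theta>\<close>-cocycle into a homomorphism on the groupoid that
  kills \<open>K\<^sub>\<theta>\<close>: a closed chain of \<open>4\<theta>\<close> jumps is a quadrilateral.  Conversely, for large \<open>t\<close> a
  homomorphism that kills \<open>K\<^sub>\<theta>\<close> comes from a \<open>\<theta>\<close>-cocycle: points at distance at most \<open>\<theta>\<close> are joined by
  a short morphism, and four short morphisms compose to some \<open>(p, w)\<close> with \<open>p\<close> tiny and
  \<open>|w| \<le> 4\<theta>\<close>, so \<open>w\<close> has a fixed point nearby.  Discrete fundamental groups never occur explicitly.

  Cocycles pull back along coarsely Lipschitz maps.  Starting from the projection of
  \<open>\<pi>\<^sub>1(Y) \<rtimes> F\<^sub>T\<close> onto its quotient by \<open>K\<^sub>\<theta>\<close>, this gives homomorphisms between the groups of \<open>X\<close> and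
  \<open>Y\<close> in both directions, whose composites are conjugate to the projections, because \<open>f \<circ> f'\<close> is
  close to the identity.  Stability of \<open>X\<close> then passes to \<open>Y\<close>, and the limit groups agree.\<close>

section \<open>Groups acting on themselves\<close>

text \<open>The obstacle is the loss of scale. A map with coarse constant \<open>K\<close> pulls a
  cocycle at scale \<open>K * n\<close> back to one at scale \<open>n\<close>, so a composite of
  induced homomorphisms compares quotients at different scales. Stability removes this on one side:
  once \<open>kill\<close> is constant on X from \<open>a\<close> on, the same quotient of the group
  of X is realised by cocycles of every scale. Take one at scale \<open>K * \<theta>\<close> with
  \<theta> at least \<open>K * a\<close>. Its pullback to Y is trivial on
  \<open>kill \<theta>\<close>, and returning through the fixed scale \<open>a\<close> gives a
  conjugate of the projection modulo \<open>kill (K * a)\<close>. Hence \<open>kill \<theta>\<close>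
  lies in \<open>kill (K * a)\<close>: Y is stable too, and one common scale then serves both
  systems.

  The factor 4 in \<open>K_set\<close> reflects the four sides of a unit square of a grid homotopy.
  Testing cocycles on quadrilaterals matches it exactly, so that no scale is lost between cocycles
  and homomorphisms. Conjugations appear because coarse maps move base points; they do not affect
  kernels, nor images once the conjugating element is known to lie in the image.\<close>

text \<open>Every group embeds into the permutations of its carrier, so the values of cocycles can be taken in
  a type of class \<^class>\<open>group_add\<close> (not commutative), without carrier conditions.\<close>

typedef 'a bijection = "{f :: 'a \<Rightarrow> 'a. bij f}"
  by (rule exI[of _ id]) simp

instantiation bijection :: (type) group_add
begin

definition "0 = Abs_bijection id"
definition "a + b = Abs_bijection (Rep_bijection a \<circ> Rep_bijection b)"
definition "uminus a = Abs_bijection (Hilbert_Choice.inv (Rep_bijection a))"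
definition "a - b = a + uminus (b :: 'a bijection)"

instance
proof
  fix a b c :: "'a bijection"
  have bij: "bij (Rep_bijection a)" for a :: "'a bijection"
    using Rep_bijection by auto
  note Abs = Abs_bijection_inverse[unfolded mem_Collect_eq]
  show "a + b + c = a + (b + c)"
    by (simp add: plus_bijection_def Abs bij bij_comp o_assoc)
  show "0 + a = a" "a + 0 = a"
    by (simp_all add: plus_bijection_def zero_bijection_def Abs Rep_bijection_inverse)
  show "- a + a = 0"
    using bij[of a]
    by (simp add: plus_bijection_def zero_bijection_def uminus_bijection_def Abs bij_imp_bij_inv
        bij_is_inj)
qed (simp add: minus_bijection_def)

end

text \<open>Applied to f 1 = f (1 * 1), this shows that a map turning products into sums sends the
  unit to 0.\<close>

lemma eq_add_self_iff: "a = a + b \<longleftrightarrow> b = (0 :: 'v::group_add)"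
  using add_left_cancel[of a 0 b] by auto

text \<open>Cayley's embedding. Outside the carrier the map is the identity, which makes it a
  bijection of the whole type.\<close>

definition left_translation :: "('a, 'b) monoid_scheme \<Rightarrow> 'a \<Rightarrow> 'a bijection"
  where "left_translation G g = Abs_bijection (\<lambda>x. if x \<in> carrier G then g \<otimes>\<^bsub>G\<^esub> x else x)"

context group
begin

lemma Rep_left_translation:
  assumes "g \<in> carrier G"
  shows "Rep_bijection (left_translation G g) = (\<lambda>x. if x \<in> carrier G then g \<otimes> x else x)"
proof -
  have "bij (\<lambda>x. if x \<in> carrier G then g \<otimes> x else x)"
    by (rule o_bij[of "\<lambda>x. if x \<in> carrier G then inv g \<otimes> x else x"])
       (use assms in \<open>auto simp: fun_eq_iff m_assoc[symmetric]\<close>)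
  then show ?thesis
    by (simp add: left_translation_def Abs_bijection_inverse)
qed

lemma left_translation_mult:
  assumes "g \<in> carrier G" "h \<in> carrier G"
  shows "left_translation G (g \<otimes> h) = left_translation G g + left_translation G h"
proof -
  have "Rep_bijection (left_translation G (g \<otimes> h)) =
      Rep_bijection (left_translation G g) \<circ> Rep_bijection (left_translation G h)"
    using assms by (auto simp: Rep_left_translation m_assoc)
  then show ?thesis
    by (metis Rep_bijection_inverse plus_bijection_def)
qed

lemma left_translation_eq_iff:
  assumes "g \<in> carrier G" "h \<in> carrier G"
  shows "left_translation G g = left_translation G h \<longleftrightarrow> g = h"
proof
  assume "left_translation G g = left_translation G h"
  then have "Rep_bijection (left_translation G g) \<one> = Rep_bijection (left_translation G h) \<one>"
    by simp
  with assms show "g = h"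
    by (simp add: Rep_left_translation)
qed simp

end

text \<open>The projection of G onto G / N followed by Cayley's embedding: a homomorphism with
  kernel N into a type of class \<open>group_add\<close>. With N = \<open>kill \<theta>\<close> it
  provides the coefficients of the cocycles.\<close>

definition quotient_translation :: "('a, 'b) monoid_scheme \<Rightarrow> 'a set \<Rightarrow> 'a \<Rightarrow> 'a set bijection"
  where "quotient_translation G N g = left_translation (G Mod N) (N #>\<^bsub>G\<^esub> g)"

context normal
begin

lemma quotient_translation_mult:
  assumes "x \<in> carrier G" "y \<in> carrier G"
  shows "quotient_translation G H (x \<otimes> y) = quotient_translation G H x + quotient_translation G H y"
proof -
  have "H #> (x \<otimes> y) = (H #> x) \<otimes>\<^bsub>G Mod H\<^esub> (H #> y)"
    using assms by (simp add: rcos_sum)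
  then show ?thesis
    using assms unfolding quotient_translation_def
    by (simp only: group.left_translation_mult[OF factorgroup_is_group] carrier_FactGroup imageI)
qed

lemma quotient_translation_eq_iff:
  assumes "x \<in> carrier G" "y \<in> carrier G"
  shows "quotient_translation G H x = quotient_translation G H y \<longleftrightarrow> H #> x = H #> y"
  using assms factorgroup_is_group
  by (simp add: quotient_translation_def group.left_translation_eq_iff carrier_FactGroup)

lemma quotient_translation_eq_0_iff:
  assumes "x \<in> carrier G"
  shows "quotient_translation G H x = 0 \<longleftrightarrow> x \<in> H"
proof -
  have "quotient_translation G H \<one> = 0"
    using quotient_translation_mult[of \<one> \<one>] by (simp add: eq_add_self_iff)
  then have "quotient_translation G H x = 0 \<longleftrightarrow> H #> x = H #> \<one>"
    using quotient_translation_eq_iff[OF assms, of \<one>] by simp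
  also have "\<dots> \<longleftrightarrow> x \<in> H"
    using coset_join1[OF _ assms is_subgroup] coset_join2[OF assms is_subgroup]
      coset_mult_one[OF subset] by auto
  finally show ?thesis .
qed

end

section \<open>Path functors and the fundamental group\<close>

lemma path_in_join: "path_in X p x y \<Longrightarrow> path_in X q y z \<Longrightarrow> path_in X (p +++ q) x z"
  by (auto simp: path_in_def path_image_join)

lemma path_in_reversepath: "path_in X p x y \<Longrightarrow> path_in X (reversepath p) y x"
  by (auto simp: path_in_def)

lemma path_in_const: "x \<in> X \<Longrightarrow> path_in X (\<lambda>_. x) x x"
  by (auto simp: path_in_def path_def path_image_def pathstart_def pathfinish_def)

lemma path_in_compose:
  "path_in X p x y \<Longrightarrow> continuous_on X f \<Longrightarrow> f ` X \<subseteq> Y \<Longrightarrow> path_in Y (f \<circ> p) (f x) (f y)"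
  by (auto simp: path_in_def path_image_compose pathstart_compose pathfinish_compose
      intro!: path_continuous_image elim: continuous_on_subset)

lemma path_in_image_mem: "path_in X p x y \<Longrightarrow> u \<in> {0..1} \<Longrightarrow> p u \<in> X"
  by (auto simp: path_in_def path_image_def)

lemma path_in_mem: "path_in X p x y \<Longrightarrow> x \<in> X \<and> y \<in> X"
  by (auto simp: path_in_def)

text \<open>Paths in the interval with equal ends are homotopic by convexity, and \<open>p\<close>
  carries the homotopy to X. In the unit and inverse laws below both sides reparametrise one
  path.\<close>

lemma homotopic_paths_interval:
  assumes "path p" "path_image p \<subseteq> X"
    and "path f" "path_image f \<subseteq> {0..1}" "path g" "path_image g \<subseteq> {0..1}"
    and "pathstart f = pathstart g" "pathfinish f = pathfinish g"
  shows "homotopic_paths X (p \<circ> f) (p \<circ> g)"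
proof (rule homotopic_paths_continuous_image)
  show "homotopic_paths {0..1::real} f g"
  proof (rule homotopic_paths_linear)
    fix u :: real assume "u \<in> {0..1}"
    then have "f u \<in> {0..1}" "g u \<in> {0..1}"
      using assms by (auto simp: path_image_def image_subset_iff)
    then show "closed_segment (f u) (g u) \<subseteq> {0..1}"
      using closed_segment_subset[of "f u" "{0..1}" "g u"] convex_real_interval(5)[of 0 "1 :: real"]
      by blast
  qed (use assms in auto)
  show "continuous_on {0..1} p" "p \<in> {0..1} \<rightarrow> X"
    using assms by (auto simp: path_def path_image_def)
qed

lemma homotopic_paths_join_const:
  assumes "path_in X p x y"
  shows "homotopic_paths X (p +++ (\<lambda>_. y)) p"
proof -
  have "homotopic_paths X (p \<circ> (linepath 0 1 +++ linepath 1 1)) (p \<circ> linepath 0 1)"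
    using assms by (intro homotopic_paths_interval) (auto simp: path_in_def path_image_join closed_segment_eq_real_ivl)
  moreover have "p \<circ> (linepath 0 1 +++ linepath 1 1) = p +++ (\<lambda>_. y)" "p \<circ> linepath 0 1 = p"
    using assms by (auto simp: path_in_def joinpaths_def linepath_def pathfinish_def fun_eq_iff)
  ultimately show ?thesis by simp
qed

lemma homotopic_paths_const_join:
  assumes "path_in X p x y"
  shows "homotopic_paths X ((\<lambda>_. x) +++ p) p"
proof -
  have "homotopic_paths X (p \<circ> (linepath 0 0 +++ linepath 0 1)) (p \<circ> linepath 0 1)"
    using assms by (intro homotopic_paths_interval) (auto simp: path_in_def path_image_join closed_segment_eq_real_ivl)
  moreover have "p \<circ> (linepath 0 0 +++ linepath 0 1) = (\<lambda>_. x) +++ p" "p \<circ> linepath 0 1 = p"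
    using assms by (auto simp: path_in_def joinpaths_def linepath_def pathstart_def fun_eq_iff)
  ultimately show ?thesis by simp
qed

lemma homotopic_paths_join_reversepath:
  assumes "path_in X p x y"
  shows "homotopic_paths X (p +++ reversepath p) (\<lambda>_. x)"
proof -
  have "homotopic_paths X (p \<circ> (linepath 0 1 +++ linepath 1 0)) (p \<circ> linepath 0 0)"
    using assms by (intro homotopic_paths_interval)
      (auto simp: path_in_def path_image_join closed_segment_eq_real_ivl)
  moreover have "p \<circ> (linepath 0 1 +++ linepath 1 0) = p +++ reversepath p" "p \<circ> linepath 0 0 = (\<lambda>_. x)"
    using assms
    by (auto simp: path_in_def joinpaths_def linepath_def pathstart_def fun_eq_iff reversepath_def)
  ultimately show ?thesis by simp
qed

lemma homotopic_paths_reversepath_join: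
  assumes "path_in X p x y"
  shows "homotopic_paths X (reversepath p +++ p) (\<lambda>_. y)"
  using homotopic_paths_join_reversepath[OF path_in_reversepath[OF assms]] by simp

lemma homotopic_paths_join_assoc:
  assumes "path_in X p x y" "path_in X q y z" "path_in X r z w"
  shows "homotopic_paths X ((p +++ q) +++ r) (p +++ q +++ r)"
  using assms by (intro homotopic_paths_sym[OF homotopic_paths_assoc]) (auto simp: path_in_def)

lemma homotopic_paths_join_left:
  assumes "path_in X a x y" "path_in X p y z" "homotopic_paths X p q"
  shows "homotopic_paths X (a +++ p) (a +++ q)"
  using assms by (intro homotopic_paths_join) (auto simp: path_in_def)

lemma homotopic_paths_join_right:
  assumes "path_in X p x y" "path_in X a y z" "homotopic_paths X p q"
  shows "homotopic_paths X (p +++ a) (q +++ a)"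
  using assms by (intro homotopic_paths_join) (auto simp: path_in_def)

section \<open>Path classes and the group of loops\<close>

lemma path_class_eqI: "homotopic_paths X p q \<Longrightarrow> path_class X p = path_class X q"
  unfolding path_class_def by (blast intro: homotopic_paths_sym homotopic_paths_trans)

text \<open>\<open>fundamental_group\<close> and \<open>conj_action\<close> are defined by unions
  over all representatives. For an operation that respects homotopy all members of the union
  coincide, so one representative computes it.\<close>

lemma UN_path_class:
  assumes "path_in X p x y"
    and "\<And>q. homotopic_paths X p q \<Longrightarrow> homotopic_paths X (F p) (F q)"
  shows "(\<Union>q\<in>path_class X p. path_class X (F q)) = path_class X (F p)"
proof -
  have "p \<in> path_class X p"
    using assms by (simp add: path_class_def path_in_def)
  moreover have "path_class X (F q) = path_class X (F p)" if "q \<in> path_class X p" for q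
    using that assms(2) by (intro path_class_eqI[symmetric]) (simp add: path_class_def)
  then have "(\<Union>q\<in>path_class X p. path_class X (F q)) = (\<Union>q\<in>path_class X p. path_class X (F p))"
    by (intro SUP_cong refl)
  moreover have "path_class X p \<noteq> {}"
    using \<open>p \<in> path_class X p\<close> by blast
  ultimately show ?thesis by simp
qed

lemma carrier_fundamental_group:
  "a \<in> carrier (fundamental_group X x) \<longleftrightarrow> (\<exists>p. path_in X p x x \<and> a = path_class X p)"
  by (simp add: fundamental_group_def) blast

text \<open>The product does not refer to the base point, so composable paths that are not loops are
  allowed.\<close>

lemma mult_path_class:
  assumes "path_in X p x y" "path_in X q y z"
  shows "path_class X p \<otimes>\<^bsub>fundamental_group X x0\<^esub> path_class X q = path_class X (p +++ q)"
proof -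
  have p: "homotopic_paths X p p" and q: "homotopic_paths X q q" and pq: "pathfinish p = pathstart q"
    using assms by (auto simp: path_in_def)
  have "(\<Union>q'\<in>path_class X q. path_class X (p' +++ q')) = path_class X (p' +++ q)"
    if "homotopic_paths X p p'" for p'
  proof (rule UN_path_class[OF assms(2)])
    fix q' assume "homotopic_paths X q q'"
    moreover have "homotopic_paths X p' p'"
      using homotopic_paths_imp_path[OF that] homotopic_paths_imp_subset[OF that] by simp
    ultimately show "homotopic_paths X (p' +++ q) (p' +++ q')"
      using that pq homotopic_paths_imp_pathfinish[OF that] by (intro homotopic_paths_join) auto
  qed
  then have "path_class X p \<otimes>\<^bsub>fundamental_group X x0\<^esub> path_class X q
      = (\<Union>p'\<in>path_class X p. path_class X (p' +++ q))"
    by (auto simp: fundamental_group_def path_class_def[of X p])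
  also have "\<dots> = path_class X (p +++ q)"
    by (rule UN_path_class[OF assms(1)]) (use q pq in \<open>auto intro: homotopic_paths_join\<close>)
  finally show ?thesis .
qed

lemma group_fundamental_group:
  assumes "x \<in> X"
  shows "group (fundamental_group X x)"
proof (rule groupI)
  let ?G = "fundamental_group X x"
  have one: "\<one>\<^bsub>?G\<^esub> = path_class X (\<lambda>_. x)"
    by (simp add: fundamental_group_def)
  show "\<one>\<^bsub>?G\<^esub> \<in> carrier ?G"
    using path_in_const[OF assms] by (auto simp: one carrier_fundamental_group)
  fix a assume "a \<in> carrier ?G"
  then obtain p where p: "path_in X p x x" "a = path_class X p"
    by (auto simp: carrier_fundamental_group)
  show "\<one>\<^bsub>?G\<^esub> \<otimes>\<^bsub>?G\<^esub> a = a"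
    using p assms
    by (simp add: one mult_path_class[OF path_in_const] path_class_eqI[OF homotopic_paths_const_join])
  show "\<exists>b\<in>carrier ?G. b \<otimes>\<^bsub>?G\<^esub> a = \<one>\<^bsub>?G\<^esub>"
  proof
    show "path_class X (reversepath p) \<in> carrier ?G"
      using p by (auto simp: carrier_fundamental_group intro: path_in_reversepath)
    show "path_class X (reversepath p) \<otimes>\<^bsub>?G\<^esub> a = \<one>\<^bsub>?G\<^esub>"
      using p by (simp add: one mult_path_class[OF path_in_reversepath[OF p(1)] p(1)]
          path_class_eqI[OF homotopic_paths_reversepath_join[OF p(1)]])
  qed
  fix b assume "b \<in> carrier ?G"
  then obtain q where q: "path_in X q x x" "b = path_class X q"
    by (auto simp: carrier_fundamental_group)
  show "a \<otimes>\<^bsub>?G\<^esub> b \<in> carrier ?G"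
    using p q by (auto simp: carrier_fundamental_group mult_path_class intro: path_in_join)
  fix c assume "c \<in> carrier ?G"
  then obtain r where r: "path_in X r x x" "c = path_class X r"
    by (auto simp: carrier_fundamental_group)
  show "a \<otimes>\<^bsub>?G\<^esub> b \<otimes>\<^bsub>?G\<^esub> c = a \<otimes>\<^bsub>?G\<^esub> (b \<otimes>\<^bsub>?G\<^esub> c)"
    using mult_path_class[OF path_in_join[OF p(1) q(1)] r(1)]
      mult_path_class[OF p(1) path_in_join[OF q(1) r(1)]]
      mult_path_class[OF p(1) q(1)] mult_path_class[OF q(1) r(1)]
      path_class_eqI[OF homotopic_paths_join_assoc[OF p(1) q(1) r(1)]] p q r
    by simp
qed

text \<open>A functor from the fundamental groupoid of X to a group, on representatives instead of
  classes.\<close>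

locale path_functor =
  fixes X :: "'a::topological_space set" and h :: "(real \<Rightarrow> 'a) \<Rightarrow> 'v::group_add"
  assumes join: "path_in X p x y \<Longrightarrow> path_in X q y z \<Longrightarrow> h (p +++ q) = h p + h q"
    and homotopic: "homotopic_paths X p q \<Longrightarrow> h p = h q"
begin

lemma const: "x \<in> X \<Longrightarrow> h (\<lambda>_. x) = 0"
  using join[OF path_in_const path_in_const, of x] homotopic[OF homotopic_paths_join_const[OF path_in_const], of x]
  by (simp add: eq_add_self_iff)

lemma reverse:
  assumes "path_in X p x y"
  shows "h (reversepath p) = - h p"
proof -
  have "h p + h (reversepath p) = h (p +++ reversepath p)"
    using join[OF assms path_in_reversepath[OF assms]] by simp
  also have "\<dots> = h (\<lambda>_. x)"
    by (rule homotopic[OF homotopic_paths_join_reversepath[OF assms]])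
  also have "\<dots> = 0"
    using const path_in_mem[OF assms] by blast
  finally show ?thesis
    by (metis minus_unique)
qed

text \<open>A path is a function on all reals; agreement on the unit interval makes paths homotopic
  but not equal.\<close>

lemma cong: "path_in X p x y \<Longrightarrow> (\<And>u. u \<in> {0..1} \<Longrightarrow> q u = p u) \<Longrightarrow> h q = h p"
  by (metis homotopic homotopic_paths_eq path_in_def)

lemma compose:
  assumes "continuous_on X f" "f ` X \<subseteq> X"
  shows "path_functor X (\<lambda>p. h (f \<circ> p))"
proof
  fix p q x y z assume "path_in X p x y" "path_in X q y z"
  then show "h (f \<circ> (p +++ q)) = h (f \<circ> p) + h (f \<circ> q)"
    using assms join[OF path_in_compose[of X p x y f X] path_in_compose[of X q y z f X]]
    by (simp add: path_compose_join)
next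
  fix p q assume "homotopic_paths X p q"
  then show "h (f \<circ> p) = h (f \<circ> q)"
    using assms by (intro homotopic homotopic_paths_continuous_image) auto
qed

end

text \<open>The constant path is chosen at \<open>x0\<close>, so that \<open>loop_functor\<close>
  evaluates a loop at \<open>x0\<close> without a conjugation.\<close>

definition base_path :: "'a::topological_space set \<Rightarrow> 'a \<Rightarrow> 'a \<Rightarrow> real \<Rightarrow> 'a"
  where "base_path X x0 x = (if x = x0 then (\<lambda>_. x0) else (SOME p. path_in X p x0 x))"

text \<open>Extends a homomorphism on the vertex group at \<open>x0\<close> to the whole groupoid,
  normalised to vanish on the chosen base paths.\<close>

definition loop_functor ::
  "'a::topological_space set \<Rightarrow> 'a \<Rightarrow> ((real \<Rightarrow> 'a) set \<Rightarrow> 'v) \<Rightarrow> (real \<Rightarrow> 'a) \<Rightarrow> 'v"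
  where "loop_functor X x0 \<kappa> p =
    \<kappa> (path_class X (base_path X x0 (pathstart p) +++ p +++ reversepath (base_path X x0 (pathfinish p))))"

lemma base_path:
  assumes "path_connected X" "x0 \<in> X" "x \<in> X"
  shows "path_in X (base_path X x0 x) x0 x"
proof (cases "x = x0")
  case False
  have "\<exists>p. path_in X p x0 x"
    using assms by (auto simp: path_connected_def path_in_def)
  then show ?thesis
    using False someI_ex[of "\<lambda>p. path_in X p x0 x"] by (simp add: base_path_def)
qed (simp add: base_path_def path_in_const assms)

text \<open>Closing up \<open>p\<close> and \<open>q\<close> separately inserts between them the
  return from y to \<open>x0\<close> and the way back to y. These cancel; the chain of homotopies
  carries this out together with the reassociations around it.\<close>

lemma
  assumes X: "path_connected X" "x0 \<in> X"
    and \<kappa>: "\<And>a b. a \<in> carrier (fundamental_group X x0) \<Longrightarrow> b \<in> carrier (fundamental_group X x0) \<Longrightarrow>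
      \<kappa> (a \<otimes>\<^bsub>fundamental_group X x0\<^esub> b) = (\<kappa> a + \<kappa> b :: 'v::group_add)"
  shows path_functor_loop_functor: "path_functor X (loop_functor X x0 \<kappa>)"
    and loop_functor_loop: "\<And>p. path_in X p x0 x0 \<Longrightarrow> loop_functor X x0 \<kappa> p = \<kappa> (path_class X p)"
    and loop_functor_base_path: "\<And>x. x \<in> X \<Longrightarrow> loop_functor X x0 \<kappa> (base_path X x0 x) = 0"
proof -
  note bp = base_path[OF X]
  have hp: "homotopic_paths X p p" if "path_in X p x y" for p x y
    using that by (auto simp: path_in_def)
  have eq: "loop_functor X x0 \<kappa> p = \<kappa> (path_class X (base_path X x0 x +++ p +++ reversepath (base_path X x0 y)))"
    if "path_in X p x y" for p x y
    using that by (auto simp: loop_functor_def path_in_def)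
  have mult: "\<kappa> (path_class X (p +++ q)) = \<kappa> (path_class X p) + \<kappa> (path_class X q)"
    if "path_in X p x0 x0" "path_in X q x0 x0" for p q
    using \<kappa>[of "path_class X p" "path_class X q"] that
    by (auto simp: carrier_fundamental_group mult_path_class[OF that])
  show PF: "path_functor X (loop_functor X x0 \<kappa>)"
  proof
    fix p q x y z assume p: "path_in X p x y" and q: "path_in X q y z"
    then have xyz: "x \<in> X" "y \<in> X" "z \<in> X"
      by (auto dest: path_in_mem)
    define a b c where "a = base_path X x0 x" "b = base_path X x0 y" "c = base_path X x0 z"
    note abc = bp[OF xyz(1), folded a_b_c_def] bp[OF xyz(2), folded a_b_c_def] bp[OF xyz(3), folded a_b_c_def]
    note rabc = abc[THEN path_in_reversepath]
    note bpq = path_in_join[OF abc(2) path_in_join[OF q rabc(3)]]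
    note pj = path_in_join
    note assoc = homotopic_paths_join_assoc and cong = homotopic_paths_join_left
    have "homotopic_paths X ((a +++ p +++ reversepath b) +++ b +++ q +++ reversepath c)
        (a +++ (p +++ reversepath b) +++ b +++ q +++ reversepath c)"
      by (rule assoc[OF abc(1) pj[OF p rabc(2)] bpq])
    also have "homotopic_paths X \<dots> (a +++ p +++ reversepath b +++ b +++ q +++ reversepath c)"
      by (rule cong[OF abc(1) pj[OF pj[OF p rabc(2)] bpq] assoc[OF p rabc(2) bpq]])
    also have "homotopic_paths X \<dots> (a +++ p +++ (reversepath b +++ b) +++ q +++ reversepath c)"
      by (rule cong[OF abc(1) pj[OF p pj[OF rabc(2) bpq]]
            cong[OF p pj[OF rabc(2) bpq] homotopic_paths_sym[OF assoc[OF rabc(2) abc(2) pj[OF q rabc(3)]]]]])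
    also have "homotopic_paths X \<dots> (a +++ p +++ (\<lambda>_. y) +++ q +++ reversepath c)"
      by (rule cong[OF abc(1) pj[OF p pj[OF pj[OF rabc(2) abc(2)] pj[OF q rabc(3)]]]
            cong[OF p pj[OF pj[OF rabc(2) abc(2)] pj[OF q rabc(3)]]
            homotopic_paths_join_right[OF pj[OF rabc(2) abc(2)] pj[OF q rabc(3)]
            homotopic_paths_reversepath_join[OF abc(2)]]]])
    also have "homotopic_paths X \<dots> (a +++ p +++ q +++ reversepath c)"
      using path_in_const[OF xyz(2)]
      by (intro cong[OF abc(1) pj[OF p pj[OF _ pj[OF q rabc(3)]]]] cong[OF p pj[OF _ pj[OF q rabc(3)]]]
           homotopic_paths_const_join[OF pj[OF q rabc(3)]])
    also have "homotopic_paths X \<dots> (a +++ (p +++ q) +++ reversepath c)"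
      by (rule cong[OF abc(1) pj[OF p pj[OF q rabc(3)]] homotopic_paths_sym[OF assoc[OF p q rabc(3)]]])
    finally have "path_class X (a +++ (p +++ q) +++ reversepath c) =
        path_class X ((a +++ p +++ reversepath b) +++ b +++ q +++ reversepath c)"
      by (metis path_class_eqI)
    moreover have "path_in X (a +++ p +++ reversepath b) x0 x0" "path_in X (b +++ q +++ reversepath c) x0 x0"
      using abc rabc p q by (auto intro: pj)
    ultimately show "loop_functor X x0 \<kappa> (p +++ q) = loop_functor X x0 \<kappa> p + loop_functor X x0 \<kappa> q"
      using mult by (simp add: eq[OF p] eq[OF q] eq[OF pj[OF p q]] flip: a_b_c_def)
  next
    fix p q assume *: "homotopic_paths X p q"
    define x y where "x = pathstart p" "y = pathfinish p"
    have p: "path_in X p x y" and q: "path_in X q x y"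
      using * by (auto simp: x_y_def path_in_def homotopic_paths_imp_path homotopic_paths_imp_subset
         homotopic_paths_imp_pathstart homotopic_paths_imp_pathfinish)
    then have xy: "x \<in> X" "y \<in> X"
      by (auto dest: path_in_mem)
    note bps = bp[OF xy(1)] path_in_reversepath[OF bp[OF xy(2)]]
    show "loop_functor X x0 \<kappa> p = loop_functor X x0 \<kappa> q"
      unfolding eq[OF p] eq[OF q]
      using p q * hp[OF bps(1)] hp[OF bps(2)] bps
      by (intro arg_cong[of _ _ \<kappa>] path_class_eqI homotopic_paths_join) (auto simp: path_in_def)
  qed
  interpret path_functor X "loop_functor X x0 \<kappa>" by (rule PF)
  show loop: "loop_functor X x0 \<kappa> p = \<kappa> (path_class X p)" if p: "path_in X p x0 x0" for p
  proof -
    have c: "base_path X x0 x0 = (\<lambda>_. x0)"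
      by (simp add: base_path_def)
    have r: "reversepath (\<lambda>_. x0) = (\<lambda>_. x0)"
      by (simp add: reversepath_def)
    have "homotopic_paths X ((\<lambda>_. x0) +++ p +++ (\<lambda>_. x0)) (p +++ (\<lambda>_. x0))"
      by (rule homotopic_paths_const_join[OF path_in_join[OF p path_in_const[OF X(2)]]])
    also have "homotopic_paths X \<dots> p"
      by (rule homotopic_paths_join_const[OF p])
    finally show ?thesis
      by (simp add: eq[OF p] c r path_class_eqI)
  qed
  fix x assume x: "x \<in> X"
  define c where "c = base_path X x0 x"
  have c: "path_in X c x0 x"
    using bp[OF x] by (simp add: c_def)
  have "loop_functor X x0 \<kappa> c = \<kappa> (path_class X ((\<lambda>_. x0) +++ c +++ reversepath c))"
    using eq[OF c] by (simp add: c_def base_path_def)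
  also have "homotopic_paths X ((\<lambda>_. x0) +++ c +++ reversepath c) (c +++ reversepath c)"
    by (rule homotopic_paths_const_join[OF path_in_join[OF c path_in_reversepath[OF c]]])
  then have "path_class X ((\<lambda>_. x0) +++ c +++ reversepath c) = path_class X (\<lambda>_. x0)"
    using homotopic_paths_join_reversepath[OF c] path_class_eqI by metis
  also have "\<kappa> (path_class X (\<lambda>_. x0)) = 0"
    using loop[OF path_in_const] const[of x0] X by simp
  finally show "loop_functor X x0 \<kappa> (base_path X x0 x) = 0"
    by (simp add: c_def)
qed

section \<open>The jumping group\<close>

text \<open>Rewriting to right-nested, freely reduced words proves identities in noncommutative
  groups. \<open>add_uminus_conv_diff\<close> has to be switched off, since it would restore the
  differences.\<close>

lemmas group_normalize = diff_conv_add_uminus minus_add add.assoc left_minus right_minus minus_minus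

section \<open>Semidirect products and normal closures\<close>

lemma group_semidirect_product:
  assumes "group N" "group H"
    and closed: "\<And>h a. h \<in> carrier H \<Longrightarrow> a \<in> carrier N \<Longrightarrow> \<phi> h a \<in> carrier N"
    and hom: "\<And>h a b. h \<in> carrier H \<Longrightarrow> a \<in> carrier N \<Longrightarrow> b \<in> carrier N \<Longrightarrow>
      \<phi> h (a \<otimes>\<^bsub>N\<^esub> b) = \<phi> h a \<otimes>\<^bsub>N\<^esub> \<phi> h b"
    and mult: "\<And>h k a. h \<in> carrier H \<Longrightarrow> k \<in> carrier H \<Longrightarrow> a \<in> carrier N \<Longrightarrow>
      \<phi> (h \<otimes>\<^bsub>H\<^esub> k) a = \<phi> h (\<phi> k a)"
    and one: "\<And>a. a \<in> carrier N \<Longrightarrow> \<phi> \<one>\<^bsub>H\<^esub> a = a"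
  shows "group (semidirect_product N H \<phi>)"
proof -
  interpret N: group N by fact
  interpret H: group H by fact
  show ?thesis
  proof (rule groupI)
    fix x assume "x \<in> carrier (semidirect_product N H \<phi>)"
    then obtain a h where x: "x = (a, h)" "a \<in> carrier N" "h \<in> carrier H"
      by (auto simp: semidirect_product_def)
    have "(\<phi> (inv\<^bsub>H\<^esub> h) (inv\<^bsub>N\<^esub> a), inv\<^bsub>H\<^esub> h) \<in> carrier (semidirect_product N H \<phi>)"
      using x closed by (simp add: semidirect_product_def)
    moreover have "\<phi> (inv\<^bsub>H\<^esub> h) (inv\<^bsub>N\<^esub> a) \<otimes>\<^bsub>N\<^esub> \<phi> (inv\<^bsub>H\<^esub> h) a = \<one>\<^bsub>N\<^esub>"
    proof -
      have "\<phi> (inv\<^bsub>H\<^esub> h) (inv\<^bsub>N\<^esub> a) \<otimes>\<^bsub>N\<^esub> \<phi> (inv\<^bsub>H\<^esub> h) a = \<phi> (inv\<^bsub>H\<^esub> h) \<one>\<^bsub>N\<^esub>"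
        using x hom[of "inv\<^bsub>H\<^esub> h" "inv\<^bsub>N\<^esub> a" a] by simp
      moreover have "\<phi> k \<one>\<^bsub>N\<^esub> = \<one>\<^bsub>N\<^esub>" if "k \<in> carrier H" for k
        using hom[OF that N.one_closed N.one_closed] closed[OF that N.one_closed]
          N.l_cancel_one[of "\<phi> k \<one>\<^bsub>N\<^esub>" "\<phi> k \<one>\<^bsub>N\<^esub>"] by simp
      ultimately show ?thesis
        using x by simp
    qed
    ultimately show "\<exists>y\<in>carrier (semidirect_product N H \<phi>).
        y \<otimes>\<^bsub>semidirect_product N H \<phi>\<^esub> x = \<one>\<^bsub>semidirect_product N H \<phi>\<^esub>"
      using x by (intro bexI[of _ "(\<phi> (inv\<^bsub>H\<^esub> h) (inv\<^bsub>N\<^esub> a), inv\<^bsub>H\<^esub> h)"]) (auto simp: semidirect_product_def)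
  qed (auto simp: semidirect_product_def closed hom mult one N.m_assoc H.m_assoc)
qed

lemma (in group) normal_normal_closure:
  assumes "K \<subseteq> carrier G"
  shows "normal_closure G K \<lhd> G"
proof -
  have "carrier G \<lhd> G"
    by (simp add: normal_inv_iff subgroup_self)
  \<comment> \<open>An intersection over the empty family would be the whole type; the whole group
    is a member.\<close>
  then have ne: "{N. N \<lhd> G \<and> K \<subseteq> N} \<noteq> {}"
    using assms by blast
  have "subgroup (normal_closure G K) G"
    unfolding normal_closure_def using ne by (intro subgroups_Inter) (auto simp: normal_def)
  then show ?thesis
    unfolding normal_inv_iff by (auto simp: normal_closure_def normal_inv_iff)
qed

lemma subset_normal_closure: "K \<subseteq> normal_closure G K"
  by (auto simp: normal_closure_def)

lemma normal_closure_least: "N \<lhd> G \<Longrightarrow> K \<subseteq> N \<Longrightarrow> normal_closure G K \<subseteq> N"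
  by (auto simp: normal_closure_def)

lemma normal_closure_mono: "K \<subseteq> L \<Longrightarrow> normal_closure G K \<subseteq> normal_closure G L"
  unfolding normal_closure_def by blast

text \<open>Words need not be reduced: composites of jumping-paths produce unreduced ones, and
  reduction is performed only on entering the free group.\<close>

definition word_in :: "'g set \<Rightarrow> 'g letter list \<Rightarrow> bool"
  where "word_in S w \<longleftrightarrow> fst ` set w \<subseteq> S"

lemma word_in_simps [simp]:
  "word_in S []"
  "word_in S (l # w) \<longleftrightarrow> fst l \<in> S \<and> word_in S w"
  "word_in S (v @ w) \<longleftrightarrow> word_in S v \<and> word_in S w"
  by (auto simp: word_in_def)

lemma fst_inv_letter [simp]: "fst (inv_letter l) = fst l"
  by (simp add: inv_letter_def)

lemma carrier_free_group: "w \<in> carrier (free_group S) \<longleftrightarrow> word_in S w \<and> reduced w"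
  by (force simp: free_group_def word_in_def)

lemma mult_free_group: "v \<otimes>\<^bsub>free_group S\<^esub> w = foldr cancel_Cons v w"
  and one_free_group: "\<one>\<^bsub>free_group S\<^esub> = []"
  by (simp_all add: free_group_def)

lemma word_in_cancel_Cons: "fst l \<in> S \<Longrightarrow> word_in S w \<Longrightarrow> word_in S (cancel_Cons l w)"
  using set_cancel_Cons[of l w] by (auto simp: word_in_def)

lemma word_in_foldr_cancel_Cons: "word_in S v \<Longrightarrow> word_in S w \<Longrightarrow> word_in S (foldr cancel_Cons v w)"
  by (induction v) (auto intro: word_in_cancel_Cons)

lemma length_cancel_Cons: "length (cancel_Cons l w) \<le> Suc (length w)"
  by (auto simp: cancel_Cons_def split: list.split)

lemma length_foldr_cancel_Cons: "length (foldr cancel_Cons v w) \<le> length v + length w"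
proof (induction v)
  case (Cons l v)
  then show ?case
    using length_cancel_Cons[of l "foldr cancel_Cons v w"] by simp
qed simp

lemma word_act_simps [simp]:
  "word_act X [] = id"
  "word_act X (l # w) = letter_act X l \<circ> word_act X w"
  "word_act X (v @ w) = word_act X v \<circ> word_act X w"
  by (induction v) (auto simp: word_act_def)

section \<open>The action of words on the space\<close>

context warped_system
begin

lemma generator:
  assumes "s \<in> S"
  shows "continuous_on X s" "s ` X = X" "inj_on s X" "continuous_on X (inv_into X s)"
proof -
  obtain s' where s': "homeomorphism X X s s'"
    using S_homeomorphism[OF assms] by blast
  then show "continuous_on X s" "s ` X = X"
    by (auto simp: homeomorphism_def)
  show inj: "inj_on s X"
    using s' by (metis homeomorphism_apply1 inj_onI)
  have "inv_into X s x = s' x" if "x \<in> X" for x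
  proof -
    have "s' x \<in> X" "s (s' x) = x"
      using s' that by (auto simp: homeomorphism_def)
    then show ?thesis
      using inj inv_into_f_f by metis
  qed
  then show "continuous_on X (inv_into X s)"
    using s' continuous_on_cong by (metis homeomorphism_cont2)
qed

lemma letter_act_continuous: "fst l \<in> S \<Longrightarrow> continuous_on X (letter_act X l)"
  by (simp add: letter_act_def generator)

lemma letter_act_mem: "fst l \<in> S \<Longrightarrow> x \<in> X \<Longrightarrow> letter_act X l x \<in> X"
  using generator(2)[of "fst l"] by (auto simp: letter_act_def inv_into_into)

lemma letter_act_image: "fst l \<in> S \<Longrightarrow> letter_act X l ` X \<subseteq> X"
  using letter_act_mem by blast

lemma letter_act_inv_letter:
  "fst l \<in> S \<Longrightarrow> x \<in> X \<Longrightarrow> letter_act X (inv_letter l) (letter_act X l x) = x"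
  using generator(2,3)[of "fst l"] by (auto simp: letter_act_def inv_letter_def f_inv_into_f)

lemma letter_act_inv_letter':
  "fst l \<in> S \<Longrightarrow> x \<in> X \<Longrightarrow> letter_act X l (letter_act X (inv_letter l) x) = x"
  using letter_act_inv_letter[of "inv_letter l" x] by simp

lemma word_act_continuous_mem:
  "word_in S w \<Longrightarrow> continuous_on X (word_act X w) \<and> word_act X w ` X \<subseteq> X"
proof (induction w)
  case (Cons l w)
  then have IH: "continuous_on X (word_act X w)" "word_act X w ` X \<subseteq> X" and l: "fst l \<in> S"
    by auto
  have "continuous_on (word_act X w ` X) (letter_act X l)"
    using IH(2) letter_act_continuous[OF l] continuous_on_subset by blast
  with IH have "continuous_on X (letter_act X l \<circ> word_act X w)"
    by (intro continuous_on_compose)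
  with IH letter_act_mem[OF l] show ?case
    by (auto simp: image_subset_iff)
qed simp

lemmas word_act_continuous = conjunct1[OF word_act_continuous_mem]
lemmas word_act_image = conjunct2[OF word_act_continuous_mem]

lemma word_act_mem: "word_in S w \<Longrightarrow> x \<in> X \<Longrightarrow> word_act X w x \<in> X"
  using word_act_image by blast

lemma word_act_cancel_Cons:
  assumes "fst l \<in> S" "word_in S w" "x \<in> X"
  shows "word_act X (cancel_Cons l w) x = letter_act X l (word_act X w x)"
  using assms
  by (auto simp: cancel_Cons_def letter_act_inv_letter' word_act_mem split: list.splits)

lemma word_act_foldr_cancel_Cons:
  assumes "word_in S v" "word_in S w" "x \<in> X"
  shows "word_act X (foldr cancel_Cons v w) x = word_act X v (word_act X w x)"
  using assms by (induction v) (auto simp: word_act_cancel_Cons word_in_foldr_cancel_Cons)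

end

section \<open>Paths of words and the action on the fundamental group\<close>

locale based_warped_system = warped_system X S
  for X :: "'a::metric_space set" and S :: "('a \<Rightarrow> 'a) set" +
  fixes x0 :: 'a and \<alpha> :: "('a \<Rightarrow> 'a) \<Rightarrow> real \<Rightarrow> 'a"
  assumes connecting: "connecting_paths X S x0 \<alpha>"
begin

lemma x0_mem [simp, intro]: "x0 \<in> X"
  using connecting by (simp add: connecting_paths_def)

lemma letter_path:
  assumes "fst l \<in> S"
  shows "path_in X (letter_path X \<alpha> l) x0 (letter_act X l x0)"
proof (cases "snd l")
  case True
  then show ?thesis
    using connecting assms by (simp add: connecting_paths_def letter_path_def letter_act_def)
next
  case False
  have "path_in X (\<alpha> (fst l)) x0 (fst l x0)"
    using connecting assms by (simp add: connecting_paths_def)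
  then have "path_in X (letter_act X l \<circ> reversepath (\<alpha> (fst l)))
      (letter_act X l (fst l x0)) (letter_act X l x0)"
    using assms letter_act_continuous letter_act_image by (intro path_in_compose path_in_reversepath)
  moreover have "letter_act X l (fst l x0) = x0"
    using letter_act_inv_letter[of "inv_letter l" x0] assms False
    by (simp add: letter_act_def inv_letter_def)
  ultimately show ?thesis
    using False by (simp add: letter_path_def)
qed

text \<open>Restricted to the unit interval, because cancelling a generator against its inverse
  needs the path to stay in X.\<close>

lemma letter_path_inv_letter:
  assumes "fst l \<in> S" "u \<in> {0..1}"
  shows "letter_path X \<alpha> (inv_letter l) u =
    (letter_act X (inv_letter l) \<circ> reversepath (letter_path X \<alpha> l)) u"
proof (cases "snd l")
  case True
  then show ?thesis
    by (simp add: letter_path_def inv_letter_def letter_act_def)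
next
  case False
  have "path_in X (\<alpha> (fst l)) x0 (fst l x0)"
    using connecting assms by (simp add: connecting_paths_def)
  then have "\<alpha> (fst l) u \<in> X"
    using assms(2) by (auto simp: path_in_def path_image_def)
  then show ?thesis
    using assms letter_act_inv_letter[of l "\<alpha> (fst l) u"] False
    by (simp add: letter_path_def inv_letter_def letter_act_def reversepath_def)
qed

lemma word_path:
  assumes "word_in S w"
  shows "path_in X (word_path X x0 \<alpha> w) x0 (word_act X w x0)"
  using assms
proof (induction w)
  case (Cons l w)
  then have "path_in X (letter_act X l \<circ> word_path X x0 \<alpha> w) (letter_act X l x0)
      (letter_act X l (word_act X w x0))"
    using letter_act_continuous[of l] letter_act_image[of l] by (intro path_in_compose) auto
  with Cons show ?case
    by (auto intro: path_in_join letter_path)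
qed (simp add: path_in_const)

definition conj_path :: "('a \<Rightarrow> 'a) letter list \<Rightarrow> (real \<Rightarrow> 'a) \<Rightarrow> real \<Rightarrow> 'a"
  where "conj_path w \<gamma> =
    word_path X x0 \<alpha> w +++ (word_act X w \<circ> \<gamma>) +++ reversepath (word_path X x0 \<alpha> w)"

lemma conj_path:
  assumes "word_in S w" "path_in X \<gamma> x0 x0"
  shows "path_in X (conj_path w \<gamma>) x0 x0"
  unfolding conj_path_def
  using word_path[OF assms(1)] path_in_compose[OF assms(2) word_act_continuous word_act_image] assms(1)
  by (auto intro: path_in_join path_in_reversepath)

lemma conj_action_path_class:
  assumes w: "word_in S w" and \<gamma>: "path_in X \<gamma> x0 x0"
  shows "conj_action X x0 \<alpha> w (path_class X \<gamma>) = path_class X (conj_path w \<gamma>)"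
  unfolding conj_action_def conj_path_def
proof (rule UN_path_class[OF \<gamma>])
  fix \<gamma>' assume *: "homotopic_paths X \<gamma> \<gamma>'"
  have p: "path_in X (word_act X w \<circ> \<gamma>) (word_act X w x0) (word_act X w x0)"
    by (rule path_in_compose[OF \<gamma> word_act_continuous[OF w] word_act_image[OF w]])
  have "homotopic_paths X (word_act X w \<circ> \<gamma>) (word_act X w \<circ> \<gamma>')"
    using * w word_act_continuous word_act_mem by (intro homotopic_paths_continuous_image) auto
  then show "homotopic_paths X
      (word_path X x0 \<alpha> w +++ (word_act X w \<circ> \<gamma>) +++ reversepath (word_path X x0 \<alpha> w))
      (word_path X x0 \<alpha> w +++ (word_act X w \<circ> \<gamma>') +++ reversepath (word_path X x0 \<alpha> w))"
    using word_path[OF w]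
    by (intro homotopic_paths_join_left[OF _ path_in_join[OF p]] homotopic_paths_join_right[OF p]
        path_in_reversepath)
qed

abbreviation \<pi>1 :: "(real \<Rightarrow> 'a) set monoid"
  where "\<pi>1 \<equiv> fundamental_group X x0"

lemma group_pi1: "group \<pi>1"
  by (rule group_fundamental_group) simp

text \<open>The regular representation of the fundamental group, extended to all paths. It is
  faithful on loops, so equalities of classes can be proved by computing with its values instead of
  constructing homotopies.\<close>

definition pi1_functor :: "(real \<Rightarrow> 'a) \<Rightarrow> (real \<Rightarrow> 'a) set bijection"
  where "pi1_functor = loop_functor X x0 (left_translation \<pi>1)"

lemma path_functor_pi1_functor: "path_functor X pi1_functor"
  and pi1_functor_eq_iff: "path_in X p x0 x0 \<Longrightarrow> path_in X q x0 x0 \<Longrightarrow>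
    pi1_functor p = pi1_functor q \<longleftrightarrow> path_class X p = path_class X q"
proof -
  note * = path_connected x0_mem group.left_translation_mult[OF group_pi1]
  show "path_functor X pi1_functor"
    unfolding pi1_functor_def by (rule path_functor_loop_functor[OF *])
  show "pi1_functor p = pi1_functor q \<longleftrightarrow> path_class X p = path_class X q"
    if "path_in X p x0 x0" "path_in X q x0 x0"
  proof -
    have "path_class X p \<in> carrier \<pi>1" "path_class X q \<in> carrier \<pi>1"
      using that carrier_fundamental_group by blast+
    then show ?thesis
      using that loop_functor_loop[OF *] unfolding pi1_functor_def
      by (simp add: group.left_translation_eq_iff[OF group_pi1])
  qed
qed

lemma
  assumes F: "path_functor X h"
  shows functor_letter: "fst l \<in> S \<Longrightarrow> path_functor X (\<lambda>p. h (letter_act X l \<circ> p))"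
    and functor_word: "word_in S w \<Longrightarrow> path_functor X (\<lambda>p. h (word_act X w \<circ> p))"
    and functor_word_path_Cons: "fst l \<in> S \<Longrightarrow> word_in S w \<Longrightarrow>
      h (word_path X x0 \<alpha> (l # w)) = h (letter_path X \<alpha> l) + h (letter_act X l \<circ> word_path X x0 \<alpha> w)"
    and functor_conj_path: "word_in S w \<Longrightarrow> path_in X \<gamma> x0 x0 \<Longrightarrow>
      h (conj_path w \<gamma>) = h (word_path X x0 \<alpha> w) + h (word_act X w \<circ> \<gamma>) - h (word_path X x0 \<alpha> w)"
proof -
  interpret path_functor X h by fact
  show "path_functor X (\<lambda>p. h (letter_act X l \<circ> p))" if "fst l \<in> S"
    using that by (intro compose letter_act_continuous letter_act_image)
  show "path_functor X (\<lambda>p. h (word_act X w \<circ> p))" if "word_in S w"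
    using that by (intro compose word_act_continuous word_act_image)
  show "h (word_path X x0 \<alpha> (l # w)) = h (letter_path X \<alpha> l) + h (letter_act X l \<circ> word_path X x0 \<alpha> w)"
    if "fst l \<in> S" "word_in S w"
    using join[OF letter_path[OF that(1)]
        path_in_compose[OF word_path[OF that(2)] letter_act_continuous[OF that(1)] letter_act_image[OF that(1)]]]
    by simp
  show "h (conj_path w \<gamma>) = h (word_path X x0 \<alpha> w) + h (word_act X w \<circ> \<gamma>) - h (word_path X x0 \<alpha> w)"
    if w: "word_in S w" and \<gamma>: "path_in X \<gamma> x0 x0"
  proof -
    note p = word_path[OF w] and r = path_in_reversepath[OF word_path[OF w]]
      and q = path_in_compose[OF \<gamma> word_act_continuous[OF w] word_act_image[OF w]]
    show ?thesis
      using join[OF p path_in_join[OF q r]] join[OF q r] reverse[OF p]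
      by (simp add: conj_path_def group_normalize del: add_uminus_conv_diff)
  qed
qed

lemma conj_action_Nil: "c \<in> carrier \<pi>1 \<Longrightarrow> conj_action X x0 \<alpha> [] c = c"
proof -
  assume "c \<in> carrier \<pi>1"
  then obtain \<gamma> where \<gamma>: "path_in X \<gamma> x0 x0" "c = path_class X \<gamma>"
    by (auto simp: carrier_fundamental_group)
  have "pi1_functor (conj_path [] \<gamma>) = pi1_functor \<gamma>"
    using functor_conj_path[OF path_functor_pi1_functor _ \<gamma>(1), of "[]"]
      path_functor.const[OF path_functor_pi1_functor x0_mem] by simp
  then show ?thesis
    using \<gamma> conj_path[OF _ \<gamma>(1), of "[]"] by (simp add: conj_action_path_class pi1_functor_eq_iff)
qed

lemma conj_action_mem:
  assumes "word_in S w" "c \<in> carrier \<pi>1"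
  shows "conj_action X x0 \<alpha> w c \<in> carrier \<pi>1"
  using assms by (auto simp: carrier_fundamental_group conj_action_path_class intro: conj_path)

text \<open>The path of \<open>l # w\<close> runs along the path of \<open>l\<close> and then along
  the translate by \<open>l\<close> of the path of \<open>w\<close>, so conjugation by it splits
  accordingly.\<close>

lemma conj_action_Cons:
  assumes l: "fst l \<in> S" and w: "word_in S w" and c: "c \<in> carrier \<pi>1"
  shows "conj_action X x0 \<alpha> (l # w) c = conj_action X x0 \<alpha> [l] (conj_action X x0 \<alpha> w c)"
proof -
  interpret F: path_functor X pi1_functor by (rule path_functor_pi1_functor)
  interpret L: path_functor X "\<lambda>p. pi1_functor (letter_act X l \<circ> p)"
    by (rule functor_letter[OF F.path_functor_axioms l])
  obtain \<gamma> where \<gamma>: "path_in X \<gamma> x0 x0" "c = path_class X \<gamma>"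
    using c by (auto simp: carrier_fundamental_group)
  have lw: "word_in S (l # w)" "word_in S [l]"
    using l w by auto
  note F' = F.path_functor_axioms and L' = L.path_functor_axioms
  have "letter_act X l \<circ> word_path X x0 \<alpha> [] = (\<lambda>_. letter_act X l x0)"
    by auto
  then have "pi1_functor (letter_act X l \<circ> word_path X x0 \<alpha> []) = 0"
    using F.const[OF letter_act_mem[OF l x0_mem]] by simp
  then have "pi1_functor (conj_path (l # w) \<gamma>) = pi1_functor (conj_path [l] (conj_path w \<gamma>))"
    using functor_conj_path[OF F' lw(1) \<gamma>(1)] functor_conj_path[OF F' lw(2) conj_path[OF w \<gamma>(1)]]
      functor_conj_path[OF L' w \<gamma>(1)] functor_word_path_Cons[OF F' l w]
      functor_word_path_Cons[OF F' l, of "[]"]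
    by (simp add: group_normalize o_assoc del: add_uminus_conv_diff word_path.simps)
  then show ?thesis
    using \<gamma> w lw conj_path by (simp add: conj_action_path_class pi1_functor_eq_iff)
qed

text \<open>The path of the word l l^-1 runs along \<open>letter_path\<close> of \<open>l\<close>
  and back, so it contributes nothing, and the word acts trivially on X.\<close>

lemma conj_action_inv_letter:
  assumes l: "fst l \<in> S" and c: "c \<in> carrier \<pi>1"
  shows "conj_action X x0 \<alpha> [l] (conj_action X x0 \<alpha> [inv_letter l] c) = c"
proof -
  interpret F: path_functor X pi1_functor by (rule path_functor_pi1_functor)
  obtain \<gamma> where \<gamma>: "path_in X \<gamma> x0 x0" "c = path_class X \<gamma>"
    using c by (auto simp: carrier_fundamental_group)
  have lw: "word_in S [l, inv_letter l]"
    using l by auto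
  note F' = F.path_functor_axioms
  have const: "pi1_functor (letter_act X l \<circ> (\<lambda>_. letter_act X (inv_letter l) x0)) = 0"
    using F.const[of x0] l by (simp add: o_def letter_act_inv_letter')
  have "pi1_functor (word_path X x0 \<alpha> [l, inv_letter l]) = 0"
  proof -
    interpret L: path_functor X "\<lambda>p. pi1_functor (letter_act X l \<circ> p)"
      by (rule functor_letter[OF F' l])
    have "pi1_functor (letter_act X l \<circ> word_path X x0 \<alpha> [inv_letter l]) =
        pi1_functor (letter_act X l \<circ> letter_path X \<alpha> (inv_letter l))"
      using functor_word_path_Cons[OF L.path_functor_axioms, of "inv_letter l" "[]"] l const
      by (simp add: o_def)
    also have "\<dots> = pi1_functor (reversepath (letter_path X \<alpha> l))"
    proof (rule F.cong[OF path_in_reversepath[OF letter_path[OF l]]])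
      fix u :: real assume u: "u \<in> {0..1}"
      have "reversepath (letter_path X \<alpha> l) u \<in> X"
        using path_in_reversepath[OF letter_path[OF l]] u by (auto simp: path_in_def path_image_def)
      with u l show "(letter_act X l \<circ> letter_path X \<alpha> (inv_letter l)) u = reversepath (letter_path X \<alpha> l) u"
        by (simp add: letter_path_inv_letter letter_act_inv_letter')
    qed
    also have "\<dots> = - pi1_functor (letter_path X \<alpha> l)"
      by (rule F.reverse[OF letter_path[OF l]])
    finally show ?thesis
      using functor_word_path_Cons[OF F' l, of "[inv_letter l]"] l by simp
  qed
  moreover have "pi1_functor (word_act X [l, inv_letter l] \<circ> \<gamma>) = pi1_functor \<gamma>"
  proof (rule F.cong[OF \<gamma>(1)])
    fix u :: real assume "u \<in> {0..1}"
    then have "\<gamma> u \<in> X"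
      using \<gamma>(1) by (auto simp: path_in_def path_image_def)
    then show "(word_act X [l, inv_letter l] \<circ> \<gamma>) u = \<gamma> u"
      using l by (simp add: letter_act_inv_letter')
  qed
  ultimately have "pi1_functor (conj_path [l, inv_letter l] \<gamma>) = pi1_functor \<gamma>"
    using functor_conj_path[OF F' lw \<gamma>(1)] by simp
  then have "conj_action X x0 \<alpha> [l, inv_letter l] c = c"
    using \<gamma> conj_path[OF lw \<gamma>(1)] lw by (simp add: conj_action_path_class pi1_functor_eq_iff)
  then show ?thesis
    using conj_action_Cons[OF l _ c, of "[inv_letter l]"] l by simp
qed

text \<open>\<open>cancel_Cons\<close> either prepends a letter or deletes an inverse pair, and such
  a pair acts trivially on classes. This is the compatibility with free reduction.\<close>

lemma conj_action_cancel_Cons: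
  assumes l: "fst l \<in> S" and w: "word_in S w" and c: "c \<in> carrier \<pi>1"
  shows "conj_action X x0 \<alpha> (cancel_Cons l w) c = conj_action X x0 \<alpha> [l] (conj_action X x0 \<alpha> w c)"
proof (cases "\<exists>v. w = inv_letter l # v")
  case True
  then obtain v where v: "w = inv_letter l # v" by blast
  then have "conj_action X x0 \<alpha> w c = conj_action X x0 \<alpha> [inv_letter l] (conj_action X x0 \<alpha> v c)"
    using conj_action_Cons[OF _ _ c, of "inv_letter l" v] l w by simp
  then show ?thesis
    using conj_action_inv_letter[OF l conj_action_mem[OF _ c]] v w by (simp add: cancel_Cons_def)
next
  case False
  then have "cancel_Cons l w = l # w"
    by (auto simp: cancel_Cons_def split: list.split)
  then show ?thesis
    using conj_action_Cons[OF l w c] by simp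
qed

lemma conj_action_foldr_cancel_Cons:
  assumes v: "word_in S v" and w: "word_in S w" and c: "c \<in> carrier \<pi>1"
  shows "conj_action X x0 \<alpha> (foldr cancel_Cons v w) c = conj_action X x0 \<alpha> v (conj_action X x0 \<alpha> w c)"
  using v
proof (induction v)
  case Nil
  then show ?case
    using conj_action_Nil conj_action_mem[OF w c] by simp
next
  case (Cons l v)
  then show ?case
    using conj_action_cancel_Cons[of l "foldr cancel_Cons v w" c] word_in_foldr_cancel_Cons[OF _ w, of v]
      conj_action_Cons[of l v "conj_action X x0 \<alpha> w c"] c conj_action_mem[OF w c]
    by simp
qed

abbreviation \<Gamma> :: "((real \<Rightarrow> 'a) set \<times> ('a \<Rightarrow> 'a) letter list) monoid"
  where "\<Gamma> \<equiv> jumping_group X S x0 \<alpha>"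

lemma group_jumping_group: "group \<Gamma>"
  unfolding jumping_group_def
proof (rule group_semidirect_product[OF group_pi1 group_free_group])
  fix w a b assume w: "w \<in> carrier (free_group S)" and "a \<in> carrier \<pi>1" "b \<in> carrier \<pi>1"
  then obtain p q where p: "path_in X p x0 x0" "a = path_class X p" and q: "path_in X q x0 x0" "b = path_class X q"
    by (auto simp: carrier_fundamental_group)
  have w: "word_in S w"
    using w by (simp add: carrier_free_group)
  interpret F: path_functor X pi1_functor by (rule path_functor_pi1_functor)
  interpret W: path_functor X "\<lambda>p. pi1_functor (word_act X w \<circ> p)"
    by (rule functor_word[OF F.path_functor_axioms w])
  note F' = F.path_functor_axioms and pq = path_in_join[OF p(1) q(1)]
  \<comment> \<open>Between the translated loops the path of \<open>w\<close> is run backwards and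
    forwards, which cancels.\<close>
  have "pi1_functor (conj_path w (p +++ q)) = pi1_functor (conj_path w p +++ conj_path w q)"
    using functor_conj_path[OF F' w pq] functor_conj_path[OF F' w p(1)] functor_conj_path[OF F' w q(1)]
      F.join[OF conj_path[OF w p(1)] conj_path[OF w q(1)]] W.join[OF p(1) q(1)]
    by (simp add: group_normalize del: add_uminus_conv_diff)
  then show "conj_action X x0 \<alpha> w (a \<otimes>\<^bsub>\<pi>1\<^esub> b) = conj_action X x0 \<alpha> w a \<otimes>\<^bsub>\<pi>1\<^esub> conj_action X x0 \<alpha> w b"
    using p q w pq conj_path[OF w pq] path_in_join[OF conj_path[OF w p(1)] conj_path[OF w q(1)]]
    by (simp add: conj_action_path_class mult_path_class[OF p(1) q(1)] pi1_functor_eq_iff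
        mult_path_class[OF conj_path[OF w p(1)] conj_path[OF w q(1)]])
qed (auto simp: carrier_free_group mult_free_group one_free_group conj_action_mem conj_action_Nil
    conj_action_foldr_cancel_Cons)

lemma carrier_jumping_group:
  "g \<in> carrier \<Gamma> \<longleftrightarrow>
    (\<exists>p w. g = (path_class X p, w) \<and> path_in X p x0 x0 \<and> word_in S w \<and> reduced w)"
  by (cases g) (auto simp: jumping_group_def semidirect_product_def carrier_fundamental_group carrier_free_group)

lemma mult_jumping_group:
  assumes "path_in X p x0 x0" "word_in S v" "path_in X q x0 x0"
  shows "(path_class X p, v) \<otimes>\<^bsub>\<Gamma>\<^esub> (path_class X q, w) =
    (path_class X (p +++ conj_path v q), foldr cancel_Cons v w)"
  using assms
  by (simp add: jumping_group_def semidirect_product_def conj_action_path_class mult_free_group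
      mult_path_class[OF assms(1) conj_path])

abbreviation kill :: "nat \<Rightarrow> ((real \<Rightarrow> 'a) set \<times> ('a \<Rightarrow> 'a) letter list) set"
  where "kill \<theta> \<equiv> normal_closure \<Gamma> (K_set X S x0 \<alpha> \<theta>)"

lemma K_set_path:
  assumes "word_in S w" "x \<in> Fix X w" "path_in X \<beta> x0 x"
  shows "path_in X (\<beta> +++ (word_act X w \<circ> reversepath \<beta>) +++ reversepath (word_path X x0 \<alpha> w)) x0 x0"
proof -
  have "path_in X (word_act X w \<circ> reversepath \<beta>) (word_act X w x) (word_act X w x0)"
    by (rule path_in_compose[OF path_in_reversepath[OF assms(3)] word_act_continuous[OF assms(1)]
          word_act_image[OF assms(1)]])
  then show ?thesis
    using assms word_path[OF assms(1)]
    by (auto simp: Fix_def intro!: path_in_join path_in_reversepath)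
qed

lemma K_set_subset: "K_set X S x0 \<alpha> \<theta> \<subseteq> carrier \<Gamma>"
  by (force simp: K_set_def carrier_jumping_group carrier_free_group intro: K_set_path)

lemma normal_kill: "kill \<theta> \<lhd> \<Gamma>"
  by (rule group.normal_normal_closure[OF group_jumping_group K_set_subset])

lemma K_set_mono: "\<theta> \<le> \<theta>' \<Longrightarrow> K_set X S x0 \<alpha> \<theta> \<subseteq> K_set X S x0 \<alpha> \<theta>'"
  by (fastforce simp: K_set_def)

lemma kill_mono: "\<theta> \<le> \<theta>' \<Longrightarrow> kill \<theta> \<subseteq> kill \<theta>'"
  by (intro normal_closure_mono K_set_mono)

end

section \<open>Representations of the jumping groupoid\<close>

lemma (in group) normal_kernel_add:
  assumes f: "\<And>x y. x \<in> carrier G \<Longrightarrow> y \<in> carrier G \<Longrightarrow> f (x \<otimes> y) = (f x + f y :: 'v::group_add)"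
  shows "{x \<in> carrier G. f x = 0} \<lhd> G"
proof -
  have one: "f \<one> = 0"
    using f[of \<one> \<one>] by (simp add: eq_add_self_iff)
  have inv: "f (inv x) = - f x" if "x \<in> carrier G" for x
    using f[of "inv x" x] that one by (simp add: eq_neg_iff_add_eq_0)
  have "subgroup {x \<in> carrier G. f x = 0} G"
    by (rule subgroupI) (use one in \<open>auto simp: f inv\<close>)
  then show ?thesis
    by (auto simp: normal_inv_iff f inv)
qed

fun word_value ::
  "'a set \<Rightarrow> (('a \<Rightarrow> 'a) letter \<Rightarrow> 'a \<Rightarrow> 'v::group_add) \<Rightarrow> ('a \<Rightarrow> 'a) letter list \<Rightarrow> 'a \<Rightarrow> 'v"
where
  "word_value X C [] x = 0"
| "word_value X C (l # w) x = C l (word_act X w x) + word_value X C w x"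

lemma word_value_append:
  "word_value X C (v @ w) x = word_value X C v (word_act X w x) + word_value X C w x"
  by (induction v) (auto simp: add.assoc)

text \<open>The morphism \<open>(p, w) : x \<rightarrow> y\<close>, with \<open>p\<close> a path from \<open>x\<close> to \<open>w y\<close>, gets the value
  \<open>h p + word_value X C w y\<close>; here \<open>C l x\<close> is the value of the jump \<open>(const, [l]) : l x \<rightarrow> x\<close>.\<close>

locale jumping_rep = based_warped_system X S x0 \<alpha> + path_functor X h
  for X :: "'a::metric_space set" and S x0 \<alpha> and h :: "(real \<Rightarrow> 'a) \<Rightarrow> 'v::group_add" +
  fixes C :: "('a \<Rightarrow> 'a) letter \<Rightarrow> 'a \<Rightarrow> 'v"
  assumes natural: "fst l \<in> S \<Longrightarrow> path_in X p x y \<Longrightarrow> h (letter_act X l \<circ> p) + C l y = C l x + h p"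
    and C_inv_letter: "fst l \<in> S \<Longrightarrow> x \<in> X \<Longrightarrow> C (inv_letter l) (letter_act X l x) = - C l x"
begin

text \<open>A jump and its inverse contribute 0 by \<open>C_inv_letter\<close>, so free reduction
  preserves the value.\<close>

lemma word_value_cancel_Cons:
  assumes "fst l \<in> S" "word_in S w" "x \<in> X"
  shows "word_value X C (cancel_Cons l w) x = C l (word_act X w x) + word_value X C w x"
proof (cases "\<exists>v. w = inv_letter l # v")
  case True
  then obtain v where v: "w = inv_letter l # v" by blast
  have x: "word_act X v x \<in> X"
    using assms v word_act_mem by simp
  have "C l (letter_act X (inv_letter l) (word_act X v x)) = - C (inv_letter l) (word_act X v x)"
    using C_inv_letter[of "inv_letter l" "word_act X v x"] x assms by simp
  with v show ?thesis
    by (simp add: cancel_Cons_def)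
next
  case False
  then have "cancel_Cons l w = l # w"
    by (auto simp: cancel_Cons_def split: list.split)
  then show ?thesis by simp
qed

lemma word_value_foldr_cancel_Cons:
  assumes "word_in S v" "word_in S w" "x \<in> X"
  shows "word_value X C (foldr cancel_Cons v w) x = word_value X C v (word_act X w x) + word_value X C w x"
  using assms
  by (induction v)
    (auto simp: word_value_cancel_Cons word_in_foldr_cancel_Cons word_act_foldr_cancel_Cons add.assoc)

lemma natural_word:
  assumes "word_in S w" "path_in X p x y"
  shows "h (word_act X w \<circ> p) + word_value X C w y = word_value X C w x + h p"
  using assms(1)
proof (induction w)
  case (Cons l w)
  then have w: "word_in S w" and l: "fst l \<in> S" by auto
  have "h (letter_act X l \<circ> (word_act X w \<circ> p)) + C l (word_act X w y)
      = C l (word_act X w x) + h (word_act X w \<circ> p)"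
    by (rule natural[OF l path_in_compose[OF assms(2) word_act_continuous[OF w] word_act_image[OF w]]])
  then have "h (letter_act X l \<circ> (word_act X w \<circ> p)) + (C l (word_act X w y) + word_value X C w y)
      = C l (word_act X w x) + (h (word_act X w \<circ> p) + word_value X C w y)"
    by (simp only: add.assoc[symmetric])
  moreover have "word_act X (l # w) \<circ> p = letter_act X l \<circ> (word_act X w \<circ> p)"
    by (simp add: fun_eq_iff)
  ultimately show ?case
    by (simp only: word_value.simps Cons.IH[OF w] add.assoc)
qed (simp)

text \<open>The value of the morphism from \<open>x0\<close> to itself given by the path of
  \<open>w\<close> and the word \<open>w\<close>; in the semidirect product this morphism is (1,
  w).\<close>

definition word_total :: "('a \<Rightarrow> 'a) letter list \<Rightarrow> 'v"
  where "word_total w = h (word_path X x0 \<alpha> w) + word_value X C w x0"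

lemma word_total_Nil [simp]: "word_total [] = 0"
  by (simp add: word_total_def const)

lemma word_total_single:
  assumes l: "fst l \<in> S"
  shows "word_total [l] = h (letter_path X \<alpha> l) + C l x0"
proof -
  have "letter_act X l \<circ> word_path X x0 \<alpha> [] = (\<lambda>_. letter_act X l x0)"
    by auto
  then show ?thesis
    using functor_word_path_Cons[OF path_functor_axioms l, of "[]"] const[OF letter_act_mem[OF l x0_mem]]
    by (simp add: word_total_def del: word_path.simps)
qed

text \<open>By naturality, the translated path of \<open>w\<close> with the jump at its end equals
  the jump at \<open>x0\<close> followed by the path itself.\<close>

lemma word_total_Cons:
  assumes l: "fst l \<in> S" and w: "word_in S w"
  shows "word_total (l # w) = word_total [l] + word_total w"
proof -
  have "h (letter_act X l \<circ> word_path X x0 \<alpha> w) + C l (word_act X w x0) = C l x0 + h (word_path X x0 \<alpha> w)"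
    by (rule natural[OF l word_path[OF w]])
  then have "h (letter_act X l \<circ> word_path X x0 \<alpha> w) + (C l (word_act X w x0) + word_value X C w x0)
      = C l x0 + (h (word_path X x0 \<alpha> w) + word_value X C w x0)"
    by (simp only: add.assoc[symmetric])
  then show ?thesis
    unfolding word_total_single[OF l]
    using functor_word_path_Cons[OF path_functor_axioms l w]
    by (simp add: word_total_def add.assoc del: word_path.simps)
qed

lemma word_total_inv_letter:
  assumes l: "fst l \<in> S"
  shows "word_total [inv_letter l] = - word_total [l]"
proof -
  have p: "path_in X (reversepath (letter_path X \<alpha> l)) (letter_act X l x0) x0"
    by (rule path_in_reversepath[OF letter_path[OF l]])
  have q: "path_in X (letter_act X (inv_letter l) \<circ> reversepath (letter_path X \<alpha> l))
      (letter_act X (inv_letter l) (letter_act X l x0)) (letter_act X (inv_letter l) x0)"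
    using l by (intro path_in_compose[OF p] letter_act_continuous letter_act_image) auto
  have "h (letter_path X \<alpha> (inv_letter l)) + C (inv_letter l) x0 =
      h (letter_act X (inv_letter l) \<circ> reversepath (letter_path X \<alpha> l)) + C (inv_letter l) x0"
    by (simp only: cong[OF q letter_path_inv_letter[OF l]])
  also have "\<dots> = C (inv_letter l) (letter_act X l x0) + h (reversepath (letter_path X \<alpha> l))"
    using l by (intro natural p) simp
  also have "\<dots> = - C l x0 - h (letter_path X \<alpha> l)"
    using C_inv_letter[OF l x0_mem] reverse[OF letter_path[OF l]] by simp
  finally show ?thesis
    using l by (simp add: word_total_single group_normalize del: add_uminus_conv_diff)
qed

lemma word_total_foldr_cancel_Cons:
  assumes "word_in S v" "word_in S w"
  shows "word_total (foldr cancel_Cons v w) = word_total v + word_total w"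
  using assms
proof (induction v)
  case (Cons l v)
  define u where "u = foldr cancel_Cons v w"
  have l: "fst l \<in> S" and u: "word_in S u"
    using Cons by (auto simp: u_def word_in_foldr_cancel_Cons)
  have "word_total (cancel_Cons l u) = word_total [l] + word_total u"
  proof (cases "\<exists>v. u = inv_letter l # v")
    case True
    then obtain v' where v': "u = inv_letter l # v'" by blast
    then have "word_total u = - word_total [l] + word_total v'"
      using u l word_total_Cons[of "inv_letter l" v'] by (simp add: word_total_inv_letter)
    with v' show ?thesis
      by (simp add: cancel_Cons_def)
  next
    case False
    then have "cancel_Cons l u = l # u"
      by (auto simp: cancel_Cons_def split: list.split)
    then show ?thesis
      using word_total_Cons[OF l u] by simp
  qed
  with Cons show ?case
    using word_total_Cons[OF l, of v] by (simp add: u_def add.assoc)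
qed simp

text \<open>Group elements carry classes, so a representative is picked; by homotopy invariance the
  choice does not affect the value.\<close>

definition total :: "(real \<Rightarrow> 'a) set \<times> ('a \<Rightarrow> 'a) letter list \<Rightarrow> 'v"
  where "total g = h (SOME p. p \<in> fst g) + word_total (snd g)"

lemma total_eq:
  assumes "path_in X p x0 x0"
  shows "total (path_class X p, w) = h p + word_total w"
proof -
  have "p \<in> path_class X p"
    using assms by (simp add: path_class_def path_in_def)
  then have "(SOME q. q \<in> path_class X p) \<in> path_class X p"
    by (rule someI[of "\<lambda>q. q \<in> path_class X p"])
  then have "h (SOME q. q \<in> path_class X p) = h p"
    by (simp add: path_class_def homotopic[symmetric])
  then show ?thesis
    by (simp add: total_def)
qed

lemma total_mult:
  assumes "f \<in> carrier \<Gamma>" "g \<in> carrier \<Gamma>"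
  shows "total (f \<otimes>\<^bsub>\<Gamma>\<^esub> g) = total f + total g"
proof -
  obtain p v where p: "f = (path_class X p, v)" "path_in X p x0 x0" "word_in S v"
    using assms by (auto simp: carrier_jumping_group)
  obtain q w where q: "g = (path_class X q, w)" "path_in X q x0 x0" "word_in S w"
    using assms by (auto simp: carrier_jumping_group)
  have "total (f \<otimes>\<^bsub>\<Gamma>\<^esub> g) = h p + h (conj_path v q) + word_total (foldr cancel_Cons v w)"
    using p q conj_path[OF p(3) q(2)]
    by (simp add: mult_jumping_group total_eq[OF path_in_join] join)
  \<comment> \<open>Naturality turns translation by \<open>v\<close> into conjugation by a value, so
    the semidirect action becomes inner.\<close>
  also have "h (conj_path v q) = word_total v + h q - word_total v"
  proof -
    have "h (word_act X v \<circ> q) = word_value X C v x0 + h q - word_value X C v x0"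
      using natural_word[OF p(3) q(2)] by (simp add: eq_diff_eq)
    then show ?thesis
      using functor_conj_path[OF path_functor_axioms p(3) q(2)]
      by (simp add: word_total_def group_normalize del: add_uminus_conv_diff)
  qed
  finally show ?thesis
    using p q by (simp add: total_eq word_total_foldr_cancel_Cons group_normalize del: add_uminus_conv_diff)
qed

text \<open>This element is the pure jump by \<open>w\<close> at the fixed point z, a morphism from
  z to z, carried to \<open>x0\<close> along \<beta>. Its value is therefore a conjugate of the
  value of the jump.\<close>

lemma total_K_element:
  assumes w: "word_in S w" and z: "z \<in> Fix X w" and \<beta>: "path_in X \<beta> x0 z"
  shows "total (path_class X (\<beta> +++ (word_act X w \<circ> reversepath \<beta>) +++ reversepath (word_path X x0 \<alpha> w)), w)
    = h \<beta> + word_value X C w z - h \<beta>"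
proof -
  have wz: "word_act X w z = z"
    using z by (simp add: Fix_def)
  have p: "path_in X (word_act X w \<circ> reversepath \<beta>) z (word_act X w x0)"
    using path_in_compose[OF path_in_reversepath[OF \<beta>] word_act_continuous[OF w] word_act_image[OF w]] wz
    by simp
  note r = path_in_reversepath[OF word_path[OF w]]
  have "h (word_act X w \<circ> reversepath \<beta>) + word_value X C w x0 = word_value X C w z - h \<beta>"
    using natural_word[OF w path_in_reversepath[OF \<beta>]] reverse[OF \<beta>] by simp
  then show ?thesis
    using join[OF \<beta> path_in_join[OF p r]] join[OF p r] reverse[OF word_path[OF w]]
    by (simp add: total_eq[OF K_set_path[OF assms]] word_total_def group_normalize del: add_uminus_conv_diff)
qed

lemma total_eq_0_if_kill:
  assumes "\<And>w z. word_in S w \<Longrightarrow> reduced w \<Longrightarrow> length w \<le> 4 * \<theta> \<Longrightarrow> z \<in> Fix X w \<Longrightarrow> word_value X C w z = 0"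
    and "g \<in> kill \<theta>"
  shows "total g = 0"
proof -
  interpret group \<Gamma> by (rule group_jumping_group)
  have "K_set X S x0 \<alpha> \<theta> \<subseteq> {g \<in> carrier \<Gamma>. total g = 0}"
  proof
    fix k assume k: "k \<in> K_set X S x0 \<alpha> \<theta>"
    then obtain \<beta> w z where w: "word_in S w" "reduced w" "length w \<le> 4 * \<theta>" "z \<in> Fix X w" "path_in X \<beta> x0 z"
      and k_eq: "k = (path_class X (\<beta> +++ (word_act X w \<circ> reversepath \<beta>) +++ reversepath (word_path X x0 \<alpha> w)), w)"
      by (auto simp: K_set_def carrier_free_group)
    then have "total k = 0"
      using total_K_element[of w z \<beta>] assms(1) by simp
    then show "k \<in> {g \<in> carrier \<Gamma>. total g = 0}"
      using k K_set_subset by blast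
  qed
  then have "kill \<theta> \<subseteq> {g \<in> carrier \<Gamma>. total g = 0}"
    by (intro normal_closure_least normal_kernel_add total_mult)
  with assms(2) show ?thesis by blast
qed

end

text \<open>The two representations correspond through \<sigma> up to a gauge \<open>b\<close> on
  points; along a composite the gauge terms telescope and only those at the ends survive.
  \<open>R\<close> is present because \<sigma> will be additive only on the image of a
  homomorphism.\<close>

lemma
  fixes h :: "(real \<Rightarrow> 'a::metric_space) \<Rightarrow> 'v::group_add" and h' :: "(real \<Rightarrow> 'a) \<Rightarrow> 'u::group_add"
  assumes rep: "jumping_rep X S x0 \<alpha> h C" and rep': "jumping_rep X S x0 \<alpha> h' C'"
    and R: "0 \<in> R" "\<And>a b. a \<in> R \<Longrightarrow> b \<in> R \<Longrightarrow> a + b \<in> R"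
    and \<sigma>: "\<And>a b. a \<in> R \<Longrightarrow> b \<in> R \<Longrightarrow> \<sigma> (a + b) = \<sigma> a + \<sigma> b"
    and C: "\<And>l x. fst l \<in> S \<Longrightarrow> x \<in> X \<Longrightarrow> C l x \<in> R \<and> \<sigma> (C l x) = b (letter_act X l x) + C' l x - b x"
  shows transfer_word_value: "\<And>w x. word_in S w \<Longrightarrow> x \<in> X \<Longrightarrow> word_value X C w x \<in> R \<and>
      \<sigma> (word_value X C w x) = b (word_act X w x) + word_value X C' w x - b x"
    and transfer_total: "\<And>g. (\<And>p x y. path_in X p x y \<Longrightarrow> h p \<in> R \<and> \<sigma> (h p) = b x + h' p - b y) \<Longrightarrow>
      g \<in> carrier (jumping_group X S x0 \<alpha>) \<Longrightarrow> jumping_rep.total X x0 \<alpha> h C g \<in> R \<and>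
      \<sigma> (jumping_rep.total X x0 \<alpha> h C g) = b x0 + jumping_rep.total X x0 \<alpha> h' C' g - b x0"
proof -
  interpret r: jumping_rep X S x0 \<alpha> h C by fact
  interpret r': jumping_rep X S x0 \<alpha> h' C' by fact
  have \<sigma>0: "\<sigma> 0 = 0"
    using \<sigma>[OF R(1,1)] by (simp add: eq_add_self_iff)
  show W: "word_value X C w x \<in> R \<and>
      \<sigma> (word_value X C w x) = b (word_act X w x) + word_value X C' w x - b x"
    if "word_in S w" "x \<in> X" for w x
    using that(1)
  proof (induction w)
    case Nil
    then show ?case by (simp add: R \<sigma>0)
  next
    case (Cons l w)
    then show ?case
      using C[of l "word_act X w x"] r.word_act_mem[OF _ that(2), of w]
      by (simp add: R \<sigma> group_normalize del: add_uminus_conv_diff)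
  qed
  fix g assume H: "\<And>p x y. path_in X p x y \<Longrightarrow> h p \<in> R \<and> \<sigma> (h p) = b x + h' p - b y"
    and "g \<in> carrier (jumping_group X S x0 \<alpha>)"
  then obtain p w where g: "g = (path_class X p, w)" "path_in X p x0 x0" "word_in S w"
    by (auto simp: r.carrier_jumping_group)
  show "r.total g \<in> R \<and> \<sigma> (r.total g) = b x0 + r'.total g - b x0"
    using g H[OF g(2)] H[OF r.word_path[OF g(3)]] W[OF g(3) r.x0_mem]
    by (simp add: r.total_eq r'.total_eq r.word_total_def r'.word_total_def R \<sigma> group_normalize
        del: add_uminus_conv_diff)
qed

context based_warped_system
begin

abbreviation base :: "'a \<Rightarrow> real \<Rightarrow> 'a"
  where "base \<equiv> base_path X x0"

lemma base: "x \<in> X \<Longrightarrow> path_in X (base x) x0 x"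
  by (rule base_path[OF path_connected x0_mem])

end

text \<open>Conversely, a homomorphism \<open>\<pi>\<close> on the jumping group extends to the groupoid by means of a path
  from \<open>x0\<close> to every other point.\<close>

locale jumping_group_hom = based_warped_system X S x0 \<alpha>
  for X :: "'a::metric_space set" and S x0 \<alpha> +
  fixes \<pi> :: "(real \<Rightarrow> 'a) set \<times> ('a \<Rightarrow> 'a) letter list \<Rightarrow> 'v::group_add"
  assumes hom: "f \<in> carrier \<Gamma> \<Longrightarrow> g \<in> carrier \<Gamma> \<Longrightarrow> \<pi> (f \<otimes>\<^bsub>\<Gamma>\<^esub> g) = \<pi> f + \<pi> g"
begin

definition taut_path :: "(real \<Rightarrow> 'a) \<Rightarrow> 'v"
  where "taut_path = loop_functor X x0 (\<lambda>c. \<pi> (c, []))"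

text \<open>The only possible choice: at \<open>x0\<close> the total of [l] must be \<pi> (1, [l]),
  and naturality along \<open>base x\<close>, where \<open>taut_path\<close> is 0, then determines
  the jump at x.\<close>

definition taut_jump :: "('a \<Rightarrow> 'a) letter \<Rightarrow> 'a \<Rightarrow> 'v"
  where "taut_jump l x = - taut_path (letter_act X l \<circ> base x) - taut_path (letter_path X \<alpha> l)
    + \<pi> (path_class X (\<lambda>_. x0), [l])"

definition image :: "'v set"
  where "image = \<pi> ` carrier \<Gamma>"

lemma hom_one: "\<pi> \<one>\<^bsub>\<Gamma>\<^esub> = 0"
  using hom[of "\<one>\<^bsub>\<Gamma>\<^esub>" "\<one>\<^bsub>\<Gamma>\<^esub>"] group.is_monoid[OF group_jumping_group]
  by (simp add: eq_add_self_iff monoid.one_closed monoid.l_one)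

lemma hom_inv: "g \<in> carrier \<Gamma> \<Longrightarrow> \<pi> (inv\<^bsub>\<Gamma>\<^esub> g) = - \<pi> g"
  using hom[of "inv\<^bsub>\<Gamma>\<^esub> g" g] hom_one group.l_inv[OF group_jumping_group, of g]
    group.inv_closed[OF group_jumping_group, of g]
  by (simp add: eq_neg_iff_add_eq_0)

lemma image_0 [simp, intro]: "0 \<in> image"
  using hom_one group.is_monoid[OF group_jumping_group] monoid.one_closed
  unfolding image_def by (metis imageI)

lemma image_add [intro]: "a \<in> image \<Longrightarrow> b \<in> image \<Longrightarrow> a + b \<in> image"
  using hom group.is_monoid[OF group_jumping_group] monoid.m_closed
  unfolding image_def by (smt (verit) imageE imageI)

lemma image_uminus [intro]: "a \<in> image \<Longrightarrow> - a \<in> image"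
  using hom_inv group.inv_closed[OF group_jumping_group]
  unfolding image_def by (smt (verit) imageE imageI)

lemma image_diff [intro]: "a \<in> image \<Longrightarrow> b \<in> image \<Longrightarrow> a - b \<in> image"
  using image_add[of a "- b"] image_uminus by simp

lemma mem_jumping_group: "path_in X p x0 x0 \<Longrightarrow> word_in S w \<Longrightarrow> reduced w \<Longrightarrow> (path_class X p, w) \<in> carrier \<Gamma>"
  by (auto simp: carrier_jumping_group)

lemma hom_path_word:
  assumes "path_in X p x0 x0" "word_in S w" "reduced w"
  shows "\<pi> (path_class X p, w) = \<pi> (path_class X p, []) + \<pi> (path_class X (\<lambda>_. x0), w)"
proof -
  note const = path_in_const[OF x0_mem]
  have "conj_action X x0 \<alpha> [] (path_class X (\<lambda>_. x0)) = path_class X (\<lambda>_. x0)"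
    using const by (intro conj_action_Nil) (auto simp: carrier_fundamental_group)
  then have "path_class X (p +++ conj_path [] (\<lambda>_. x0)) = path_class X (p +++ (\<lambda>_. x0))"
    using mult_path_class[OF assms(1) conj_path[OF _ const], of "[]" x0]
      mult_path_class[OF assms(1) const, of x0]
    by (simp add: conj_action_path_class const)
  also have "\<dots> = path_class X p"
    by (rule path_class_eqI[OF homotopic_paths_join_const[OF assms(1)]])
  finally have "(path_class X p, []) \<otimes>\<^bsub>\<Gamma>\<^esub> (path_class X (\<lambda>_. x0), w) = (path_class X p, w)"
    using mult_jumping_group[OF assms(1) _ const, of "[]" w] by simp
  then show ?thesis
    using hom[of "(path_class X p, [])" "(path_class X (\<lambda>_. x0), w)"] assms const
    by (simp add: mem_jumping_group)
qed

text \<open>The commutation relation of the semidirect product, seen through \<pi>.\<close>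

lemma hom_word_path:
  assumes "path_in X p x0 x0" "word_in S w" "reduced w"
  shows "\<pi> (path_class X (\<lambda>_. x0), w) + \<pi> (path_class X p, []) =
    \<pi> (path_class X (conj_path w p), []) + \<pi> (path_class X (\<lambda>_. x0), w)"
proof -
  note const = path_in_const[OF x0_mem]
  have "path_class X ((\<lambda>_. x0) +++ conj_path w p) = path_class X (conj_path w p)"
    by (rule path_class_eqI[OF homotopic_paths_const_join[OF conj_path[OF assms(2,1)]]])
  then have "(path_class X (\<lambda>_. x0), w) \<otimes>\<^bsub>\<Gamma>\<^esub> (path_class X p, []) = (path_class X (conj_path w p), w)"
    using mult_jumping_group[OF const assms(2,1), of "[]"] foldr_cancel_Cons_Nil[OF assms(3)] by simp
  then show ?thesis
    using hom[of "(path_class X (\<lambda>_. x0), w)" "(path_class X p, [])"] assms const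
      hom_path_word[OF conj_path[OF assms(2,1)] assms(2,3)]
    by (simp add: mem_jumping_group)
qed

lemma hom_word_word:
  assumes "word_in S v" "reduced v" "word_in S w" "reduced w"
  shows "\<pi> (path_class X (\<lambda>_. x0), foldr cancel_Cons v w) =
    \<pi> (path_class X (\<lambda>_. x0), v) + \<pi> (path_class X (\<lambda>_. x0), w)"
proof -
  note const = path_in_const[OF x0_mem]
  interpret \<pi>1: group \<pi>1 by (rule group_pi1)
  have one: "path_class X (\<lambda>_. x0) = \<one>\<^bsub>\<pi>1\<^esub>"
    by (simp add: fundamental_group_def)
  interpret F: path_functor X pi1_functor by (rule path_functor_pi1_functor)
  have "path_in X (word_act X v \<circ> (\<lambda>_. x0)) (word_act X v x0) (word_act X v x0)"
    by (rule path_in_compose[OF const word_act_continuous[OF assms(1)] word_act_image[OF assms(1)]])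
  have "pi1_functor (word_act X v \<circ> (\<lambda>_. x0)) = 0"
    using F.const[OF word_act_mem[OF assms(1) x0_mem]] by (simp add: o_def)
  then have "pi1_functor (conj_path v (\<lambda>_. x0)) = pi1_functor (\<lambda>_. x0)"
    using functor_conj_path[OF F.path_functor_axioms assms(1) const] F.const[OF x0_mem] by simp
  then have "path_class X (conj_path v (\<lambda>_. x0)) = path_class X (\<lambda>_. x0)"
    using pi1_functor_eq_iff[OF conj_path[OF assms(1) const] const] by simp
  then have "path_class X ((\<lambda>_. x0) +++ conj_path v (\<lambda>_. x0)) = path_class X (\<lambda>_. x0)"
    using path_class_eqI[OF homotopic_paths_const_join[OF conj_path[OF assms(1) const]]] by simp
  then have "(path_class X (\<lambda>_. x0), v) \<otimes>\<^bsub>\<Gamma>\<^esub> (path_class X (\<lambda>_. x0), w) =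
      (path_class X (\<lambda>_. x0), foldr cancel_Cons v w)"
    using mult_jumping_group[OF const assms(1) const, of w] by simp
  then show ?thesis
    using hom[of "(path_class X (\<lambda>_. x0), v)" "(path_class X (\<lambda>_. x0), w)"] assms const
    by (simp add: mem_jumping_group)
qed

lemma path_functor_taut_path: "path_functor X taut_path"
  and taut_path_loop: "path_in X p x0 x0 \<Longrightarrow> taut_path p = \<pi> (path_class X p, [])"
  and taut_path_base: "x \<in> X \<Longrightarrow> taut_path (base x) = 0"
proof -
  have *: "\<pi> (a \<otimes>\<^bsub>\<pi>1\<^esub> b, []) = \<pi> (a, []) + \<pi> (b, [])" if "a \<in> carrier \<pi>1" "b \<in> carrier \<pi>1" for a b
  proof -
    have "(a, []) \<otimes>\<^bsub>\<Gamma>\<^esub> (b, []) = (a \<otimes>\<^bsub>\<pi>1\<^esub> b, [])"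
      using conj_action_Nil[OF that(2)]
      by (simp add: jumping_group_def semidirect_product_def mult_free_group)
    moreover have "(a, []) \<in> carrier \<Gamma>" "(b, []) \<in> carrier \<Gamma>"
      using that by (auto simp: carrier_jumping_group carrier_fundamental_group)
    ultimately show ?thesis
      using hom[of "(a, [])" "(b, [])"] by simp
  qed
  show "path_functor X taut_path"
    unfolding taut_path_def by (rule path_functor_loop_functor[OF path_connected x0_mem *])
  show "taut_path p = \<pi> (path_class X p, [])" if "path_in X p x0 x0"
    unfolding taut_path_def by (rule loop_functor_loop[OF path_connected x0_mem * that])
  show "taut_path (base x) = 0" if "x \<in> X"
    unfolding taut_path_def by (rule loop_functor_base_path[OF path_connected x0_mem * that])
qed

sublocale taut: path_functor X taut_path
  by (rule path_functor_taut_path)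

text \<open>For the loop obtained by closing \<open>p\<close> with base paths the claim is the
  relation \<open>hom_word_path\<close>; the terms of the closing paths are those built into
  \<open>taut_jump\<close>.\<close>

lemma taut_natural:
  assumes l: "fst l \<in> S" and p: "path_in X p x y"
  shows "taut_path (letter_act X l \<circ> p) + taut_jump l y = taut_jump l x + taut_path p"
proof -
  interpret L: path_functor X "\<lambda>p. taut_path (letter_act X l \<circ> p)"
    by (rule functor_letter[OF taut.path_functor_axioms l])
  have xy: "x \<in> X" "y \<in> X"
    using path_in_mem[OF p] by auto
  note b = base[OF xy(1)] path_in_reversepath[OF base[OF xy(2)]]
  define \<gamma> where "\<gamma> = base x +++ p +++ reversepath (base y)"
  have \<gamma>: "path_in X \<gamma> x0 x0"
    unfolding \<gamma>_def by (intro path_in_join[OF b(1)] path_in_join[OF p] b(2))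
  have h\<gamma>: "taut_path \<gamma> = taut_path p"
    unfolding \<gamma>_def taut.join[OF b(1) path_in_join[OF p b(2)]] taut.join[OF p b(2)] taut.reverse[OF base[OF xy(2)]]
    by (simp add: taut_path_base xy)
  have hl\<gamma>: "taut_path (letter_act X l \<circ> \<gamma>) = taut_path (letter_act X l \<circ> base x) +
      taut_path (letter_act X l \<circ> p) - taut_path (letter_act X l \<circ> base y)"
    unfolding \<gamma>_def L.join[OF b(1) path_in_join[OF p b(2)]] L.join[OF p b(2)] L.reverse[OF base[OF xy(2)]]
    by (simp add: group_normalize del: add_uminus_conv_diff)
  have lw: "word_in S [l]" "reduced [l]"
    using l by (auto simp: reduced_def)
  have wl: "taut_path (word_path X x0 \<alpha> [l]) = taut_path (letter_path X \<alpha> l)"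
  proof -
    have "letter_act X l \<circ> word_path X x0 \<alpha> [] = (\<lambda>_. letter_act X l x0)"
      by auto
    then show ?thesis
      using functor_word_path_Cons[OF taut.path_functor_axioms l, of "[]"] taut.const[OF letter_act_mem[OF l x0_mem]]
      by (simp del: word_path.simps)
  qed
  have "\<pi> (path_class X (\<lambda>_. x0), [l]) + taut_path \<gamma> =
      taut_path (conj_path [l] \<gamma>) + \<pi> (path_class X (\<lambda>_. x0), [l])"
    using hom_word_path[OF \<gamma> lw] taut_path_loop[OF \<gamma>] taut_path_loop[OF conj_path[OF lw(1) \<gamma>]] by simp
  also have "taut_path (conj_path [l] \<gamma>) =
      taut_path (letter_path X \<alpha> l) + taut_path (letter_act X l \<circ> \<gamma>) - taut_path (letter_path X \<alpha> l)"
    using functor_conj_path[OF taut.path_functor_axioms lw(1) \<gamma>] wl by (simp del: word_path.simps)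
  finally have "\<pi> (path_class X (\<lambda>_. x0), [l]) + taut_path p = taut_path (letter_path X \<alpha> l) +
      (taut_path (letter_act X l \<circ> base x) + taut_path (letter_act X l \<circ> p) - taut_path (letter_act X l \<circ> base y))
      - taut_path (letter_path X \<alpha> l) + \<pi> (path_class X (\<lambda>_. x0), [l])"
    unfolding h\<gamma> hl\<gamma> .
  then show ?thesis
    unfolding taut_jump_def by (simp add: group_normalize del: add_uminus_conv_diff)
qed

text \<open>Naturality moves both jumps to \<open>x0\<close>, where the claim says that (1, [l]) and
  (1, [l^-1]) have inverse values.\<close>

lemma taut_jump_inv_letter:
  assumes l: "fst l \<in> S" and x: "x \<in> X"
  shows "taut_jump (inv_letter l) (letter_act X l x) = - taut_jump l x"
proof -
  let ?m = "inv_letter l"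
  have m: "fst ?m \<in> S" using l by simp
  define e where "e l = \<pi> (path_class X (\<lambda>_. x0), [l])" for l
  have "e l + e ?m = 0"
  proof -
    have "e l + e ?m = \<pi> (path_class X (\<lambda>_. x0), [])"
      using hom_word_word[of "[l]" "[?m]"] l by (simp add: e_def reduced_def cancel_Cons_def)
    then show ?thesis
      using taut_path_loop[OF path_in_const[OF x0_mem]] taut.const[OF x0_mem] by simp
  qed
  then have em: "e ?m = - e l"
    by (metis minus_unique)
  have jl0: "taut_jump l x0 = - taut_path (letter_path X \<alpha> l) + e l" if "fst l \<in> S" for l
  proof -
    have "letter_act X l \<circ> base x0 = (\<lambda>_. letter_act X l x0)"
      by (auto simp: base_path_def)
    then show ?thesis
      using taut.const[OF letter_act_mem[OF that x0_mem]]
      by (simp add: taut_jump_def e_def)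
  qed
  have "taut_path (letter_act X ?m \<circ> (letter_act X l \<circ> base x)) = 0"
  proof -
    have "taut_path (letter_act X ?m \<circ> (letter_act X l \<circ> base x)) = taut_path (base x)"
      using base[OF x] l
      by (intro taut.cong[OF base[OF x]]) (auto simp: path_in_def path_image_def letter_act_inv_letter image_subset_iff)
    then show ?thesis
      by (simp add: taut_path_base x)
  qed
  then have 1: "taut_jump ?m (letter_act X l x) =
      taut_jump ?m (letter_act X l x0) + taut_path (letter_act X l \<circ> base x)"
    using taut_natural[OF m path_in_compose[OF base[OF x] letter_act_continuous[OF l] letter_act_image[OF l]]]
    by simp
  have "taut_path (letter_path X \<alpha> ?m) = - taut_path (letter_act X ?m \<circ> letter_path X \<alpha> l)"
  proof -
    interpret M: path_functor X "\<lambda>p. taut_path (letter_act X ?m \<circ> p)"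
      by (rule functor_letter[OF taut.path_functor_axioms m])
    have "taut_path (letter_path X \<alpha> ?m) = taut_path (letter_act X ?m \<circ> reversepath (letter_path X \<alpha> l))"
      by (rule taut.cong[OF path_in_compose[OF path_in_reversepath[OF letter_path[OF l]]
              letter_act_continuous[OF m] letter_act_image[OF m]] letter_path_inv_letter[OF l]])
    then show ?thesis
      by (simp add: M.reverse[OF letter_path[OF l]])
  qed
  moreover have "taut_jump ?m (letter_act X l x0) = - taut_path (letter_act X ?m \<circ> letter_path X \<alpha> l) +
      (taut_jump ?m x0 + taut_path (letter_path X \<alpha> l))"
    using taut_natural[OF m letter_path[OF l]] by (metis minus_add_cancel)
  ultimately have 2: "taut_jump ?m (letter_act X l x0) = - taut_jump l x0"
    using jl0[OF m] jl0[OF l] em by (simp add: group_normalize del: add_uminus_conv_diff)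
  have "taut_jump l x = - taut_path (letter_act X l \<circ> base x) + taut_jump l x0"
    unfolding jl0[OF l] by (simp add: taut_jump_def e_def group_normalize del: add_uminus_conv_diff)
  then show ?thesis
    unfolding 1 2 by (simp add: group_normalize del: add_uminus_conv_diff)
qed

sublocale taut: jumping_rep X S x0 \<alpha> taut_path taut_jump
  by standard (fact taut_natural taut_jump_inv_letter)+

lemma taut_rep: "jumping_rep X S x0 \<alpha> taut_path taut_jump"
  by (rule taut.jumping_rep_axioms)

text \<open>On loops \<open>taut_path\<close> is \<pi> by construction, and on words both sides add
  up letter by letter.\<close>

lemma total_taut:
  assumes "g \<in> carrier \<Gamma>"
  shows "taut.total g = \<pi> g"
proof -
  obtain p w where g: "g = (path_class X p, w)" "path_in X p x0 x0" "word_in S w" "reduced w"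
    using assms by (auto simp: carrier_jumping_group)
  have "taut.word_total w = \<pi> (path_class X (\<lambda>_. x0), w)"
    using g(3,4)
  proof (induction w)
    case Nil
    then show ?case
      using taut_path_loop[OF path_in_const[OF x0_mem]] taut.const[OF x0_mem] by simp
  next
    case (Cons l w)
    then have l: "fst l \<in> S" and w: "word_in S w" "reduced w"
      by (auto simp: reduced_Cons)
    have "letter_act X l \<circ> base x0 = (\<lambda>_. letter_act X l x0)"
      by (auto simp: base_path_def)
    then have "taut_jump l x0 = - taut_path (letter_path X \<alpha> l) + \<pi> (path_class X (\<lambda>_. x0), [l])"
      using taut.const[OF letter_act_mem[OF l x0_mem]] by (simp add: taut_jump_def)
    then have "taut.word_total [l] = \<pi> (path_class X (\<lambda>_. x0), [l])"
      by (simp add: taut.word_total_single[OF l])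
    moreover have "cancel_Cons l w = l # w"
      using Cons.prems by (cases w) (auto simp: cancel_Cons_def reduced_Cons)
    ultimately show ?case
      using hom_word_word[of "[l]" w] l w Cons.IH[OF w] taut.word_total_Cons[OF l w(1)]
      by (simp add: reduced_def)
  qed
  then show ?thesis
    using g by (simp add: taut.total_eq taut_path_loop hom_path_word[OF g(2-4)])
qed

lemma taut_path_image: "path_in X p x y \<Longrightarrow> taut_path p \<in> image"
  and taut_path_eq: "path_in X p x y \<Longrightarrow> taut_path p =
    \<pi> (path_class X (base x +++ p +++ reversepath (base y)), [])"
proof -
  assume p: "path_in X p x y"
  then have xy: "x \<in> X" "y \<in> X"
    using path_in_mem by auto
  show eq: "taut_path p = \<pi> (path_class X (base x +++ p +++ reversepath (base y)), [])"
    using p by (auto simp: taut_path_def loop_functor_def path_in_def)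
  have "path_in X (base x +++ p +++ reversepath (base y)) x0 x0"
    by (intro path_in_join[OF base[OF xy(1)]] path_in_join[OF p] path_in_reversepath[OF base[OF xy(2)]])
  then show "taut_path p \<in> image"
    unfolding eq image_def by (intro imageI mem_jumping_group) auto
qed

lemma taut_jump_image:
  assumes l: "fst l \<in> S" and x: "x \<in> X"
  shows "taut_jump l x \<in> image"
proof -
  have "\<pi> (path_class X (\<lambda>_. x0), [l]) \<in> image"
    unfolding image_def using l
    by (intro imageI mem_jumping_group path_in_const) (auto simp: reduced_def)
  moreover have "taut_path (letter_act X l \<circ> base x) \<in> image"
    by (rule taut_path_image[OF path_in_compose[OF base[OF x] letter_act_continuous[OF l] letter_act_image[OF l]]])
  moreover have "taut_path (letter_path X \<alpha> l) \<in> image"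
    by (rule taut_path_image[OF letter_path[OF l]])
  ultimately show ?thesis
    unfolding taut_jump_def by blast
qed

text \<open>At \<open>x0\<close> the two representations correspond exactly under \<sigma>.
  Elsewhere \<open>taut_path\<close> vanishes on base paths while \<open>h\<close> may not, and this
  discrepancy is the gauge \<open>h (base x)\<close>.\<close>

lemma transfer_taut:
  fixes h :: "(real \<Rightarrow> 'a) \<Rightarrow> 'u::group_add"
  assumes rep: "jumping_rep X S x0 \<alpha> h C"
    and \<sigma>: "\<And>g. g \<in> carrier \<Gamma> \<Longrightarrow> \<sigma> (\<pi> g) = jumping_rep.total X x0 \<alpha> h C g"
  shows "\<And>a b. a \<in> image \<Longrightarrow> b \<in> image \<Longrightarrow> \<sigma> (a + b) = \<sigma> a + \<sigma> b"
    and "path_in X p x y \<Longrightarrow> \<sigma> (taut_path p) = h (base x) + h p - h (base y)"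
    and "fst l \<in> S \<Longrightarrow> x \<in> X \<Longrightarrow> \<sigma> (taut_jump l x) = h (base (letter_act X l x)) + C l x - h (base x)"
proof -
  interpret r: jumping_rep X S x0 \<alpha> h C by fact
  show add: "\<sigma> (a + b) = \<sigma> a + \<sigma> b" if "a \<in> image" "b \<in> image" for a b
  proof -
    obtain f g where fg: "a = \<pi> f" "b = \<pi> g" "f \<in> carrier \<Gamma>" "g \<in> carrier \<Gamma>"
      using \<open>a \<in> image\<close> \<open>b \<in> image\<close> unfolding image_def by blast
    then have "f \<otimes>\<^bsub>\<Gamma>\<^esub> g \<in> carrier \<Gamma>"
      using group.is_monoid[OF group_jumping_group] monoid.m_closed by metis
    with fg show ?thesis
      using \<sigma>[of "f \<otimes>\<^bsub>\<Gamma>\<^esub> g"] by (simp add: \<sigma> hom r.total_mult)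
  qed
  have \<sigma>0: "\<sigma> 0 = 0"
    using add[of 0 0] by (simp add: eq_add_self_iff)
  have minus: "\<sigma> (- a) = - \<sigma> a" if "a \<in> image" for a
    using add[OF image_uminus[OF that] that] \<sigma>0 by (simp add: eq_neg_iff_add_eq_0)
  show path: "\<sigma> (taut_path p) = h (base x) + h p - h (base y)" if p: "path_in X p x y" for p x y
  proof -
    have xy: "x \<in> X" "y \<in> X"
      using path_in_mem[OF p] by auto
    note b = base[OF xy(1)] path_in_reversepath[OF base[OF xy(2)]]
    have q: "path_in X (base x +++ p +++ reversepath (base y)) x0 x0"
      by (intro path_in_join[OF b(1)] path_in_join[OF p] b(2))
    have "\<sigma> (taut_path p) = h (base x +++ p +++ reversepath (base y))"
      using \<sigma>[OF mem_jumping_group[OF q]] by (simp add: taut_path_eq[OF p] r.total_eq[OF q])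
    then show ?thesis
      unfolding r.join[OF b(1) path_in_join[OF p b(2)]] r.join[OF p b(2)] r.reverse[OF base[OF xy(2)]]
      by (simp add: group_normalize del: add_uminus_conv_diff)
  qed
  assume l: "fst l \<in> S" and x: "x \<in> X"
  have b0: "h (base x0) = 0"
    by (simp add: base_path_def r.const)
  have w: "\<sigma> (\<pi> (path_class X (\<lambda>_. x0), [l])) = h (letter_path X \<alpha> l) + C l x0"
    "\<pi> (path_class X (\<lambda>_. x0), [l]) \<in> image"
    using l \<sigma>[OF mem_jumping_group[OF path_in_const[OF x0_mem]], of "[l]"] path_in_const[OF x0_mem]
    by (auto simp: r.total_eq r.const r.word_total_single image_def reduced_def intro!: imageI mem_jumping_group)
  note q = path_in_compose[OF base[OF x] letter_act_continuous[OF l] letter_act_image[OF l]]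
  have "\<sigma> (taut_jump l x) = - \<sigma> (taut_path (letter_act X l \<circ> base x)) - \<sigma> (taut_path (letter_path X \<alpha> l))
      + (h (letter_path X \<alpha> l) + C l x0)"
    unfolding taut_jump_def
    using taut_path_image[OF q] taut_path_image[OF letter_path[OF l]] w
    by (simp add: add minus image_uminus image_add group_normalize del: add_uminus_conv_diff)
  also have "\<dots> = h (base (letter_act X l x)) + (- h (letter_act X l \<circ> base x) + C l x0)"
    unfolding path[OF q] path[OF letter_path[OF l]] b0
    by (simp add: group_normalize del: add_uminus_conv_diff)
  also have "- h (letter_act X l \<circ> base x) + C l x0 = C l x - h (base x)"
  proof -
    have "C l x0 = h (letter_act X l \<circ> base x) + C l x - h (base x)"
      using r.natural[OF l base[OF x]] by (simp add: eq_diff_eq)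
    then show ?thesis
      by (simp add: group_normalize del: add_uminus_conv_diff)
  qed
  finally show "\<sigma> (taut_jump l x) = h (base (letter_act X l x)) + C l x - h (base x)"
    by (simp add: add_diff_eq)
qed

end

section \<open>From cocycles to representations\<close>

text \<open>Degenerate quadrilaterals give antisymmetry and the rule for triangles. Testing
  triangles alone would be weaker, as the diagonals of a quadrilateral may be longer than
  \<theta>.\<close>

definition cocycle :: "'a set \<Rightarrow> ('a \<Rightarrow> 'a \<Rightarrow> real) \<Rightarrow> real \<Rightarrow> ('a \<Rightarrow> 'a \<Rightarrow> 'v::group_add) \<Rightarrow> bool"
  where "cocycle X \<rho> \<theta> c \<longleftrightarrow> (\<forall>x\<in>X. c x x = 0) \<and>
    (\<forall>x\<in>X. \<forall>y\<in>X. \<forall>z\<in>X. \<forall>u\<in>X. \<rho> x y \<le> \<theta> \<longrightarrow> \<rho> y z \<le> \<theta> \<longrightarrow> \<rho> z u \<le> \<theta> \<longrightarrow> \<rho> u x \<le> \<theta> \<longrightarrow>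
      c x y + c y z + c z u + c u x = 0)"

text \<open>\<open>\<phi>\<close> is a primitive of \<open>c\<close> along \<open>p\<close>.
  Prescribing only its increments over short parameter intervals avoids choosing a
  subdivision.\<close>

definition develops :: "('a \<Rightarrow> 'a \<Rightarrow> 'v::group_add) \<Rightarrow> (real \<Rightarrow> 'a) \<Rightarrow> (real \<Rightarrow> 'v) \<Rightarrow> bool"
  where "develops c p \<phi> \<longleftrightarrow>
    (\<exists>\<eta>>0. \<forall>u\<in>{0..1}. \<forall>v\<in>{0..1}. \<bar>u - v\<bar> < \<eta> \<longrightarrow> - \<phi> u + \<phi> v = c (p u) (p v))"

definition development :: "('a \<Rightarrow> 'a \<Rightarrow> 'v::group_add) \<Rightarrow> (real \<Rightarrow> 'a) \<Rightarrow> 'v"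
  where "development c p = (SOME g. \<exists>\<phi>. develops c p \<phi> \<and> g = - \<phi> 0 + \<phi> 1)"

text \<open>Finitely many steps of size \<eta>/2 lead from 0 to any point of the interval.\<close>

lemma unit_interval_induct:
  fixes \<eta> :: real
  assumes "\<eta> > 0" "P 0"
    and step: "\<And>u v. u \<in> {0..1} \<Longrightarrow> v \<in> {0..1} \<Longrightarrow> \<bar>u - v\<bar> < \<eta> \<Longrightarrow> P u \<Longrightarrow> P v"
    and "u \<in> {0..1}"
  shows "P u"
proof -
  have "u \<in> {0..1} \<Longrightarrow> u \<le> real n * (\<eta> / 2) \<Longrightarrow> P u" for n u
  proof (induction n arbitrary: u)
    case 0
    then show ?case using \<open>P 0\<close> by simp
  next
    case (Suc n)
    define u' where "u' = max 0 (u - \<eta> / 2)"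
    have "u' \<in> {0..1}" "\<bar>u' - u\<bar> < \<eta>" "u' \<le> real n * (\<eta> / 2)"
      using Suc.prems \<open>\<eta> > 0\<close> by (auto simp: u'_def max_def algebra_simps abs_if)
    then show ?case
      using Suc.IH step Suc.prems(1) by blast
  qed
  moreover obtain n :: nat where "u / (\<eta> / 2) \<le> real n"
    using real_arch_simple by blast
  then have "u \<le> real n * (\<eta> / 2)"
    using assms(1) by (simp add: pos_divide_le_eq)
  ultimately show ?thesis
    using assms(4) by blast
qed

text \<open>Two primitives have the same increments over short intervals, hence the same total
  increment.\<close>

lemma development_eqI:
  assumes "develops c p \<phi>"
  shows "development c p = - \<phi> 0 + \<phi> 1"
proof -
  have "\<exists>\<psi>. develops c p \<psi> \<and> development c p = - \<psi> 0 + \<psi> 1"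
    unfolding development_def by (rule someI) (use assms in blast)
  then obtain \<psi> where \<psi>: "develops c p \<psi>" "development c p = - \<psi> 0 + \<psi> 1"
    by blast
  obtain \<eta> where \<eta>: "\<eta> > 0" "\<And>u v. u \<in> {0..1} \<Longrightarrow> v \<in> {0..1} \<Longrightarrow> \<bar>u - v\<bar> < \<eta> \<Longrightarrow>
      - \<phi> u + \<phi> v = c (p u) (p v)"
    using assms unfolding develops_def by blast
  obtain \<eta>' where \<eta>': "\<eta>' > 0" "\<And>u v. u \<in> {0..1} \<Longrightarrow> v \<in> {0..1} \<Longrightarrow> \<bar>u - v\<bar> < \<eta>' \<Longrightarrow>
      - \<psi> u + \<psi> v = c (p u) (p v)"
    using \<psi>(1) unfolding develops_def by blast
  have "- \<phi> 0 + \<phi> 1 = - \<psi> 0 + \<psi> 1"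
  proof (rule unit_interval_induct[of "min \<eta> \<eta>'" "\<lambda>u. - \<phi> 0 + \<phi> u = - \<psi> 0 + \<psi> u"])
    fix u v :: real
    assume uv: "u \<in> {0..1}" "v \<in> {0..1}" "\<bar>u - v\<bar> < min \<eta> \<eta>'"
      and eq: "- \<phi> 0 + \<phi> u = - \<psi> 0 + \<psi> u"
    have "- \<phi> 0 + \<phi> v = (- \<phi> 0 + \<phi> u) + (- \<phi> u + \<phi> v)"
      by (simp add: add.assoc)
    also have "\<dots> = (- \<psi> 0 + \<psi> u) + (- \<psi> u + \<psi> v)"
      using uv \<eta>(2)[of u v] \<eta>'(2)[of u v] eq by simp
    finally show "- \<phi> 0 + \<phi> v = - \<psi> 0 + \<psi> v"
      by (simp add: add.assoc)
  qed (use \<eta> \<eta>' in auto)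
  with \<psi> show ?thesis by simp
qed

locale metric_cocycle = Metric_space X \<rho>
  for X :: "'a set" and \<rho> +
  fixes \<theta> :: real and c :: "'a \<Rightarrow> 'a \<Rightarrow> 'v::group_add"
  assumes nonneg_scale: "0 \<le> \<theta>" and cocycle: "cocycle X \<rho> \<theta> c"
begin

lemma refl: "x \<in> X \<Longrightarrow> c x x = 0"
  using cocycle by (simp add: cocycle_def)

lemma quad:
  "x \<in> X \<Longrightarrow> y \<in> X \<Longrightarrow> z \<in> X \<Longrightarrow> u \<in> X \<Longrightarrow> \<rho> x y \<le> \<theta> \<Longrightarrow> \<rho> y z \<le> \<theta> \<Longrightarrow> \<rho> z u \<le> \<theta> \<Longrightarrow> \<rho> u x \<le> \<theta> \<Longrightarrow>
    c x y + c y z + c z u + c u x = 0"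
  using cocycle by (simp add: cocycle_def)

lemma sym:
  assumes "x \<in> X" "y \<in> X" "\<rho> x y \<le> \<theta>"
  shows "c y x = - c x y"
proof -
  have "\<rho> y x \<le> \<theta>" "\<rho> x x \<le> \<theta>"
    using assms nonneg_scale commute[of x y] by auto
  then have "c x y + c y x = 0"
    using quad[of x y x x] assms by (simp add: refl)
  then show ?thesis
    by (metis minus_unique)
qed

lemma square:
  assumes "x \<in> X" "y \<in> X" "z \<in> X" "u \<in> X" "\<rho> x y \<le> \<theta>" "\<rho> y z \<le> \<theta>" "\<rho> x u \<le> \<theta>" "\<rho> u z \<le> \<theta>"
  shows "c x y + c y z = c x u + c u z"
proof -
  have "c x y + c y z + c z u + c u x = 0"
    using assms commute by (intro quad) auto
  moreover have "c z u = - c u z" "c u x = - c x u"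
    using sym assms by auto
  ultimately have "(c x y + c y z) + (- c u z + - c x u) = 0"
    by (simp only: add.assoc)
  then have "c x y + c y z = - (- c u z + - c x u)"
    by (simp only: eq_neg_iff_add_eq_0)
  then show ?thesis
    by (simp only: minus_add minus_minus)
qed

lemma triangle_eq:
  assumes "x \<in> X" "y \<in> X" "z \<in> X" "\<rho> x y \<le> \<theta>" "\<rho> y z \<le> \<theta>" "\<rho> x z \<le> \<theta>"
  shows "c x y + c y z = c x z"
proof -
  have "\<rho> z z \<le> \<theta>"
    using assms nonneg_scale by simp
  then show ?thesis
    using square[of x y z z] assms refl by simp
qed

text \<open>\<open>\<phi> a\<close> is the product of \<open>c\<close> along the subdivided segment from \<open>0\<close> to \<open>a\<close>; two neighbouring segments
  span a ladder of small quadrilaterals.  With \<open>K\<close> the unit square this gives homotopy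
  invariance.\<close>

lemma star_development:
  fixes F :: "'k::real_normed_vector \<Rightarrow> 'a"
  assumes star: "\<And>a r. a \<in> K \<Longrightarrow> 0 \<le> r \<Longrightarrow> r \<le> 1 \<Longrightarrow> r *\<^sub>R a \<in> K"
    and K: "bounded K" and F: "F ` K \<subseteq> X" and \<eta>: "\<eta> > 0"
    and small: "\<And>a b. a \<in> K \<Longrightarrow> b \<in> K \<Longrightarrow> dist a b < \<eta> \<Longrightarrow> \<rho> (F a) (F b) \<le> \<theta>"
  obtains \<phi> where "\<And>a b. a \<in> K \<Longrightarrow> b \<in> K \<Longrightarrow> dist a b < \<eta> \<Longrightarrow> - \<phi> a + \<phi> b = c (F a) (F b)"
proof -
  obtain B where B: "B > 0" "\<And>a. a \<in> K \<Longrightarrow> norm a \<le> B"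
    using K bounded_pos by metis
  \<comment> \<open>After n subdivisions neighbouring points of a segment are at distance at most
    B/n, which is below \<eta>.\<close>
  obtain n :: nat where n: "B / \<eta> < real n"
    using reals_Archimedean2 by blast
  have n0: "real n > 0"
    using n B(1) \<eta> by (metis divide_pos_pos less_trans)
  define pt where "pt m a = F ((real m / real n) *\<^sub>R a)" for m a
  define \<phi> where "\<phi> m a = rec_nat 0 (\<lambda>i v. v + c (pt i a) (pt (Suc i) a)) m" for m a
  have \<phi>: "\<phi> 0 a = 0" "\<phi> (Suc m) a = \<phi> m a + c (pt m a) (pt (Suc m) a)" for m a
    by (simp_all add: \<phi>_def)
  have in_K: "(real m / real n) *\<^sub>R a \<in> K" if "a \<in> K" "m \<le> n" for a m
    using star[OF that(1)] that(2) n0 by simp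
  then have mem: "pt m a \<in> X" if "a \<in> K" "m \<le> n" for a m
    using F that by (auto simp: pt_def)
  have step: "\<rho> (pt m a) (pt (Suc m) a) \<le> \<theta>" if "a \<in> K" "Suc m \<le> n" for m a
  proof -
    have "real m / real n - real (Suc m) / real n = - (1 / real n)"
      by (simp add: add_divide_distrib)
    then have "(real m / real n) *\<^sub>R a - (real (Suc m) / real n) *\<^sub>R a = (- (1 / real n)) *\<^sub>R a"
      by (metis scaleR_left_diff_distrib)
    then have "dist ((real m / real n) *\<^sub>R a) ((real (Suc m) / real n) *\<^sub>R a) = norm a / real n"
      using n0 by (simp add: dist_norm)
    also have "\<dots> \<le> B / real n"
      using B(2)[OF that(1)] n0 by (simp add: divide_right_mono)
    also have "\<dots> < \<eta>"
      using n n0 \<eta> by (simp add: field_simps)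
    finally show ?thesis
      unfolding pt_def using that by (intro small in_K) auto
  qed
  have close: "\<rho> (pt m a) (pt m b) \<le> \<theta>" if "a \<in> K" "b \<in> K" "dist a b < \<eta>" "m \<le> n" for m a b
  proof -
    have "dist ((real m / real n) *\<^sub>R a) ((real m / real n) *\<^sub>R b) = (real m / real n) * dist a b"
      by (simp add: dist_norm flip: scaleR_diff_right)
    also have "\<dots> \<le> 1 * dist a b"
      using that(4) n0 by (intro mult_right_mono) auto
    finally show ?thesis
      unfolding pt_def using that by (intro small in_K) auto
  qed
  have main: "\<phi> m a + c (pt m a) (pt m b) = \<phi> m b" if "m \<le> n" "a \<in> K" "b \<in> K" "dist a b < \<eta>" for m a b
    using that(1)
  proof (induction m)
    case 0
    then show ?case
      using mem[OF that(2), of 0] by (simp add: \<phi>(1) pt_def refl)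
  next
    case (Suc m)
    have "c (pt m a) (pt (Suc m) a) + c (pt (Suc m) a) (pt (Suc m) b) =
        c (pt m a) (pt m b) + c (pt m b) (pt (Suc m) b)"
      using Suc.prems that by (intro square mem step close) auto
    with Suc show ?case
      by (simp add: \<phi>(2) add.assoc) (simp flip: add.assoc)
  qed
  have "- \<phi> n a + \<phi> n b = c (F a) (F b)" if "a \<in> K" "b \<in> K" "dist a b < \<eta>" for a b
    using main[OF _ that, of n, symmetric] n0 by (simp add: pt_def)
  then show ?thesis
    by (rule that)
qed

lemma develops_exists:
  assumes p: "p ` {0..1} \<subseteq> X" and \<eta>: "\<eta> > 0"
    and small: "\<And>u v. u \<in> {0..1} \<Longrightarrow> v \<in> {0..1} \<Longrightarrow> \<bar>u - v\<bar> < \<eta> \<Longrightarrow> \<rho> (p u) (p v) \<le> \<theta>"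
  obtains \<phi> where "develops c p \<phi>"
proof -
  obtain \<phi> where "\<And>a b. a \<in> {0..1} \<Longrightarrow> b \<in> {0..1} \<Longrightarrow> dist a b < \<eta> \<Longrightarrow> - \<phi> a + \<phi> b = c (p a) (p b)"
    by (rule star_development[of "{0..1}" p \<eta>])
      (use assms in \<open>auto simp: dist_real_def mult_le_one\<close>)
  then have "develops c p \<phi>"
    using \<eta> unfolding develops_def dist_real_def by blast
  then show ?thesis by (rule that)
qed

end

section \<open>Warped metrics and the cocycles on them\<close>

context warped_system
begin

lemma warped_metric_space:
  assumes "t > 0"
  shows "Metric_space X (warped_dist X S t)"
    and "x \<in> X \<Longrightarrow> y \<in> X \<Longrightarrow> warped_dist X S t x y \<le> t * dist x y"
    and "fst l \<in> S \<Longrightarrow> x \<in> X \<Longrightarrow> warped_dist X S t (letter_act X l x) x \<le> 1"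
proof -
  have "warped_dist X S t \<in> warped_metrics X S t"
    using assms generator(2) by (intro warped_dist_in_warped_metrics) auto
  then have M: "Metric_space X (warped_dist X S t)"
    and le: "\<And>x y. x \<in> X \<Longrightarrow> y \<in> X \<Longrightarrow> warped_dist X S t x y \<le> t * dist x y"
    and s: "\<And>s x. x \<in> X \<Longrightarrow> s \<in> S \<Longrightarrow> warped_dist X S t x (s x) \<le> 1"
    by (auto simp: warped_metrics_def)
  show "Metric_space X (warped_dist X S t)" by fact
  show "x \<in> X \<Longrightarrow> y \<in> X \<Longrightarrow> warped_dist X S t x y \<le> t * dist x y" by fact
  assume l: "fst l \<in> S" and x: "x \<in> X"
  show "warped_dist X S t (letter_act X l x) x \<le> 1"
  proof (cases "snd l")
    case True
    then show ?thesis
      using s[OF x l] Metric_space.commute[OF M] by (simp add: letter_act_def)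
  next
    case False
    then have "fst l (letter_act X l x) = x"
      using letter_act_inv_letter[OF l x] by (simp add: letter_act_def inv_letter_def)
    then show ?thesis
      using s[OF letter_act_mem[OF l x] l] by simp
  qed
qed

text \<open>For fixed t the warped distance is at most t times the original one, so uniform
  continuity carries over.\<close>

lemma warped_dist_uniform:
  fixes F :: "'k::metric_space \<Rightarrow> 'a"
  assumes "t > 0" "\<epsilon> > 0" "compact K" "continuous_on K F" "F ` K \<subseteq> X"
  obtains \<eta> where "\<eta> > 0" "\<And>a b. a \<in> K \<Longrightarrow> b \<in> K \<Longrightarrow> dist a b < \<eta> \<Longrightarrow> warped_dist X S t (F a) (F b) \<le> \<epsilon>"
proof -
  have "uniformly_continuous_on K F"
    using assms compact_uniformly_continuous by blast
  then obtain \<eta> where \<eta>: "\<eta> > 0" "\<And>a b. a \<in> K \<Longrightarrow> b \<in> K \<Longrightarrow> dist b a < \<eta> \<Longrightarrow> dist (F b) (F a) < \<epsilon> / t"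
    unfolding uniformly_continuous_on_def using assms(1,2) by (metis divide_pos_pos)
  have "warped_dist X S t (F a) (F b) \<le> \<epsilon>" if "a \<in> K" "b \<in> K" "dist a b < \<eta>" for a b
  proof -
    have "warped_dist X S t (F a) (F b) \<le> t * dist (F a) (F b)"
      using assms that by (intro warped_metric_space(2)) auto
    also have "\<dots> \<le> t * (\<epsilon> / t)"
      using \<eta>(2)[of b a] that assms(1) by (intro mult_left_mono) auto
    finally show ?thesis
      using assms(1) by simp
  qed
  with \<eta>(1) show ?thesis
    using that by blast
qed

end

text \<open>The bound 1 \<le> \<theta> brings every jump by a generator into the range where
  \<open>c\<close> is controlled.\<close>

locale warped_cocycle = based_warped_system X S x0 \<alpha>
  for X :: "'a::metric_space set" and S x0 \<alpha> +
  fixes t \<theta> :: real and c :: "'a \<Rightarrow> 'a \<Rightarrow> 'v::group_add"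
  assumes t: "1 \<le> t" and \<theta>: "1 \<le> \<theta>" and cocycle_warped: "cocycle X (warped_dist X S t) \<theta> c"
begin

abbreviation wd :: "'a \<Rightarrow> 'a \<Rightarrow> real"
  where "wd \<equiv> warped_dist X S t"

abbreviation jump :: "('a \<Rightarrow> 'a) letter \<Rightarrow> 'a \<Rightarrow> 'v"
  where "jump l x \<equiv> c (letter_act X l x) x"

lemma t_pos: "t > 0"
  using t by simp

sublocale W: metric_cocycle X wd \<theta> c
proof -
  interpret Metric_space X wd
    by (rule warped_metric_space(1)[OF t_pos])
  show "metric_cocycle X wd \<theta> c"
    by standard (use \<theta> cocycle_warped in auto)
qed

lemma wd_letter: "fst l \<in> S \<Longrightarrow> x \<in> X \<Longrightarrow> wd (letter_act X l x) x \<le> \<theta>"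
  using warped_metric_space(3)[OF t_pos, of l x] \<theta> by simp

lemma path_small:
  assumes "path_in X p x y"
  obtains \<eta> where "\<eta> > 0" "\<And>u v. u \<in> {0..1} \<Longrightarrow> v \<in> {0..1} \<Longrightarrow> \<bar>u - v\<bar> < \<eta> \<Longrightarrow> wd (p u) (p v) \<le> 1"
proof -
  have "continuous_on {0..1} p" "p ` {0..1} \<subseteq> X"
    using assms by (auto simp: path_in_def path_def path_image_def)
  then obtain \<eta> where "\<eta> > 0" "\<And>u v. u \<in> {0..1} \<Longrightarrow> v \<in> {0..1} \<Longrightarrow> dist u v < \<eta> \<Longrightarrow> wd (p u) (p v) \<le> 1"
    using warped_dist_uniform[OF t_pos, of 1 "{0..1}" p] by auto
  then show ?thesis
    using that unfolding dist_real_def by blast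
qed

lemma path_develops:
  assumes "path_in X p x y"
  obtains \<phi> where "develops c p \<phi>"
proof -
  obtain \<eta> where "\<eta> > 0" "\<And>u v. u \<in> {0..1} \<Longrightarrow> v \<in> {0..1} \<Longrightarrow> \<bar>u - v\<bar> < \<eta> \<Longrightarrow> wd (p u) (p v) \<le> 1"
    using path_small[OF assms] by blast
  then have "\<And>u v. u \<in> {0..1} \<Longrightarrow> v \<in> {0..1} \<Longrightarrow> \<bar>u - v\<bar> < \<eta> \<Longrightarrow> wd (p u) (p v) \<le> \<theta>"
    using \<theta> by fastforce
  then show ?thesis
    using W.develops_exists[of p \<eta>] \<open>\<eta> > 0\<close> assms that by (auto simp: path_in_def path_image_def)
qed

text \<open>The two halves of one primitive of the concatenation are primitives of \<open>p\<close>
  and of \<open>q\<close>.\<close>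

lemma development_join:
  assumes p: "path_in X p x y" and q: "path_in X q y z"
  shows "development c (p +++ q) = development c p + development c q"
proof -
  obtain \<phi> where \<phi>: "develops c (p +++ q) \<phi>"
    using path_develops[OF path_in_join[OF p q]] .
  then obtain \<eta> where \<eta>: "\<eta> > 0" "\<And>u v. u \<in> {0..1} \<Longrightarrow> v \<in> {0..1} \<Longrightarrow> \<bar>u - v\<bar> < \<eta> \<Longrightarrow>
      - \<phi> u + \<phi> v = c ((p +++ q) u) ((p +++ q) v)"
    unfolding develops_def by blast
  have pq: "p 1 = q 0"
    using p q by (auto simp: path_in_def pathstart_def pathfinish_def)
  have "develops c p (\<lambda>u. \<phi> (u / 2))"
    unfolding develops_def
  proof (intro exI[of _ \<eta>] conjI ballI impI)
    fix u v :: real assume "u \<in> {0..1}" "v \<in> {0..1}" "\<bar>u - v\<bar> < \<eta>"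
    then show "- \<phi> (u / 2) + \<phi> (v / 2) = c (p u) (p v)"
      using \<eta>(2)[of "u / 2" "v / 2"] by (auto simp: joinpaths_def abs_if split: if_splits)
  qed (fact \<eta>(1))
  moreover have "develops c q (\<lambda>u. \<phi> ((1 + u) / 2))"
    unfolding develops_def
  proof (intro exI[of _ \<eta>] conjI ballI impI)
    fix u v :: real assume uv: "u \<in> {0..1}" "v \<in> {0..1}" "\<bar>u - v\<bar> < \<eta>"
    have "(p +++ q) ((1 + u) / 2) = q u" if "u \<in> {0..1}" for u
      using that pq by (auto simp: joinpaths_def add_divide_distrib)
    moreover have "\<bar>(1 + u) / 2 - (1 + v) / 2\<bar> < \<eta>"
      using uv(3) by (simp add: add_divide_distrib abs_if split: if_splits)
    ultimately show "- \<phi> ((1 + u) / 2) + \<phi> ((1 + v) / 2) = c (q u) (q v)"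
      using \<eta>(2)[of "(1 + u) / 2" "(1 + v) / 2"] uv by simp
  qed (fact \<eta>(1))
  ultimately show ?thesis
    using development_eqI[OF \<phi>] development_eqI[of c p] development_eqI[of c q] by (simp add: add.assoc)
qed

lemma development_homotopic:
  assumes "homotopic_paths X p q"
  shows "development c p = development c q"
proof -
  obtain H where H: "continuous_on ({0..1} \<times> {0..1}) H" "H \<in> {0..1} \<times> {0..1} \<rightarrow> X"
    and p: "\<And>u. u \<in> {0..1} \<Longrightarrow> H (0, u) = p u" and q: "\<And>u. u \<in> {0..1} \<Longrightarrow> H (1, u) = q u"
    and ends: "\<And>r. r \<in> {0..1::real} \<Longrightarrow> pathstart (H \<circ> Pair r) = pathstart p \<and> pathfinish (H \<circ> Pair r) = pathfinish p"
    using assms unfolding homotopic_paths by blast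
  let ?K = "{0..1} \<times> {0..1} :: (real \<times> real) set"
  have img: "H ` ?K \<subseteq> X"
    using H(2) by auto
  obtain \<eta> where \<eta>: "\<eta> > 0" "\<And>a b. a \<in> ?K \<Longrightarrow> b \<in> ?K \<Longrightarrow> dist a b < \<eta> \<Longrightarrow> wd (H a) (H b) \<le> \<theta>"
    using warped_dist_uniform[OF t_pos _ _ H(1) img, of \<theta>] \<theta> compact_Times[of "{0..1::real}" "{0..1::real}"]
    by auto
  have "bounded ?K"
    by (intro bounded_Times) auto
  then obtain \<phi> where \<phi>: "\<And>a b. a \<in> ?K \<Longrightarrow> b \<in> ?K \<Longrightarrow> dist a b < \<eta> \<Longrightarrow> - \<phi> a + \<phi> b = c (H a) (H b)"
    by (rule W.star_development[OF _ _ img \<eta>, rotated]) (auto simp: mult_le_one)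
  have "develops c p (\<lambda>u. \<phi> (0, u))" "develops c q (\<lambda>u. \<phi> (1, u))"
    unfolding develops_def using \<eta>(1) \<phi>[of "(0, _)" "(0, _)"] \<phi>[of "(1, _)" "(1, _)"] p q
    by (auto intro!: exI[of _ \<eta>] simp: dist_Pair_Pair dist_real_def)
  \<comment> \<open>On the lateral sides \<open>H\<close> is constant, so the increments there are
    values \<open>c z z\<close>, which are 0.\<close>
  moreover have "\<phi> (1, e) = \<phi> (0, e)" if e: "e = 0 \<or> e = 1" for e
  proof (rule unit_interval_induct[of \<eta> "\<lambda>r. \<phi> (r, e) = \<phi> (0, e)"])
    fix u v :: real assume uv: "u \<in> {0..1}" "v \<in> {0..1}" "\<bar>u - v\<bar> < \<eta>" "\<phi> (u, e) = \<phi> (0, e)"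
    have "H (u, e) = H (v, e)"
      using ends[OF uv(1)] ends[OF uv(2)] e by (auto simp: pathstart_def pathfinish_def)
    moreover have "(u, e) \<in> ?K"
      using e uv(1) by auto
    then have "H (u, e) \<in> X"
      using img by (meson image_subset_iff)
    ultimately have "- \<phi> (u, e) + \<phi> (v, e) = 0"
      using \<phi>[of "(u, e)" "(v, e)"] uv e by (auto simp: dist_Pair_Pair dist_real_def W.refl)
    then have "\<phi> (v, e) = \<phi> (u, e)"
      by (metis minus_minus minus_unique)
    with uv show "\<phi> (v, e) = \<phi> (0, e)" by simp
  qed (use \<eta> in auto)
  ultimately show ?thesis
    using development_eqI[of c p] development_eqI[of c q] by simp
qed

sublocale path_functor X "development c"
  by standard (fact development_join development_homotopic)+

lemma development_natural:
  assumes l: "fst l \<in> S" and p: "path_in X p x y"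
  shows "development c (letter_act X l \<circ> p) + jump l y = jump l x + development c p"
proof -
  obtain \<phi> where \<phi>: "develops c p \<phi>"
    using path_develops[OF p] .
  then obtain \<eta> where \<eta>: "\<eta> > 0" "\<And>u v. u \<in> {0..1} \<Longrightarrow> v \<in> {0..1} \<Longrightarrow> \<bar>u - v\<bar> < \<eta> \<Longrightarrow>
      - \<phi> u + \<phi> v = c (p u) (p v)"
    unfolding develops_def by blast
  obtain \<eta>1 where \<eta>1: "\<eta>1 > 0" "\<And>u v. u \<in> {0..1} \<Longrightarrow> v \<in> {0..1} \<Longrightarrow> \<bar>u - v\<bar> < \<eta>1 \<Longrightarrow> wd (p u) (p v) \<le> 1"
    using path_small[OF p] by blast
  obtain \<eta>2 where \<eta>2: "\<eta>2 > 0" "\<And>u v. u \<in> {0..1} \<Longrightarrow> v \<in> {0..1} \<Longrightarrow> \<bar>u - v\<bar> < \<eta>2 \<Longrightarrow>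
      wd ((letter_act X l \<circ> p) u) ((letter_act X l \<circ> p) v) \<le> 1"
    using path_small[OF path_in_compose[OF p letter_act_continuous[OF l] letter_act_image[OF l]]] by blast
  \<comment> \<open>By the squares spanned by nearby points of \<open>p\<close> and their images
    under \<open>l\<close>, subtracting the jump turns a primitive along \<open>p\<close> into one
    along the translated path.\<close>
  define \<psi> where "\<psi> u = \<phi> u - jump l (p u)" for u
  have "develops c (letter_act X l \<circ> p) \<psi>"
    unfolding develops_def
  proof (intro exI[of _ "min \<eta> (min \<eta>1 \<eta>2)"] conjI ballI impI)
    fix u v :: real assume uv: "u \<in> {0..1}" "v \<in> {0..1}" "\<bar>u - v\<bar> < min \<eta> (min \<eta>1 \<eta>2)"
    define a b where "a = p u" "b = p v"
    define la lb where "la = letter_act X l a" "lb = letter_act X l b"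
    have mem: "a \<in> X" "b \<in> X" "la \<in> X" "lb \<in> X"
      using uv path_in_image_mem[OF p] letter_act_mem[OF l] by (auto simp: a_b_def la_lb_def)
    have "c la a + c a b = c la lb + c lb b"
      using mem wd_letter[OF l mem(1)] wd_letter[OF l mem(2)] \<eta>1(2)[of u v] \<eta>2(2)[of u v] uv \<theta>
      by (intro W.square) (auto simp: a_b_def la_lb_def)
    then have "c la lb = c la a + c a b - c lb b"
      by (simp add: eq_diff_eq)
    moreover have "c a b = - \<phi> u + \<phi> v"
      using \<eta>(2)[of u v] uv by (simp add: a_b_def)
    ultimately show "- \<psi> u + \<psi> v = c ((letter_act X l \<circ> p) u) ((letter_act X l \<circ> p) v)"
      by (simp add: \<psi>_def flip: a_b_def la_lb_def) (simp add: group_normalize del: add_uminus_conv_diff)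
  qed (use \<eta> \<eta>1 \<eta>2 in auto)
  then have "development c (letter_act X l \<circ> p) = - \<psi> 0 + \<psi> 1"
    by (rule development_eqI)
  moreover have "development c p = - \<phi> 0 + \<phi> 1"
    by (rule development_eqI[OF \<phi>])
  moreover have "p 0 = x" "p 1 = y"
    using p by (auto simp: path_in_def pathstart_def pathfinish_def)
  ultimately show ?thesis
    by (simp add: \<psi>_def group_normalize del: add_uminus_conv_diff)
qed

sublocale jumping_rep X S x0 \<alpha> "development c" jump
proof
  fix l :: "('a \<Rightarrow> 'a) letter" and x assume l: "fst l \<in> S" and x: "x \<in> X"
  show "jump (inv_letter l) (letter_act X l x) = - jump l x"
    using W.sym[OF letter_act_mem[OF l x] x wd_letter[OF l x]] letter_act_inv_letter[OF l x] by simp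
qed (fact development_natural)

lemma wd_word_act:
  assumes "word_in S w" "x \<in> X"
  shows "wd (word_act X w x) x \<le> length w"
  using assms(1)
proof (induction w)
  case (Cons l w)
  then have l: "fst l \<in> S" and w: "word_in S w" by auto
  have "wd (letter_act X l (word_act X w x)) x \<le> wd (letter_act X l (word_act X w x)) (word_act X w x) + wd (word_act X w x) x"
    using l w assms(2) by (intro W.triangle letter_act_mem word_act_mem)
  also have "\<dots> \<le> 1 + length w"
    using Cons.IH[OF w] warped_metric_space(3)[OF t_pos l word_act_mem[OF w assms(2)]] by simp
  finally show ?case by simp
qed (use assms in simp)

text \<open>All points reached by suffixes of \<open>w\<close> lie within \<theta> of x, so the sum
  of jumps collapses triangle by triangle.\<close>

lemma word_value_short:
  assumes "word_in S w" "x \<in> X" "length w \<le> \<theta>"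
  shows "word_value X jump w x = c (word_act X w x) x"
  using assms(1,3)
proof (induction w)
  case (Cons l w)
  then have l: "fst l \<in> S" and w: "word_in S w" "length w \<le> \<theta>" by auto
  have wx: "word_act X w x \<in> X"
    using w assms(2) by (simp add: word_act_mem)
  have "c (letter_act X l (word_act X w x)) (word_act X w x) + c (word_act X w x) x =
      c (letter_act X l (word_act X w x)) x"
    using l wx assms(2) wd_letter[OF l wx] wd_word_act[OF w(1) assms(2)] wd_word_act[of "l # w" x] w(2) Cons.prems
    by (intro W.triangle_eq letter_act_mem) auto
  then show ?case
    using Cons.IH[OF w] by simp
qed (use assms in \<open>simp add: W.refl\<close>)

lemma word_value_Fix:
  assumes w: "word_in S w" and len: "length w \<le> 4 * n" and n: "real n \<le> \<theta>" and z: "z \<in> Fix X w"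
  shows "word_value X jump w z = 0"
proof -
  \<comment> \<open>Four consecutive blocks of at most n letters: each is worth one value of
    \<open>c\<close>, and the four values belong to a quadrilateral that closes up at z.\<close>
  define w1 w2 w3 w4 where w_defs: "w1 = take n w" "w2 = take n (drop n w)"
    "w3 = take n (drop n (drop n w))" "w4 = drop n (drop n (drop n w))"
  have w_eq: "w = w1 @ w2 @ w3 @ w4"
    unfolding w_defs by (simp only: append_take_drop_id)
  have lens: "length w1 \<le> n" "length w2 \<le> n" "length w3 \<le> n" "length w4 \<le> n"
    using len by (auto simp: w_defs)
  then have lens: "length w1 \<le> \<theta>" "length w2 \<le> \<theta>" "length w3 \<le> \<theta>" "length w4 \<le> \<theta>"
    using n by linarith+
  have ws: "word_in S w1" "word_in S w2" "word_in S w3" "word_in S w4"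
    using w unfolding w_eq by auto
  have zX: "z \<in> X" and wz: "word_act X w z = z"
    using z by (auto simp: Fix_def)
  define a b d where "a = word_act X w4 z" "b = word_act X w3 a" "d = word_act X w2 b"
  have mem: "a \<in> X" "b \<in> X" "d \<in> X"
    using ws zX by (auto simp: a_b_d_def word_act_mem)
  have dz: "word_act X w1 d = z"
    using wz unfolding w_eq by (simp add: a_b_d_def)
  have "word_value X jump w z = c z d + c d b + c b a + c a z"
    unfolding w_eq word_value_append
    using word_value_short[OF ws(1) mem(3) lens(1)] word_value_short[OF ws(2) mem(2) lens(2)]
      word_value_short[OF ws(3) mem(1) lens(3)] word_value_short[OF ws(4) zX lens(4)] dz
    by (simp add: a_b_d_def add.assoc)
  also have "\<dots> = 0"
    using wd_word_act[OF ws(1) mem(3)] wd_word_act[OF ws(2) mem(2)] wd_word_act[OF ws(3) mem(1)]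
      wd_word_act[OF ws(4) zX] lens mem zX dz
    by (intro W.quad) (auto simp: a_b_d_def)
  finally show ?thesis .
qed

text \<open>A development is a sum of values of \<open>c\<close> on pairs at distance at most 1.
  With \<open>R\<close> the image of a homomorphism, this provides the membership required for
  \<sigma> to be additive.\<close>

lemma development_in:
  assumes R: "0 \<in> R" "\<And>a b. a \<in> R \<Longrightarrow> b \<in> R \<Longrightarrow> a + b \<in> R"
    and c: "\<And>x y. x \<in> X \<Longrightarrow> y \<in> X \<Longrightarrow> wd x y \<le> 1 \<Longrightarrow> c x y \<in> R"
    and p: "path_in X p x y"
    and \<phi>: "develops c p \<phi>" and u: "u \<in> {0..1}"
  shows "- \<phi> 0 + \<phi> u \<in> R"
proof -
  obtain \<eta> where \<eta>: "\<eta> > 0" "\<And>u v. u \<in> {0..1} \<Longrightarrow> v \<in> {0..1} \<Longrightarrow> \<bar>u - v\<bar> < \<eta> \<Longrightarrow>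
      - \<phi> u + \<phi> v = c (p u) (p v)"
    using \<phi> unfolding develops_def by blast
  obtain \<eta>1 where \<eta>1: "\<eta>1 > 0" "\<And>u v. u \<in> {0..1} \<Longrightarrow> v \<in> {0..1} \<Longrightarrow> \<bar>u - v\<bar> < \<eta>1 \<Longrightarrow> wd (p u) (p v) \<le> 1"
    using path_small[OF p] by blast
  show ?thesis
  proof (rule unit_interval_induct[of "min \<eta> \<eta>1" "\<lambda>u. - \<phi> 0 + \<phi> u \<in> R"])
    fix u v :: real assume uv: "u \<in> {0..1}" "v \<in> {0..1}" "\<bar>u - v\<bar> < min \<eta> \<eta>1" "- \<phi> 0 + \<phi> u \<in> R"
    have "- \<phi> u + \<phi> v \<in> R"
      using \<eta>(2)[of u v] \<eta>1(2)[of u v] c[of "p u" "p v"] path_in_image_mem[OF p] uv by simp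
    then have "(- \<phi> 0 + \<phi> u) + (- \<phi> u + \<phi> v) \<in> R"
      using R(2) uv(4) by blast
    then show "- \<phi> 0 + \<phi> v \<in> R"
      by (simp add: add.assoc)
  qed (use \<eta> \<eta>1 R u in auto)
qed

end

section \<open>Jumping chains\<close>

text \<open>Stands for a geodesic reparametrised on the unit interval. The bound keeps the whole
  path as close to its start as its end is, which controls \<open>c\<close> along it and the size of
  chains.\<close>

definition tight_path :: "'a::metric_space set \<Rightarrow> (real \<Rightarrow> 'a) \<Rightarrow> 'a \<Rightarrow> 'a \<Rightarrow> bool"
  where "tight_path X q x y \<longleftrightarrow> path_in X q x y \<and> (\<forall>u\<in>{0..1}. dist x (q u) \<le> dist x y)"

text \<open>\<open>jumping_chain X S t x r p w y\<close>: the pair \<open>(p, w) : x \<rightarrow> y\<close> is the composite of a jumping-path from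
  \<open>x\<close> to \<open>y\<close> with chord length \<open>r\<close>.\<close>

inductive jumping_chain ::
  "'a::metric_space set \<Rightarrow> ('a \<Rightarrow> 'a) set \<Rightarrow> real \<Rightarrow> 'a \<Rightarrow> real \<Rightarrow> (real \<Rightarrow> 'a) \<Rightarrow>
    ('a \<Rightarrow> 'a) letter list \<Rightarrow> 'a \<Rightarrow> bool"
  for X S t x
where
  start: "tight_path X q x y \<Longrightarrow> jumping_chain X S t x (t * dist x y) q [] y"
| step: "jumping_chain X S t x r p w y \<Longrightarrow> fst l \<in> S \<Longrightarrow> tight_path X q (letter_act X l y) z \<Longrightarrow>
    jumping_chain X S t x (r + 1 + t * dist (letter_act X l y) z)
      (p +++ (word_act X (w @ [inv_letter l]) \<circ> q)) (w @ [inv_letter l]) z"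

lemma finite_uniform:
  assumes "finite W" "\<And>w. w \<in> W \<Longrightarrow> \<exists>\<delta>>0. P w \<delta>"
    and mono: "\<And>w \<delta> \<delta>'. P w \<delta> \<Longrightarrow> 0 < \<delta>' \<Longrightarrow> \<delta>' \<le> \<delta> \<Longrightarrow> P w \<delta>'"
  shows "\<exists>\<delta>>0. \<forall>w\<in>W. P w (\<delta>::real)"
  using assms(1,2)
proof (induction W)
  case empty
  show ?case by (intro exI[of _ 1]) simp
next
  case (insert w W)
  then obtain \<delta>' where "\<delta>' > 0" "\<forall>w\<in>W. P w \<delta>'"
    by auto
  moreover obtain \<delta> where "\<delta> > 0" "P w \<delta>"
    using insert.prems by blast
  ultimately show ?case
    using mono[of w \<delta> "min \<delta> \<delta>'"] mono[of _ \<delta>' "min \<delta> \<delta>'"]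
    by (intro exI[of _ "min \<delta> \<delta>'"]) auto
qed

lemma dist_le_path_length:
  "ennreal (dist (pathstart \<gamma>) (pathfinish \<gamma>)) \<le> path_length \<gamma>"
proof -
  let ?u = "\<lambda>n::nat. if n = 0 then 0 else 1 :: real"
  have "(1, ?u) \<in> {(n :: nat, u). mono_on {..n} u \<and> u ` {..n} \<subseteq> {0..1}}"
    by (auto simp: mono_on_def)
  then show ?thesis
    unfolding path_length_def pathstart_def pathfinish_def
    by (rule SUP_upper2) simp
qed

context warped_system
begin

lemma finite_words: "finite {w. word_in S w \<and> length w \<le> n}"
proof -
  have "finite {w. set w \<subseteq> S \<times> (UNIV :: bool set) \<and> length w \<le> n}"
    by (rule finite_lists_length_le) (simp add: finite_S)
  then show ?thesis
    by (rule finite_subset[rotated]) (auto simp: word_in_def)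
qed

text \<open>There are finitely many such words, and each acts uniformly continuously on the compact
  X.\<close>

lemma words_equicontinuous:
  assumes "\<epsilon> > 0"
  obtains \<delta> where "\<delta> > 0"
    "\<And>w x y. word_in S w \<Longrightarrow> length w \<le> n \<Longrightarrow> x \<in> X \<Longrightarrow> y \<in> X \<Longrightarrow> dist x y < \<delta> \<Longrightarrow>
      dist (word_act X w x) (word_act X w y) < \<epsilon>"
proof -
  let ?P = "\<lambda>w \<delta>. \<forall>x\<in>X. \<forall>y\<in>X. dist x y < \<delta> \<longrightarrow> dist (word_act X w x) (word_act X w y) < \<epsilon>"
  have "\<exists>\<delta>>0. \<forall>w\<in>{w. word_in S w \<and> length w \<le> n}. ?P w \<delta>"
  proof (rule finite_uniform[OF finite_words])
    fix w assume "w \<in> {w. word_in S w \<and> length w \<le> n}"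
    then have "uniformly_continuous_on X (word_act X w)"
      using word_act_continuous compact by (intro compact_uniformly_continuous) auto
    then show "\<exists>\<delta>>0. ?P w \<delta>"
      using assms unfolding uniformly_continuous_on_def by (metis dist_commute)
  qed auto
  then obtain \<delta> where "\<delta> > 0" "\<forall>w\<in>{w. word_in S w \<and> length w \<le> n}. ?P w \<delta>"
    by blast
  then show ?thesis
    by (intro that) auto
qed

text \<open>The displacement of \<open>w\<close> is continuous and positive on the compact set of
  points at distance at least \<epsilon> from all fixed points, so it has a positive minimum there.
  If \<open>w\<close> has no fixed point, this set is all of X.\<close>

lemma near_Fix:
  assumes "\<epsilon> > 0"
  obtains \<delta> where "\<delta> > 0"
    "\<And>w x. word_in S w \<Longrightarrow> length w \<le> n \<Longrightarrow> x \<in> X \<Longrightarrow> dist x (word_act X w x) < \<delta> \<Longrightarrow>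
      \<exists>z\<in>Fix X w. dist x z < \<epsilon>"
proof -
  let ?P = "\<lambda>w \<delta>. \<forall>x\<in>X. dist x (word_act X w x) < \<delta> \<longrightarrow> (\<exists>z\<in>Fix X w. dist x z < \<epsilon>)"
  have "\<exists>\<delta>>0. \<forall>w\<in>{w. word_in S w \<and> length w \<le> n}. ?P w \<delta>"
  proof (rule finite_uniform[OF finite_words])
    fix w assume "w \<in> {w. word_in S w \<and> length w \<le> n}"
    then have w: "word_in S w" by simp
    define K where "K = X \<inter> (\<Inter>z\<in>Fix X w. {x. \<epsilon> \<le> dist x z})"
    have "compact K"
      unfolding K_def
      by (intro compact_Int_closed compact closed_INT ballI closed_Collect_le continuous_intros)
    show "\<exists>\<delta>>0. ?P w \<delta>"
    proof (cases "K = {}")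
      case True
      then show ?thesis
        by (intro exI[of _ 1]) (fastforce simp: K_def not_le)
    next
      case False
      have "continuous_on K (\<lambda>x. dist x (word_act X w x))"
        using word_act_continuous[OF w] by (intro continuous_intros) (auto simp: K_def elim: continuous_on_subset)
      then obtain x where x: "x \<in> K" "\<And>y. y \<in> K \<Longrightarrow> dist x (word_act X w x) \<le> dist y (word_act X w y)"
        using continuous_attains_inf[OF \<open>compact K\<close> False] by blast
      have "dist x (word_act X w x) > 0"
      proof (rule ccontr)
        assume "\<not> dist x (word_act X w x) > 0"
        then have "x \<in> Fix X w"
          using x(1) by (auto simp: Fix_def K_def)
        then show False
          using x(1) assms by (auto simp: K_def)
      qed
      then show ?thesis
        using x(2) by (intro exI[of _ "dist x (word_act X w x)"]) (fastforce simp: K_def not_le)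
    qed
  qed auto
  then obtain \<delta> where "\<delta> > 0" "\<forall>w\<in>{w. word_in S w \<and> length w \<le> n}. ?P w \<delta>"
    by blast
  then show ?thesis
    by (intro that) auto
qed

lemma tight_path_exists:
  assumes "x \<in> X" "y \<in> X"
  obtains q where "tight_path X q x y"
proof -
  obtain t where "jumping_geodesic X S t"
    using jumping_geodesic eventually_happens'[of at_top] by (metis trivial_limit_at_top_linorder)
  then have "geodesic_set X"
    by (simp add: jumping_geodesic_def)
  then obtain g where g: "g 0 = x" "g (dist x y) = y" "g ` {0..dist x y} \<subseteq> X"
      "\<And>a b. a \<in> {0..dist x y} \<Longrightarrow> b \<in> {0..dist x y} \<Longrightarrow> dist (g a) (g b) = \<bar>a - b\<bar>"
  proof -
    have "\<exists>g :: real \<Rightarrow> 'a. g 0 = x \<and> g (dist x y) = y \<and> g ` {0..dist x y} \<subseteq> X \<and>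
        (\<forall>a\<in>{0..dist x y}. \<forall>b\<in>{0..dist x y}. dist (g a) (g b) = \<bar>a - b\<bar>)"
      using \<open>geodesic_set X\<close> assms unfolding geodesic_set_def by (elim ballE) auto
    then show thesis
      by (elim exE conjE) (rule that, auto)
  qed
  have "continuous_on {0..dist x y} g"
    unfolding continuous_on_iff
  proof (intro ballI allI impI)
    fix a e :: real assume a: "a \<in> {0..dist x y}" and "0 < e"
    then show "\<exists>d>0. \<forall>b\<in>{0..dist x y}. dist b a < d \<longrightarrow> dist (g b) (g a) < e"
      using g(4)[OF _ a] by (intro exI[of _ e]) (simp add: dist_real_def)
  qed
  then have "continuous_on {0..1} (\<lambda>u. g (u * dist x y))"
    by (rule continuous_on_compose2) (intro continuous_intros, auto simp: mult_left_le_one_le)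
  moreover have in_ivl: "u * dist x y \<in> {0..dist x y}" if "u \<in> {0..1}" for u
    using that by (auto simp: mult_left_le_one_le)
  moreover have "dist x (g (u * dist x y)) \<le> dist x y" if "u \<in> {0..1}" for u
    using g(4)[of 0 "u * dist x y"] in_ivl[OF that] g(1) by auto
  ultimately have "tight_path X (\<lambda>u. g (u * dist x y)) x y"
    using g(1-3)
    by (auto simp: image_subset_iff tight_path_def path_in_def path_def path_image_def pathstart_def pathfinish_def)
  then show ?thesis by (rule that)
qed

lemma jumping_chain_basic:
  assumes "jumping_chain X S t x r p w y" "0 \<le> t"
  shows "word_in S w" "path_in X p x (word_act X w y)" "real (length w) \<le> r" "y \<in> X"
proof -
  have "word_in S w \<and> path_in X p x (word_act X w y) \<and> real (length w) \<le> r \<and> y \<in> X"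
    using assms(1)
  proof (induction rule: jumping_chain.induct)
    case (start q y)
    then show ?case
      using assms(2) path_in_mem[of X q x y] by (auto simp: tight_path_def)
  next
    case (step r p w y l q z)
    let ?w = "w @ [inv_letter l]"
    have w: "word_in S ?w"
      using step by simp
    have q: "path_in X q (letter_act X l y) z"
      using step by (simp add: tight_path_def)
    have "path_in X (word_act X ?w \<circ> q) (word_act X ?w (letter_act X l y)) (word_act X ?w z)"
      by (rule path_in_compose[OF q word_act_continuous[OF w] word_act_image[OF w]])
    \<comment> \<open>Jumping from y to l y is the morphism with letter l^-1, whose action leads
      back to y; hence the chain appends \<open>inv_letter l\<close>.\<close>
    moreover have "word_act X ?w (letter_act X l y) = word_act X w y"
      using step by (simp add: letter_act_inv_letter)
    ultimately have "path_in X (p +++ (word_act X ?w \<circ> q)) x (word_act X ?w z)"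
      using step.IH by (auto intro: path_in_join)
    moreover have "0 \<le> t * dist (letter_act X l y) z"
      using assms(2) by simp
    ultimately show ?case
      using step.IH w path_in_mem[OF q] by simp
  qed
  then show "word_in S w" "path_in X p x (word_act X w y)" "real (length w) \<le> r" "y \<in> X"
    by auto
qed

lemma mdist_warped_metric: "t > 0 \<Longrightarrow> mdist (warped_metric X S t) = warped_dist X S t"
  and mspace_warped_metric: "t > 0 \<Longrightarrow> mspace (warped_metric X S t) = X"
  using Metric_space.mdist_metric[OF warped_metric_space(1)] Metric_space.mspace_metric[OF warped_metric_space(1)]
  by (simp_all add: warped_metric_def)

text \<open>Each continuous piece of a jumping-path that realises the distance is replaced by a
  tight path with the same ends. The length of a path bounds its chord, so the total does not grow;
  homotopy classes may change.\<close>

lemma jumping_chain_exists: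
  assumes t: "t \<ge> 1" and geod: "jumping_geodesic X S t" and x: "x \<in> X" and y: "y \<in> X"
  obtains r p w where "r \<le> warped_dist X S t x y" "jumping_chain X S t x r p w y"
proof -
  obtain n \<gamma> l where \<gamma>: "jumping_path X S n \<gamma> l" "pathstart (\<gamma> 0) = x" "pathfinish (\<gamma> n) = y"
      "jumping_path_length t n \<gamma> = ennreal (warped_dist X S t x y)"
  proof -
    have "\<forall>x\<in>X. \<forall>y\<in>X. \<exists>n \<gamma> l. jumping_path X S n \<gamma> l \<and> pathstart (\<gamma> 0) = x \<and> pathfinish (\<gamma> n) = y \<and>
        jumping_path_length t n \<gamma> = ennreal (mdist (warped_metric X S t) x y)"
      by (rule conjunct2[OF geod[unfolded jumping_geodesic_def]])
    from this[rule_format, OF x y] show thesis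
      using t by (elim exE conjE) (rule that, auto simp: mdist_warped_metric)
  qed
  have mem: "pathstart (\<gamma> i) \<in> X" "pathfinish (\<gamma> i) \<in> X" if "i \<le> n" for i
  proof -
    have "path_image (\<gamma> i) \<subseteq> X"
      using \<gamma>(1) that unfolding jumping_path_def by simp
    then show "pathstart (\<gamma> i) \<in> X" "pathfinish (\<gamma> i) \<in> X"
      using pathstart_in_path_image[of "\<gamma> i"] pathfinish_in_path_image[of "\<gamma> i"] by blast+
  qed
  have len: "ennreal (t * dist (pathstart (\<gamma> i)) (pathfinish (\<gamma> i))) \<le> ennreal t * path_length (\<gamma> i)" for i
    using dist_le_path_length[of "\<gamma> i"] t by (simp add: ennreal_mult mult_left_mono)
  have "i \<le> n \<Longrightarrow> \<exists>r p w. jumping_chain X S t x r p w (pathfinish (\<gamma> i)) \<and>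
      ennreal r \<le> of_nat i + (\<Sum>j\<le>i. ennreal t * path_length (\<gamma> j))" for i
  proof (induction i)
    case 0
    obtain q where "tight_path X q x (pathfinish (\<gamma> 0))"
      using tight_path_exists[OF x mem(2)] by blast
    then show ?case
      using len[of 0] \<gamma>(2) by (auto intro!: exI jumping_chain.start)
  next
    case (Suc i)
    then obtain r p w where r: "jumping_chain X S t x r p w (pathfinish (\<gamma> i))"
      "ennreal r \<le> of_nat i + (\<Sum>j\<le>i. ennreal t * path_length (\<gamma> j))"
      by auto
    have "Suc i \<in> {1..n}"
      using Suc.prems by simp
    then have l: "fst (l (Suc i)) \<in> S" "pathstart (\<gamma> (Suc i)) = letter_act X (l (Suc i)) (pathfinish (\<gamma> i))"
      using \<gamma>(1) unfolding jumping_path_def by (auto dest!: bspec[of _ _ "Suc i"])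
    obtain q where q: "tight_path X q (letter_act X (l (Suc i)) (pathfinish (\<gamma> i))) (pathfinish (\<gamma> (Suc i)))"
      using tight_path_exists[OF mem[OF Suc.prems]] l(2) by metis
    define d where "d = dist (letter_act X (l (Suc i)) (pathfinish (\<gamma> i))) (pathfinish (\<gamma> (Suc i)))"
    have "0 \<le> r"
      using jumping_chain_basic(3)[OF r(1)] t by linarith
    then have "ennreal (r + 1 + t * d) = ennreal r + 1 + ennreal (t * d)"
      using t by (simp add: d_def ennreal_plus)
    also have "\<dots> \<le> (of_nat i + (\<Sum>j\<le>i. ennreal t * path_length (\<gamma> j))) + 1 + ennreal t * path_length (\<gamma> (Suc i))"
      using r(2) len[of "Suc i"] l(2) by (intro add_mono) (auto simp: d_def)
    also have "\<dots> = of_nat (Suc i) + (\<Sum>j\<le>Suc i. ennreal t * path_length (\<gamma> j))"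
      by (simp add: algebra_simps)
    finally show ?case
      using jumping_chain.step[OF r(1) l(1) q] unfolding d_def by blast
  qed
  from this[of n] obtain r p w where r: "jumping_chain X S t x r p w y"
      "ennreal r \<le> jumping_path_length t n \<gamma>"
    using \<gamma>(3) by (auto simp: jumping_path_length_def)
  have "r \<le> warped_dist X S t x y"
    using r(2) \<gamma>(4) Metric_space.nonneg[OF warped_metric_space(1)] t by (simp add: ennreal_le_iff)
  then show ?thesis
    using that r(1) by blast
qed

lemma joinpaths_mem:
  assumes "u \<in> {0..1}" "\<And>v. v \<in> {0..1} \<Longrightarrow> P (p v)" "\<And>v. v \<in> {0..1} \<Longrightarrow> P (q v)"
  shows "P ((p +++ q) u)"
  using assms by (auto simp: joinpaths_def)

text \<open>Each piece of a chain of length at most n has chord at most n/t, which tends to 0, and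
  words of length at most n act equicontinuously.\<close>

lemma jumping_chain_small:
  assumes "\<epsilon> > 0"
  obtains t0 where "t0 \<ge> 1" "\<And>t x r p w y. t \<ge> t0 \<Longrightarrow> jumping_chain X S t x r p w y \<Longrightarrow> r \<le> real n \<Longrightarrow>
    path_image p \<subseteq> ball x \<epsilon>"
proof -
  \<comment> \<open>The budget \<epsilon> is shared among at most n + 1 pieces.\<close>
  define e where "e = \<epsilon> / (real n + 1)"
  have e: "e > 0" "(real n + 1) * e = \<epsilon>"
    using assms by (simp_all add: e_def)
  obtain \<delta> where \<delta>: "\<delta> > 0" "\<And>w x y. word_in S w \<Longrightarrow> length w \<le> n \<Longrightarrow> x \<in> X \<Longrightarrow> y \<in> X \<Longrightarrow> dist x y < \<delta> \<Longrightarrow>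
      dist (word_act X w x) (word_act X w y) < e"
    using words_equicontinuous[OF e(1)] by metis
  \<comment> \<open>From this parameter on, a chord d with t * d \<le> n is shorter than
    \<delta>.\<close>
  define t0 where "t0 = real n / \<delta> + 1"
  have t0: "1 \<le> t0"
    using \<delta>(1) by (simp add: t0_def)
  have small: "d < \<delta>" if "t \<ge> t0" "t * d \<le> real n" "0 \<le> d" for t d
  proof (rule ccontr)
    assume "\<not> d < \<delta>"
    have "real n < (real n / \<delta> + 1) * \<delta>"
      using \<delta>(1) by (simp add: field_simps)
    also have "\<dots> \<le> t * d"
      using \<open>\<not> d < \<delta>\<close> that(1) \<delta>(1) t0 unfolding t0_def by (intro mult_mono) linarith+
    finally show False using that(2) by simp
  qed
  have main: "\<forall>u\<in>{0..1}. dist x (p u) < (real (length w) + 1) * e"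
    if "t \<ge> t0" and "jumping_chain X S t x r p w y" "r \<le> real n" for t x r p w y
    using that(2,3)
  proof (induction rule: jumping_chain.induct)
    case (start q y)
    show ?case
    proof
      fix u :: real assume u: "u \<in> {0..1}"
      have "x \<in> X" "q u \<in> X" "dist x (q u) \<le> dist x y" "dist x y < \<delta>"
        using start u path_in_mem[of X q x y] small[OF that(1)]
        by (auto simp: tight_path_def path_in_def path_image_def)
      then show "dist x (q u) < (real (length []) + 1) * e"
        using \<delta>(2)[of "[]" x "q u"] by simp
    qed
  next
    case (step r p w y l q z)
    let ?w = "w @ [inv_letter l]" and ?y = "letter_act X l y"
    have t: "0 \<le> t"
      using that(1) t0 by simp
    have d: "0 \<le> t * dist ?y z"
      using t by simp
    have r: "0 \<le> r"
      using jumping_chain_basic(3)[OF step(1) t] by linarith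
    have IH: "\<forall>u\<in>{0..1}. dist x (p u) < (real (length w) + 1) * e"
      using step d by simp
    have len: "length ?w \<le> n"
      using jumping_chain_basic(3)[OF jumping_chain.step[OF step(1-3)] t] step.prems by simp
    have w: "word_in S ?w"
      using jumping_chain_basic(1)[OF jumping_chain.step[OF step(1-3)] t] .
    have q: "path_in X q ?y z" "\<And>u. u \<in> {0..1} \<Longrightarrow> dist ?y (q u) \<le> dist ?y z"
      using step by (auto simp: tight_path_def)
    have "dist ?y z < \<delta>"
      using small[OF that(1), of "dist ?y z"] step.prems r by simp
    have "p 1 = word_act X w y" "y \<in> X"
      using jumping_chain_basic(2,4)[OF step(1) t] by (auto simp: path_in_def pathfinish_def)
    then have p1: "p 1 = word_act X ?w ?y"
      using step by (simp add: letter_act_inv_letter)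
    show ?case
    proof
      fix u :: real assume u: "u \<in> {0..1}"
      show "dist x ((p +++ (word_act X ?w \<circ> q)) u) < (real (length ?w) + 1) * e"
        using u
      proof (rule joinpaths_mem)
        fix v :: real assume v: "v \<in> {0..1}"
        show "dist x (p v) < (real (length ?w) + 1) * e"
          using IH v e by (fastforce simp: algebra_simps)
        have "dist (word_act X ?w ?y) (word_act X ?w (q v)) < e"
          using q(2)[OF v] \<open>dist ?y z < \<delta>\<close> path_in_mem[OF q(1)] q(1) v
          by (intro \<delta>(2) w len) (auto simp: path_in_def path_image_def)
        moreover have "dist x (p 1) < (real (length w) + 1) * e"
          using IH by simp
        ultimately have "dist x (word_act X ?w (q v)) < (real (length w) + 1) * e + e"
          unfolding p1 using dist_triangle[of x "word_act X ?w (q v)" "word_act X ?w ?y"] by linarith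
        then show "dist x ((word_act X ?w \<circ> q) v) < (real (length ?w) + 1) * e"
          by (simp add: algebra_simps)
      qed
    qed
  qed
  show ?thesis
  proof (rule that)
    show "t0 \<ge> 1" by (rule t0)
    fix t x r p w y assume *: "t \<ge> t0" "jumping_chain X S t x r p w y" "r \<le> real n"
    have "length w \<le> n"
      using jumping_chain_basic(3)[OF *(2)] * t0 by simp
    then have "(real (length w) + 1) * e \<le> \<epsilon>"
      unfolding e(2)[symmetric] using e(1) by (intro mult_right_mono) auto
    then show "path_image p \<subseteq> ball x \<epsilon>"
      using main[OF *] by (fastforce simp: path_image_def)
  qed
qed

end

context warped_cocycle
begin

text \<open>The path stays within \<theta> of x, so sending u to \<open>c x (q u)\<close> is itself
  a primitive along \<open>q\<close>.\<close>

lemma tight_path_value: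
  assumes x: "x \<in> X" and q: "tight_path X q a b" and le: "wd x a + t * dist a b \<le> \<theta>"
  shows "c x a + development c q = c x b" "wd x b \<le> wd x a + t * dist a b"
proof -
  have q': "path_in X q a b" "\<And>u. u \<in> {0..1} \<Longrightarrow> dist a (q u) \<le> dist a b"
    using q by (auto simp: tight_path_def)
  have ab: "a \<in> X" "b \<in> X"
    using path_in_mem[OF q'(1)] by auto
  have wd_le: "wd x z \<le> wd x a + t * dist a z" if "z \<in> X" for z
    using W.triangle[OF x ab(1) that] warped_metric_space(2)[OF t_pos ab(1) that] by simp
  show "wd x b \<le> wd x a + t * dist a b"
    by (rule wd_le[OF ab(2)])
  have wd_q: "wd x (q u) \<le> \<theta>" if "u \<in> {0..1}" for u
  proof -
    have "wd x (q u) \<le> wd x a + t * dist a (q u)"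
      by (rule wd_le[OF path_in_image_mem[OF q'(1) that]])
    also have "\<dots> \<le> wd x a + t * dist a b"
      using q'(2)[OF that] t_pos by simp
    finally show ?thesis using le by simp
  qed
  obtain \<eta> where \<eta>: "\<eta> > 0" "\<And>u v. u \<in> {0..1} \<Longrightarrow> v \<in> {0..1} \<Longrightarrow> \<bar>u - v\<bar> < \<eta> \<Longrightarrow> wd (q u) (q v) \<le> 1"
    using path_small[OF q'(1)] by blast
  have "develops c q (\<lambda>u. c x (q u))"
    unfolding develops_def
  proof (intro exI[of _ \<eta>] conjI ballI impI)
    fix u v :: real assume uv: "u \<in> {0..1}" "v \<in> {0..1}" "\<bar>u - v\<bar> < \<eta>"
    have "c x (q u) + c (q u) (q v) = c x (q v)"
      using \<eta>(2)[OF uv] \<theta> path_in_image_mem[OF q'(1)] uv x wd_q by (intro W.triangle_eq) auto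
    then show "- c x (q u) + c x (q v) = c (q u) (q v)"
      by (metis minus_add_cancel)
  qed (fact \<eta>(1))
  then have "development c q = - c x (q 0) + c x (q 1)"
    by (rule development_eqI)
  moreover have "q 0 = a" "q 1 = b"
    using q'(1) by (auto simp: path_in_def pathstart_def pathfinish_def)
  ultimately show "c x a + development c q = c x b"
    by simp
qed

text \<open>All points of the chain lie within \<theta> of its start, so its value telescopes to a
  single value of \<open>c\<close>.\<close>

lemma jumping_chain_value:
  assumes "jumping_chain X S t x r p w y" "r \<le> \<theta>"
  shows "development c p + word_value X jump w y = c x y" "wd x y \<le> r"
proof -
  have "development c p + word_value X jump w y = c x y \<and> wd x y \<le> r"
    using assms
  proof (induction rule: jumping_chain.induct)
    case (start q y)
    then have x: "x \<in> X"
      by (auto simp: tight_path_def dest: path_in_mem)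
    then show ?case
      using tight_path_value[OF x start(1)] start(2) by (simp add: W.refl)
  next
    case (step r p w y l q z)
    let ?w = "w @ [inv_letter l]" and ?y = "letter_act X l y"
    have t0: "0 \<le> t"
      using t_pos by simp
    note basic = jumping_chain_basic[OF step(1) t0]
    have q: "path_in X q ?y z"
      using step by (simp add: tight_path_def)
    have x: "x \<in> X"
      using path_in_mem[OF basic(2)] by simp
    have y: "y \<in> X" "?y \<in> X"
      using basic(4) letter_act_mem[OF step(2)] by auto
    have d: "0 \<le> t * dist ?y z"
      using t0 by simp
    have IH: "development c p + word_value X jump w y = c x y" "wd x y \<le> r"
      using step.IH step.prems d by auto
    have w: "word_in S ?w"
      using basic(1) step(2) by simp
    have yy: "wd y ?y \<le> 1"
      using warped_metric_space(3)[OF t_pos step(2) y(1)] W.commute by simp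
    have xy: "wd x ?y \<le> r + 1"
      using W.triangle[OF x y] yy IH(2) by simp
    have ly: "word_act X ?w ?y = word_act X w y" "word_value X jump ?w ?y = word_value X jump w y + c y ?y"
      using step(2) y(1) by (simp_all add: letter_act_inv_letter word_value_append)
    have p2: "path_in X (word_act X ?w \<circ> q) (word_act X w y) (word_act X ?w z)"
      using path_in_compose[OF q word_act_continuous[OF w] word_act_image[OF w]] ly(1) by simp
    have "development c (p +++ (word_act X ?w \<circ> q)) + word_value X jump ?w z =
        development c p + (development c (word_act X ?w \<circ> q) + word_value X jump ?w z)"
      by (simp only: join[OF basic(2) p2] add.assoc)
    \<comment> \<open>Naturality takes \<open>q\<close> out of the translation by the word, with the
      last jump placed before it.\<close>
    also have "\<dots> = (development c p + word_value X jump w y) + c y ?y + development c q"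
      by (simp only: natural_word[OF w q] ly(2) add.assoc)
    also have "\<dots> = c x ?y + development c q"
      using W.triangle_eq[OF x y] IH yy xy \<theta> step.prems d by simp
    also have "\<dots> = c x z"
      using tight_path_value(1)[OF x step(3)] xy step.prems by simp
    finally show ?case
      using tight_path_value(2)[OF x step(3)] xy step.prems by simp
  qed
  then show "development c p + word_value X jump w y = c x y" "wd x y \<le> r"
    by auto
qed

end

section \<open>From representations to cocycles\<close>

context jumping_rep
begin

text \<open>\<rho> is a Lebesgue number for a cover by balls in which loops at the centre contract.
  A small loop at z is conjugated to a loop at the centre by a tight path, which stays inside the
  ball.\<close>

lemma small_loops_trivial:
  obtains \<rho> where "\<rho> > 0" "\<And>z q. path_in X q z z \<Longrightarrow> path_image q \<subseteq> ball z \<rho> \<Longrightarrow> h q = 0"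
proof -
  have "\<exists>e>0. \<forall>p. path_in (ball x e \<inter> X) p x x \<longrightarrow> homotopic_paths X p (\<lambda>_. x)" if x: "x \<in> X" for x
  proof -
    obtain U where U: "openin (top_of_set X) U" "x \<in> U"
        "\<And>p. path_in U p x x \<Longrightarrow> homotopic_paths X p (\<lambda>_. x)"
      using semilocally_simply_connected x unfolding semilocally_simply_connected_def by blast
    obtain e where e: "e > 0" "ball x e \<inter> X \<subseteq> U"
      using U(1,2) openin_contains_ball by metis
    have "homotopic_paths X p (\<lambda>_. x)" if "path_in (ball x e \<inter> X) p x x" for p
      using that e(2) by (intro U(3)) (auto simp: path_in_def)
    with e(1) show ?thesis by blast
  qed
  then obtain e where e: "\<And>x. x \<in> X \<Longrightarrow> e x > 0"
    "\<And>x p. x \<in> X \<Longrightarrow> path_in (ball x (e x) \<inter> X) p x x \<Longrightarrow> homotopic_paths X p (\<lambda>_. x)"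
    by metis
  have cover: "X \<subseteq> \<Union>((\<lambda>x. ball x (e x)) ` X)"
    using e(1) by (auto intro!: bexI)
  obtain \<rho> where \<rho>: "\<rho> > 0" "\<And>z. z \<in> X \<Longrightarrow> \<exists>G\<in>(\<lambda>x. ball x (e x)) ` X. ball z \<rho> \<subseteq> G"
    by (rule Heine_Borel_lemma[OF compact cover]) (auto intro: that)
  have "h q = 0" if q: "path_in X q z z" and qb: "path_image q \<subseteq> ball z \<rho>" for z q
  proof -
    have z: "z \<in> X"
      using path_in_mem[OF q] by simp
    obtain x where x: "x \<in> X" "ball z \<rho> \<subseteq> ball x (e x)"
      using \<rho>(2)[OF z] by blast
    obtain a where a: "tight_path X a x z"
      using tight_path_exists[OF x(1) z] by blast
    then have a': "path_in X a x z" "\<And>u. u \<in> {0..1} \<Longrightarrow> dist x (a u) \<le> dist x z"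
      by (auto simp: tight_path_def)
    have "dist x z < e x"
      using x(2) \<rho>(1) by (auto simp: subset_eq)
    then have "path_image a \<subseteq> ball x (e x)"
      using a'(2) by (fastforce simp: path_image_def)
    then have "path_in (ball x (e x) \<inter> X) a x z"
      using a'(1) by (auto simp: path_in_def)
    moreover have "path_in (ball x (e x) \<inter> X) q z z"
      using q qb x(2) by (auto simp: path_in_def)
    ultimately have "path_in (ball x (e x) \<inter> X) (a +++ q +++ reversepath a) x x"
      by (intro path_in_join path_in_reversepath)
    then have "h (a +++ q +++ reversepath a) = h (\<lambda>_. x)"
      using e(2)[OF x(1)] homotopic by blast
    then have "h a + h q - h a = 0"
      using join[OF a'(1) path_in_join[OF q path_in_reversepath[OF a'(1)]]]
        join[OF q path_in_reversepath[OF a'(1)]] reverse[OF a'(1)] const[OF x(1)]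
      by (simp add: group_normalize del: add_uminus_conv_diff)
    then show ?thesis
      by (metis add_cancel_left_right eq_iff_diff_eq_0 eq_add_self_iff)
  qed
  with \<rho>(1) show ?thesis
    by (rule that)
qed

text \<open>This notion does not mention t; for large t every chain of length at most
  \<open>n\<close> satisfies it.\<close>

definition short :: "real \<Rightarrow> nat \<Rightarrow> 'a \<Rightarrow> (real \<Rightarrow> 'a) \<Rightarrow> ('a \<Rightarrow> 'a) letter list \<Rightarrow> 'a \<Rightarrow> bool"
  where "short \<epsilon> n x p w y \<longleftrightarrow> word_in S w \<and> length w \<le> n \<and> y \<in> X \<and>
    path_in X p x (word_act X w y) \<and> path_image p \<subseteq> ball x \<epsilon>"

abbreviation val :: "(real \<Rightarrow> 'a) \<Rightarrow> ('a \<Rightarrow> 'a) letter list \<Rightarrow> 'a \<Rightarrow> 'v"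
  where "val p w y \<equiv> h p + word_value X C w y"

text \<open>The second path is translated by \<open>v\<close> before it is appended, so its size
  after translation, \<open>d\<close>, enters the bound in place of \<open>b\<close>.\<close>

lemma short_compose:
  assumes p: "short a m x p v y" and q: "short b k y q w z"
    and eq: "\<And>u. u \<in> X \<Longrightarrow> dist y u < b \<Longrightarrow> dist (word_act X v y) (word_act X v u) < d"
  shows "short (a + d) (m + k) x (p +++ (word_act X v \<circ> q)) (v @ w) z"
    and "val (p +++ (word_act X v \<circ> q)) (v @ w) z = val p v y + val q w z"
proof -
  have p': "word_in S v" "length v \<le> m" "y \<in> X" "path_in X p x (word_act X v y)" "path_image p \<subseteq> ball x a"
    and q': "word_in S w" "length w \<le> k" "z \<in> X" "path_in X q y (word_act X w z)" "path_image q \<subseteq> ball y b"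
    using p q by (auto simp: short_def)
  have vq: "path_in X (word_act X v \<circ> q) (word_act X v y) (word_act X v (word_act X w z))"
    by (rule path_in_compose[OF q'(4) word_act_continuous[OF p'(1)] word_act_image[OF p'(1)]])
  have "h (word_act X v \<circ> q) + word_value X C v (word_act X w z) = word_value X C v y + h q"
    by (rule natural_word[OF p'(1) q'(4)])
  then have "h (word_act X v \<circ> q) + (word_value X C v (word_act X w z) + word_value X C w z)
      = word_value X C v y + (h q + word_value X C w z)"
    by (simp only: add.assoc[symmetric])
  then show "val (p +++ (word_act X v \<circ> q)) (v @ w) z = val p v y + val q w z"
    by (simp only: join[OF p'(4) vq] word_value_append add.assoc)
  have xa: "dist x (word_act X v y) < a"
  proof -
    have "word_act X v y \<in> path_image p"
      using p'(4) by (metis path_in_def pathfinish_in_path_image)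
    then show ?thesis using p'(5) by auto
  qed
  have d: "d > 0"
    using eq[OF p'(3)] q'(5) q'(4) by (metis (no_types, lifting) dist_self less_le_trans mem_ball not_le
      order.strict_trans1 path_in_def pathstart_in_path_image subsetD zero_le_dist)
  have "dist x ((p +++ (word_act X v \<circ> q)) u) < a + d" if "u \<in> {0..1}" for u
    using that
  proof (rule joinpaths_mem)
    fix s :: real assume s: "s \<in> {0..1}"
    have "p s \<in> path_image p"
      using s by (auto simp: path_image_def)
    then have "dist x (p s) < a"
      using p'(5) by auto
    with d show "dist x (p s) < a + d"
      by simp
    have "q s \<in> path_image q"
      using s by (auto simp: path_image_def)
    then have "dist y (q s) < b" "q s \<in> X"
      using q'(4,5) by (auto simp: path_in_def)
    then have "dist (word_act X v y) (word_act X v (q s)) < d"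
      using eq by blast
    then show "dist x ((word_act X v \<circ> q) s) < a + d"
      using xa dist_triangle[of x "word_act X v (q s)" "word_act X v y"] by simp
  qed
  then have "path_image (p +++ (word_act X v \<circ> q)) \<subseteq> ball x (a + d)"
    by (auto simp: path_image_def)
  then show "short (a + d) (m + k) x (p +++ (word_act X v \<circ> q)) (v @ w) z"
    using p' q' path_in_join[OF p'(4) vq] by (simp add: short_def)
qed

text \<open>Let z be a fixed point near the composite and \<open>a\<close> a short path from z to
  its base point. Then \<open>a\<close>, the path of the composite and the reversed image of
  \<open>a\<close> form a small loop at z, of value 0. So the value of the composite is conjugate to
  that of the pure jump at z, which vanishes by hypothesis.\<close>

lemma short_quad:
  assumes kills: "\<And>w z. word_in S w \<Longrightarrow> reduced w \<Longrightarrow> length w \<le> 4 * n \<Longrightarrow> z \<in> Fix X w \<Longrightarrow>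
    word_value X C w z = 0"
  obtains \<epsilon> where "\<epsilon> > 0"
    "\<And>x y z u p1 p2 p3 p4 w1 w2 w3 w4. short \<epsilon> n x p1 w1 y \<Longrightarrow> short \<epsilon> n y p2 w2 z \<Longrightarrow>
      short \<epsilon> n z p3 w3 u \<Longrightarrow> short \<epsilon> n u p4 w4 x \<Longrightarrow>
      val p1 w1 y + val p2 w2 z + val p3 w3 u + val p4 w4 x = 0"
proof -
  obtain \<rho> where \<rho>: "\<rho> > 0" "\<And>z q. path_in X q z z \<Longrightarrow> path_image q \<subseteq> ball z \<rho> \<Longrightarrow> h q = 0"
    using small_loops_trivial by blast
  obtain \<delta>1 where \<delta>1: "\<delta>1 > 0" "\<And>w x y. word_in S w \<Longrightarrow> length w \<le> 4 * n \<Longrightarrow> x \<in> X \<Longrightarrow> y \<in> X \<Longrightarrow>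
      dist x y < \<delta>1 \<Longrightarrow> dist (word_act X w x) (word_act X w y) < \<rho>"
    using words_equicontinuous[OF \<rho>(1), of "4 * n"] by metis
  \<comment> \<open>\<delta>1 controls the image under the word of a path from the fixed point; half
    of \<rho> leaves room for the path of the morphism.\<close>
  define \<delta>2 where "\<delta>2 = min \<delta>1 (\<rho> / 2)"
  have \<delta>2: "\<delta>2 > 0"
    using \<delta>1(1) \<rho>(1) by (simp add: \<delta>2_def)
  obtain \<delta>3 where \<delta>3: "\<delta>3 > 0" "\<And>w x. word_in S w \<Longrightarrow> length w \<le> 4 * n \<Longrightarrow> x \<in> X \<Longrightarrow>
      dist x (word_act X w x) < \<delta>3 \<Longrightarrow> \<exists>z\<in>Fix X w. dist x z < \<delta>2"
    using near_Fix[OF \<delta>2, of "4 * n"] by metis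
  \<comment> \<open>Divided by 4, since a composite of four morphisms will have size 4 e.\<close>
  define e where "e = min \<delta>3 (\<rho> / 2) / 4"
  have e: "e > 0" "4 * e \<le> \<delta>3" "4 * e \<le> \<rho> / 2"
    using \<delta>3(1) \<rho>(1) by (simp_all add: e_def)
  obtain \<delta>4 where \<delta>4: "\<delta>4 > 0" "\<And>w x y. word_in S w \<Longrightarrow> length w \<le> 4 * n \<Longrightarrow> x \<in> X \<Longrightarrow> y \<in> X \<Longrightarrow>
      dist x y < \<delta>4 \<Longrightarrow> dist (word_act X w x) (word_act X w y) < e"
    using words_equicontinuous[OF e(1), of "4 * n"] by metis
  have loop: "val p w x = 0" if p: "short (4 * e) (4 * n) x p w x" for x p w
  proof -
    have w: "word_in S w" "length w \<le> 4 * n" and x: "x \<in> X"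
      and p': "path_in X p x (word_act X w x)" "path_image p \<subseteq> ball x (4 * e)"
      using p by (auto simp: short_def)
    \<comment> \<open>The hypothesis speaks of reduced words; free reduction keeps the action and
      the value and does not lengthen the word.\<close>
    define v where "v = foldr cancel_Cons w []"
    have v: "word_in S v" "reduced v" "length v \<le> 4 * n"
      using w length_foldr_cancel_Cons[of w "[]"]
      by (auto simp: v_def word_in_foldr_cancel_Cons reduced_foldr_cancel_Cons)
    have act: "word_act X v u = word_act X w u" "word_value X C v u = word_value X C w u" if "u \<in> X" for u
      using word_act_foldr_cancel_Cons[of w "[]" u] word_value_foldr_cancel_Cons[of w "[]" u] w that
      by (auto simp: v_def)
    have "word_act X w x \<in> path_image p"
      using p'(1) by (metis path_in_def pathfinish_in_path_image)
    then have "dist x (word_act X v x) < \<delta>3"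
      using p'(2) e(2) act(1)[OF x] by (auto simp: subset_eq)
    then obtain z where z: "z \<in> Fix X v" "dist x z < \<delta>2"
      using \<delta>3(2)[OF v(1,3) x] by blast
    then have zX: "z \<in> X" "word_act X w z = z"
      using act(1)[of z] by (auto simp: Fix_def)
    obtain a where "tight_path X a z x"
      using tight_path_exists[OF zX(1) x] by blast
    then have a: "path_in X a z x" "\<And>u. u \<in> {0..1} \<Longrightarrow> dist z (a u) \<le> dist z x"
      by (auto simp: tight_path_def)
    have wa: "path_in X (word_act X w \<circ> a) z (word_act X w x)"
      using path_in_compose[OF a(1) word_act_continuous[OF w(1)] word_act_image[OF w(1)]] zX(2) by simp
    define q where "q = a +++ p +++ reversepath (word_act X w \<circ> a)"
    have q: "path_in X q z z"
      unfolding q_def by (intro path_in_join[OF a(1)] path_in_join[OF p'(1)] path_in_reversepath[OF wa])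
    have zx: "dist z x < \<delta>2"
      using z(2) by (simp add: dist_commute)
    have "path_image a \<subseteq> ball z \<rho>"
      using a(2) zx \<rho>(1) by (fastforce simp: path_image_def \<delta>2_def)
    moreover have "path_image p \<subseteq> ball z \<rho>"
    proof
      fix s assume "s \<in> path_image p"
      then have "dist x s < 4 * e"
        using p'(2) by auto
      then show "s \<in> ball z \<rho>"
        using zx e(3) dist_triangle[of z s x] by (simp add: \<delta>2_def)
    qed
    moreover have "path_image (word_act X w \<circ> a) \<subseteq> ball z \<rho>"
    proof -
      have "dist z (word_act X w (a u)) < \<rho>" if u: "u \<in> {0..1}" for u
      proof -
        have "dist z (a u) < \<delta>1"
          using a(2)[OF u] zx by (simp add: \<delta>2_def)
        then have "dist (word_act X w z) (word_act X w (a u)) < \<rho>"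
          using path_in_image_mem[OF a(1) u] by (intro \<delta>1(2) w zX(1))
        then show ?thesis
          by (simp add: zX(2))
      qed
      then show ?thesis
        by (auto simp: path_image_def)
    qed
    ultimately have "path_image q \<subseteq> ball z \<rho>"
      unfolding q_def by (intro order.trans[OF path_image_join_subset] Un_least) auto
    then have "h q = 0"
      by (rule \<rho>(2)[OF q])
    then have "h a + h p - h (word_act X w \<circ> a) = 0"
      using join[OF a(1) path_in_join[OF p'(1) path_in_reversepath[OF wa]]]
        join[OF p'(1) path_in_reversepath[OF wa]] reverse[OF wa]
      by (simp add: q_def group_normalize del: add_uminus_conv_diff)
    then have "h (word_act X w \<circ> a) = h a + h p"
      by simp
    moreover have "word_value X C w z = 0"
      using kills[OF v z(1)] act(2)[OF zX(1)] by simp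
    ultimately have "h a + (h p + word_value X C w x) = h a"
      using natural_word[OF w(1) a(1)] by (simp add: add.assoc)
    then show ?thesis
      by (metis eq_add_self_iff)
  qed
  \<comment> \<open>\<delta>4 keeps every translate of an \<epsilon>-small path below e.\<close>
  define \<epsilon> where "\<epsilon> = min e \<delta>4"
  have \<epsilon>: "\<epsilon> > 0" "\<epsilon> \<le> e" "\<epsilon> \<le> \<delta>4"
    using e(1) \<delta>4(1) by (auto simp: \<epsilon>_def)
  have eq: "dist (word_act X v y) (word_act X v u) < e"
    if "short a m x p v y" "m \<le> 4 * n" "u \<in> X" "dist y u < \<epsilon>" for a m x p v y u
    using that \<epsilon> by (intro \<delta>4(2)) (auto simp: short_def)
  show ?thesis
  proof (rule that[OF \<epsilon>(1)])
    fix x y z u p1 p2 p3 p4 w1 w2 w3 w4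
    assume 1: "short \<epsilon> n x p1 w1 y" and 2: "short \<epsilon> n y p2 w2 z"
      and 3: "short \<epsilon> n z p3 w3 u" and 4: "short \<epsilon> n u p4 w4 x"
    have m: "n \<le> 4 * n" "n + n \<le> 4 * n" "n + n + n \<le> 4 * n"
      by auto
    note c2 = short_compose[OF 1 2 eq[OF 1 m(1)]]
    note c3 = short_compose[OF c2(1) 3 eq[OF c2(1) m(2)]]
    note c4 = short_compose[OF c3(1) 4 eq[OF c3(1) m(3)]]
    define P W where "P = ((p1 +++ (word_act X w1 \<circ> p2)) +++ (word_act X (w1 @ w2) \<circ> p3)) +++
        (word_act X ((w1 @ w2) @ w3) \<circ> p4)" "W = ((w1 @ w2) @ w3) @ w4"
    have s: "short (\<epsilon> + e + e + e) (n + n + n + n) x P W x"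
      unfolding P_W_def by (rule c4(1))
    have "val P W x = val p1 w1 y + val p2 w2 z + val p3 w3 u + val p4 w4 x"
      unfolding P_W_def
      by (rule trans[OF c4(2) arg_cong2[of _ _ _ _ "(+)", OF trans[OF c3(2)
            arg_cong2[of _ _ _ _ "(+)", OF c2(2) refl]] refl]])
    moreover have "short (4 * e) (4 * n) x P W x"
      using s \<epsilon>(2) by (auto simp: short_def subset_eq)
    ultimately show "val p1 w1 y + val p2 w2 z + val p3 w3 u + val p4 w4 x = 0"
      using loop by simp
  qed
qed

text \<open>The last clause records that each value is attained on a chain no longer than the
  distance. This allows evaluation at smaller scales and shows that the values lie in the
  image.\<close>

definition realized_by :: "real \<Rightarrow> nat \<Rightarrow> ('a \<Rightarrow> 'a \<Rightarrow> 'v) \<Rightarrow> bool"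
  where "realized_by t n \<tau> \<longleftrightarrow> warped_cocycle X S x0 \<alpha> t (real n) \<tau> \<and>
    (\<forall>l x. fst l \<in> S \<longrightarrow> x \<in> X \<longrightarrow> \<tau> (letter_act X l x) x = C l x) \<and>
    (\<forall>p x y. path_in X p x y \<longrightarrow> development \<tau> p = h p) \<and>
    (\<forall>x\<in>X. \<forall>y\<in>X. warped_dist X S t x y \<le> real n \<longrightarrow>
      (\<exists>r p w. r \<le> warped_dist X S t x y \<and> jumping_chain X S t x r p w y \<and> \<tau> x y = h p + word_value X C w y))"

lemma cocycle_exists:
  assumes n: "n \<ge> 1" and kills: "\<And>w z. word_in S w \<Longrightarrow> reduced w \<Longrightarrow> length w \<le> 4 * n \<Longrightarrow> z \<in> Fix X w \<Longrightarrow>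
    word_value X C w z = 0"
  obtains t0 where "\<And>t. t \<ge> t0 \<Longrightarrow> \<exists>\<tau>. realized_by t n \<tau>"
proof -
  obtain \<epsilon> where \<epsilon>: "\<epsilon> > 0" and quad: "\<And>x y z u p1 p2 p3 p4 w1 w2 w3 w4. short \<epsilon> n x p1 w1 y \<Longrightarrow>
      short \<epsilon> n y p2 w2 z \<Longrightarrow> short \<epsilon> n z p3 w3 u \<Longrightarrow> short \<epsilon> n u p4 w4 x \<Longrightarrow>
      val p1 w1 y + val p2 w2 z + val p3 w3 u + val p4 w4 x = 0"
    using short_quad[OF kills] by blast
  obtain t1 where t1: "t1 \<ge> 1" "\<And>t x r p w y. t \<ge> t1 \<Longrightarrow> jumping_chain X S t x r p w y \<Longrightarrow> r \<le> real n \<Longrightarrow>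
      path_image p \<subseteq> ball x \<epsilon>"
    using jumping_chain_small[OF \<epsilon>, of n] by blast
  obtain t2 where t2: "\<And>t. t \<ge> t2 \<Longrightarrow> jumping_geodesic X S t"
    using jumping_geodesic unfolding eventually_at_top_linorder by blast
  have "\<exists>\<tau>. realized_by t n \<tau>"
    if tt: "t \<ge> max t1 t2" for t
  proof -
    have t: "t \<ge> 1" "t \<ge> t1" "t > 0" "0 \<le> t"
      using tt t1(1) by auto
    note geod = t2[of t]
    let ?wd = "warped_dist X S t"
    interpret W: Metric_space X ?wd
      by (rule warped_metric_space(1)[OF t(3)])
    have chain: "\<exists>r p w. r \<le> ?wd x y \<and> jumping_chain X S t x r p w y \<and> short \<epsilon> n x p w y"
      if xy: "x \<in> X" "y \<in> X" "?wd x y \<le> real n" for x y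
    proof -
      obtain r p w where r: "r \<le> ?wd x y" "jumping_chain X S t x r p w y"
        using jumping_chain_exists[OF t(1) geod xy(1,2)] tt by auto
      moreover have "short \<epsilon> n x p w y"
        using jumping_chain_basic[OF r(2) t(4)] t1(2)[OF t(2) r(2)] r(1) xy(3) by (simp add: short_def)
      ultimately show ?thesis by blast
    qed
    define \<tau> where "\<tau> x y = (SOME g. \<exists>p w. short \<epsilon> n x p w y \<and> g = val p w y)" for x y
    have triv: "short \<epsilon> n x (\<lambda>_. x) [] x" "val (\<lambda>_. x) [] x = 0" if "x \<in> X" for x
      using that \<epsilon> const by (auto simp: short_def path_in_const path_image_def)
    have \<tau>: "\<tau> x y = val p w y" if p: "short \<epsilon> n x p w y" and x: "x \<in> X" and d: "?wd x y \<le> real n" for x y p w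
    proof -
      have y: "y \<in> X" using p by (simp add: short_def)
      have "?wd y x \<le> real n"
        using d W.commute by simp
      then obtain q v where q: "short \<epsilon> n y q v x"
        using chain[OF y x] by blast
      \<comment> \<open>Two short morphisms with the same ends are compared by closing both with the
        same short return; the other two sides of each quadrilateral are constant.\<close>
      have "val p' w' y = val p w y" if "short \<epsilon> n x p' w' y" for p' w'
      proof -
        have "val p w y + val q v x = val p' w' y + val q v x"
          using quad[OF p q triv(1)[OF x] triv(1)[OF x]] quad[OF that q triv(1)[OF x] triv(1)[OF x]]
          by (simp only: triv(2)[OF x] add.right_neutral)
        then show ?thesis
          by (simp only: add_right_cancel)
      qed
      then show ?thesis
        unfolding \<tau>_def by (intro some_equality exI[of _ p] exI[of _ w] conjI p refl) (elim exE conjE, simp)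
    qed
    have "cocycle X ?wd (real n) \<tau>"
      unfolding cocycle_def
    proof (intro conjI ballI impI)
      fix x assume "x \<in> X"
      then show "\<tau> x x = 0"
        using \<tau>[OF triv(1)] triv(2) by simp
    next
      fix x y z u assume *: "x \<in> X" "y \<in> X" "z \<in> X" "u \<in> X"
        "?wd x y \<le> real n" "?wd y z \<le> real n" "?wd z u \<le> real n" "?wd u x \<le> real n"
      obtain p1 w1 where 1: "short \<epsilon> n x p1 w1 y" using chain * by blast
      obtain p2 w2 where 2: "short \<epsilon> n y p2 w2 z" using chain * by blast
      obtain p3 w3 where 3: "short \<epsilon> n z p3 w3 u" using chain * by blast
      obtain p4 w4 where 4: "short \<epsilon> n u p4 w4 x" using chain * by blast
      show "\<tau> x y + \<tau> y z + \<tau> z u + \<tau> u x = 0"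
        using quad[OF 1 2 3 4] \<tau>[OF 1] \<tau>[OF 2] \<tau>[OF 3] \<tau>[OF 4] * by simp
    qed
    then have cocycle: "warped_cocycle X S x0 \<alpha> t (real n) \<tau>"
      by unfold_locales (use t n in auto)
    interpret T: warped_cocycle X S x0 \<alpha> t "real n" \<tau>
      by (rule cocycle)
    show ?thesis
      unfolding realized_by_def
    proof (intro exI[of _ \<tau>] conjI allI ballI impI)
      fix l :: "('a \<Rightarrow> 'a) letter" and x assume l: "fst l \<in> S" and x: "x \<in> X"
      \<comment> \<open>A single jump is a short morphism because n \<ge> 1.\<close>
      have "short \<epsilon> n (letter_act X l x) (\<lambda>_. letter_act X l x) [l] x"
        using l x n \<epsilon> letter_act_mem[OF l x] by (auto simp: short_def path_in_const path_image_def)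
      then show "\<tau> (letter_act X l x) x = C l x"
        using \<tau>[OF _ letter_act_mem[OF l x] T.wd_letter[OF l x]] const[OF letter_act_mem[OF l x]] by simp
    next
      fix p x y assume p: "path_in X p x y"
      then have p': "path p" "path_image p \<subseteq> X" "p 0 = x" "p 1 = y"
        by (auto simp: path_in_def pathstart_def pathfinish_def)
      have seg: "path_in X (p \<circ> linepath u v) (p u) (p v)" if "u \<in> {0..1}" "v \<in> {0..1}" for u v
      proof -
        have "path_in {0..1} (linepath u v) u v"
          using that closed_segment_subset[of u "{0..1}" v] by (auto simp: path_in_def)
        then show ?thesis
          using p' by (intro path_in_compose) (auto simp: path_def path_image_def)
      qed
      have "uniformly_continuous_on {0..1} p"
        using p'(1) by (intro compact_uniformly_continuous) (auto simp: path_def)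
      then obtain \<eta>1 where \<eta>1: "\<eta>1 > 0" "\<And>u v. u \<in> {0..1} \<Longrightarrow> v \<in> {0..1} \<Longrightarrow> dist v u < \<eta>1 \<Longrightarrow> dist (p v) (p u) < \<epsilon>"
        using \<epsilon> unfolding uniformly_continuous_on_def by metis
      obtain \<eta>2 where \<eta>2: "\<eta>2 > 0" "\<And>u v. u \<in> {0..1} \<Longrightarrow> v \<in> {0..1} \<Longrightarrow> \<bar>u - v\<bar> < \<eta>2 \<Longrightarrow> ?wd (p u) (p v) \<le> 1"
        using T.path_small[OF p] by blast
      \<comment> \<open>For nearby parameters the segment between them is a short morphism with the
        empty word, so \<open>h\<close> of the initial part of \<open>p\<close> is a
        primitive.\<close>
      have "develops \<tau> p (\<lambda>u. h (p \<circ> linepath 0 u))"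
        unfolding develops_def
      proof (intro exI[of _ "min \<eta>1 \<eta>2"] conjI ballI impI)
        fix u v :: real assume uv: "u \<in> {0..1}" "v \<in> {0..1}" "\<bar>u - v\<bar> < min \<eta>1 \<eta>2"
        have "path_image (p \<circ> linepath u v) \<subseteq> ball (p u) \<epsilon>"
        proof -
          have "dist (p u) (p s) < \<epsilon>" if "s \<in> closed_segment u v" for s
          proof -
            have "s \<in> {0..1}" "\<bar>u - s\<bar> \<le> \<bar>u - v\<bar>"
              using that uv(1,2) by (auto simp: closed_segment_eq_real_ivl split: if_splits)
            then show ?thesis
              using \<eta>1(2)[of s u] uv by (simp add: dist_real_def)
          qed
          then show ?thesis
            by (auto simp: path_image_compose)
        qed
        then have "short \<epsilon> n (p u) (p \<circ> linepath u v) [] (p v)"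
          using seg[OF uv(1,2)] path_in_image_mem[OF p uv(2)] by (simp add: short_def)
        moreover have "?wd (p u) (p v) \<le> real n"
          using \<eta>2(2)[of u v] uv n by simp
        ultimately have "\<tau> (p u) (p v) = h (p \<circ> linepath u v)"
          using \<tau>[OF _ path_in_image_mem[OF p uv(1)]] by fastforce
        moreover have "h (p \<circ> linepath 0 v) = h (p \<circ> linepath 0 u) + h (p \<circ> linepath u v)"
        proof -
          have "homotopic_paths X (p \<circ> (linepath 0 u +++ linepath u v)) (p \<circ> linepath 0 v)"
            using uv(1,2) closed_segment_subset[of u "{0..1}" v] closed_segment_subset[of 0 "{0..1}" u]
              closed_segment_subset[of 0 "{0..1}" v]
            by (intro homotopic_paths_interval p') (auto simp: path_image_join)
          then have "h (p \<circ> linepath 0 v) = h ((p \<circ> linepath 0 u) +++ (p \<circ> linepath u v))"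
            using homotopic path_compose_join by metis
          then show ?thesis
            using join[OF seg[of 0 u] seg[of u v]] uv by simp
        qed
        ultimately show "- h (p \<circ> linepath 0 u) + h (p \<circ> linepath 0 v) = \<tau> (p u) (p v)"
          by simp
      qed (use \<eta>1 \<eta>2 in auto)
      then have "development \<tau> p = - h (p \<circ> linepath 0 0) + h (p \<circ> linepath 0 1)"
        by (rule development_eqI)
      moreover have "p \<circ> linepath 0 0 = (\<lambda>_. x)" "p \<circ> linepath 0 1 = p"
        using p' by (auto simp: linepath_def)
      ultimately show "development \<tau> p = h p"
        using const path_in_mem[OF p] by simp
    next
      fix x y assume xy: "x \<in> X" "y \<in> X" "?wd x y \<le> real n"
      then obtain r p w where "r \<le> ?wd x y" "jumping_chain X S t x r p w y" "short \<epsilon> n x p w y"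
        using chain by blast
      then show "\<exists>r p w. r \<le> ?wd x y \<and> jumping_chain X S t x r p w y \<and> \<tau> x y = h p + word_value X C w y"
        using \<tau> xy by blast
    qed (fact cocycle)
  qed
  then show ?thesis
    by (rule that)
qed

end

section \<open>Composites of induced homomorphisms\<close>

text \<open>At integer scales n \<ge> 1 the additive constant is absorbed into the factor: scale n
  goes to scale \<open>K * n\<close>.\<close>

definition controlled_inverses ::
  "nat \<Rightarrow> 'a set \<Rightarrow> ('a \<Rightarrow> 'a \<Rightarrow> real) \<Rightarrow> 'b set \<Rightarrow> ('b \<Rightarrow> 'b \<Rightarrow> real) \<Rightarrow> ('a \<Rightarrow> 'b) \<Rightarrow> ('b \<Rightarrow> 'a) \<Rightarrow> bool"
where
  "controlled_inverses K X d Y e f f' \<longleftrightarrow> (\<forall>x\<in>X. f x \<in> Y) \<and> (\<forall>y\<in>Y. f' y \<in> X) \<and>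
    (\<forall>x\<in>X. \<forall>x'\<in>X. \<forall>n\<ge>1. d x x' \<le> real n \<longrightarrow> e (f x) (f x') \<le> real (K * n)) \<and>
    (\<forall>y\<in>Y. \<forall>y'\<in>Y. \<forall>n\<ge>1. e y y' \<le> real n \<longrightarrow> d (f' y) (f' y') \<le> real (K * n)) \<and>
    (\<forall>y\<in>Y. e (f (f' y)) y \<le> real K) \<and> (\<forall>x\<in>X. d (f' (f x)) x \<le> real K)"

lemma controlled_inversesD:
  assumes "controlled_inverses K X d Y e f f'"
  shows "x \<in> X \<Longrightarrow> f x \<in> Y" and "y \<in> Y \<Longrightarrow> f' y \<in> X"
    and "x \<in> X \<Longrightarrow> x' \<in> X \<Longrightarrow> 1 \<le> n \<Longrightarrow> d x x' \<le> real n \<Longrightarrow> e (f x) (f x') \<le> real (K * n)"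
    and "y \<in> Y \<Longrightarrow> y' \<in> Y \<Longrightarrow> 1 \<le> n \<Longrightarrow> e y y' \<le> real n \<Longrightarrow> d (f' y) (f' y') \<le> real (K * n)"
    and "y \<in> Y \<Longrightarrow> e (f (f' y)) y \<le> real K"
  using assms unfolding controlled_inverses_def by blast+

lemma controlled_inverses_sym:
  "controlled_inverses K X d Y e f f' \<Longrightarrow> controlled_inverses K Y e X d f' f"
  unfolding controlled_inverses_def by blast

text \<open>A cocycle tests only distances, so \<open>f\<close> may be discontinuous: small
  quadrilaterals may become large as long as their sides stay within \<theta>'.\<close>

lemma warped_cocycle_pullback:
  assumes X: "based_warped_system X S x0 \<alpha>" and \<tau>: "warped_cocycle Y T y0 \<beta> s \<theta>' \<tau>"
    and f: "\<And>x. x \<in> X \<Longrightarrow> f x \<in> Y"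
    and le: "\<And>x x'. x \<in> X \<Longrightarrow> x' \<in> X \<Longrightarrow> warped_dist X S t x x' \<le> \<theta> \<Longrightarrow>
      warped_dist Y T s (f x) (f x') \<le> \<theta>'"
    and t: "1 \<le> t" "1 \<le> \<theta>"
  shows "warped_cocycle X S x0 \<alpha> t \<theta> (\<lambda>x x'. \<tau> (f x) (f x'))"
proof -
  interpret X: based_warped_system X S x0 \<alpha> by fact
  interpret \<tau>: warped_cocycle Y T y0 \<beta> s \<theta>' \<tau> by fact
  have "cocycle X (warped_dist X S t) \<theta> (\<lambda>x x'. \<tau> (f x) (f x'))"
    unfolding cocycle_def by (intro conjI ballI impI \<tau>.W.refl \<tau>.W.quad f le) auto
  then show ?thesis
    using t by unfold_locales
qed

abbreviation taut_realized ::
  "'a::metric_space set \<Rightarrow> ('a \<Rightarrow> 'a) set \<Rightarrow> 'a \<Rightarrow> (('a \<Rightarrow> 'a) \<Rightarrow> real \<Rightarrow> 'a) \<Rightarrow>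
    ((real \<Rightarrow> 'a) set \<times> ('a \<Rightarrow> 'a) letter list \<Rightarrow> 'v::group_add) \<Rightarrow> real \<Rightarrow> nat \<Rightarrow> ('a \<Rightarrow> 'a \<Rightarrow> 'v) \<Rightarrow> bool"
  where "taut_realized X S x0 \<alpha> \<pi> \<equiv> jumping_rep.realized_by X S x0 \<alpha>
    (jumping_group_hom.taut_path X x0 \<pi>) (jumping_group_hom.taut_jump X x0 \<alpha> \<pi>)"

abbreviation induced_map ::
  "'a::metric_space set \<Rightarrow> 'a \<Rightarrow> (('a \<Rightarrow> 'a) \<Rightarrow> real \<Rightarrow> 'a) \<Rightarrow> ('a \<Rightarrow> 'a \<Rightarrow> 'v::group_add) \<Rightarrow>
    (real \<Rightarrow> 'a) set \<times> ('a \<Rightarrow> 'a) letter list \<Rightarrow> 'v"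
  where "induced_map X x0 \<alpha> c \<equiv> jumping_rep.total X x0 \<alpha> (development c) (\<lambda>l x. c (letter_act X l x) x)"

text \<open>The element of \<open>K_set\<close> is taken with the path \<open>base z\<close>, on
  which \<open>taut_path\<close> vanishes, so the conjugate in \<open>total_K_element\<close> is the
  jump itself.\<close>

lemma (in jumping_group_hom) taut_word_value_Fix:
  assumes kill: "\<And>g. g \<in> kill n \<Longrightarrow> \<pi> g = 0"
    and w: "word_in S w" "reduced w" "length w \<le> 4 * n" and z: "z \<in> Fix X w"
  shows "word_value X taut_jump w z = 0"
proof -
  have "z \<in> X"
    using z by (simp add: Fix_def)
  note b = base[OF this]
  let ?k = "(path_class X (base z +++ (word_act X w \<circ> reversepath (base z)) +++
    reversepath (word_path X x0 \<alpha> w)), w)"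
  have "?k \<in> K_set X S x0 \<alpha> n"
    unfolding K_set_def using w z b by (auto simp: carrier_free_group)
  then have k: "?k \<in> kill n" "?k \<in> carrier \<Gamma>"
    using subset_normal_closure[of "K_set X S x0 \<alpha> n" \<Gamma>] K_set_subset[of n] by auto
  have "taut_path (base z) + word_value X taut_jump w z - taut_path (base z) = 0"
    using taut.total_K_element[OF w(1) z b] total_taut[OF k(2)] kill[OF k(1)] by simp
  then show ?thesis
    by (simp add: taut_path_base[OF \<open>z \<in> X\<close>])
qed

text \<open>\<tau>X lives at scale a1 and \<tau>Y at b0; their pullbacks live on Y at b1 and on X at
  a0. A step of size 1 in Y becomes one of size K in X, hence K \<le> a0; then b0 is at least K as
  well and covers the distance from f (f' y) to y. Squares with such sides make the composite
  homomorphism on the group of Y a conjugate of \<pi>Y.\<close>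

lemma composition_conjugate:
  fixes \<pi>X :: "(real \<Rightarrow> 'a::metric_space) set \<times> ('a \<Rightarrow> 'a) letter list \<Rightarrow> 'u::group_add"
    and \<pi>Y :: "(real \<Rightarrow> 'b::metric_space) set \<times> ('b \<Rightarrow> 'b) letter list \<Rightarrow> 'v::group_add"
  assumes homX: "jumping_group_hom X S x0 \<alpha> \<pi>X" and homY: "jumping_group_hom Y T y0 \<beta> \<pi>Y"
    and \<tau>X: "taut_realized X S x0 \<alpha> \<pi>X t a1 \<tau>X"
    and \<tau>Y: "taut_realized Y T y0 \<beta> \<pi>Y s b0 \<tau>Y"
    and ctrl: "controlled_inverses K X (warped_dist X S t) Y (warped_dist Y T s) f f'"
    and scales: "1 \<le> a0" "a0 \<le> a1" "K \<le> a0" "K * a0 \<le> b0" "1 \<le> b1" "K * b1 \<le> a1"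
    and ker: "\<And>g. g \<in> carrier (jumping_group X S x0 \<alpha>) \<Longrightarrow> \<pi>X g = 0 \<Longrightarrow>
      induced_map X x0 \<alpha> (\<lambda>x x'. \<tau>Y (f x) (f x')) g = 0"
  shows "\<And>g. g \<in> carrier (jumping_group Y T y0 \<beta>) \<Longrightarrow>
      induced_map Y y0 \<beta> (\<lambda>y y'. \<tau>X (f' y) (f' y')) g \<in> \<pi>X ` carrier (jumping_group X S x0 \<alpha>)"
    and "\<exists>b\<in>\<pi>Y ` carrier (jumping_group Y T y0 \<beta>).
      \<forall>g\<in>carrier (jumping_group Y T y0 \<beta>). \<forall>z\<in>carrier (jumping_group X S x0 \<alpha>).
        induced_map Y y0 \<beta> (\<lambda>y y'. \<tau>X (f' y) (f' y')) g = \<pi>X z \<longrightarrow>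
        induced_map X x0 \<alpha> (\<lambda>x x'. \<tau>Y (f x) (f x')) z = b + \<pi>Y g - b"
proof -
  interpret X: jumping_group_hom X S x0 \<alpha> \<pi>X by fact
  interpret Y: jumping_group_hom Y T y0 \<beta> \<pi>Y by fact
  note f = controlled_inversesD(1)[OF ctrl] and f' = controlled_inversesD(2)[OF ctrl]
    and lip = controlled_inversesD(3)[OF ctrl] and lip' = controlled_inversesD(4)[OF ctrl]
    and close = controlled_inversesD(5)[OF ctrl]
  define cX where "cX x x' = \<tau>Y (f x) (f x')" for x x'
  define cY where "cY y y' = \<tau>X (f' y) (f' y')" for y y'
  note rX = \<tau>X[unfolded X.taut.realized_by_def] and rY = \<tau>Y[unfolded Y.taut.realized_by_def]
  interpret TX: warped_cocycle X S x0 \<alpha> t "real a1" \<tau>X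
    using rX by blast
  interpret TY: warped_cocycle Y T y0 \<beta> s "real b0" \<tau>Y
    using rY by blast
  have b0: "real (K * a0) \<le> real b0" "1 \<le> b0" "K \<le> b0"
  proof -
    show "real (K * a0) \<le> real b0"
      using scales(4) by (simp only: of_nat_le_iff)
    show "1 \<le> b0"
      using TY.\<theta> by simp
    have "K \<le> K * a0"
      using scales(1) by simp
    then show "K \<le> b0"
      using scales(4) by (rule order.trans)
  qed
  have "warped_cocycle X S x0 \<alpha> t (real a0) (\<lambda>x x'. \<tau>Y (f x) (f x'))"
    using scales(1) TX.t
    by (intro warped_cocycle_pullback[OF X.based_warped_system_axioms TY.warped_cocycle_axioms f
          order.trans[OF lip b0(1)]]) auto
  then interpret P: warped_cocycle X S x0 \<alpha> t "real a0" cX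
    unfolding cX_def .
  have "real (K * b1) \<le> real a1"
    using scales(6) by (simp only: of_nat_le_iff)
  then have "warped_cocycle Y T y0 \<beta> s (real b1) (\<lambda>y y'. \<tau>X (f' y) (f' y'))"
    using scales(5) TY.t
    by (intro warped_cocycle_pullback[OF Y.based_warped_system_axioms TX.warped_cocycle_axioms f'
          order.trans[OF lip']]) auto
  then interpret Q: warped_cocycle Y T y0 \<beta> s "real b1" cY
    unfolding cY_def .
  interpret GX: group X.\<Gamma> by (rule X.group_jumping_group)
  \<comment> \<open>The homomorphism on the group of X descends to the image of \<pi>X by a choice
    of preimages; \<open>ker\<close> makes the value independent of it.\<close>
  define \<sigma> where "\<sigma> v = P.total (SOME z. z \<in> carrier X.\<Gamma> \<and> \<pi>X z = v)" for v
  have \<sigma>: "\<sigma> (\<pi>X z) = P.total z" if z: "z \<in> carrier X.\<Gamma>" for z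
  proof -
    define z' where "z' = (SOME z'. z' \<in> carrier X.\<Gamma> \<and> \<pi>X z' = \<pi>X z)"
    have "z' \<in> carrier X.\<Gamma> \<and> \<pi>X z' = \<pi>X z"
      unfolding z'_def by (rule someI[of _ z]) (use z in simp)
    then have z': "z' \<in> carrier X.\<Gamma>" "\<pi>X z' = \<pi>X z"
      by auto
    define d where "d = inv\<^bsub>X.\<Gamma>\<^esub> z \<otimes>\<^bsub>X.\<Gamma>\<^esub> z'"
    have d: "d \<in> carrier X.\<Gamma>"
      using z z' by (simp add: d_def)
    have "\<pi>X d = 0"
      using z z' by (simp add: d_def X.hom X.hom_inv)
    then have "P.total d = 0"
      using ker[OF d] by (simp add: cX_def[abs_def])
    moreover have "z' = z \<otimes>\<^bsub>X.\<Gamma>\<^esub> d"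
      using z z' by (simp add: d_def GX.m_assoc[symmetric])
    ultimately have "P.total z' = P.total z"
      using P.total_mult[OF z d] by simp
    then show ?thesis
      by (simp add: \<sigma>_def z'_def)
  qed
  \<comment> \<open>The gauge of \<open>transfer_taut\<close>, between \<pi>X and the representation
    of the pulled back cocycle.\<close>
  define D where "D x = development cX (X.base x)" for x
  note transfer = X.transfer_taut[OF P.jumping_rep_axioms \<sigma>, folded D_def]
  have taut: "\<And>a b. a \<in> X.image \<Longrightarrow> b \<in> X.image \<Longrightarrow> \<sigma> (a + b) = \<sigma> a + \<sigma> b"
    "\<And>p x y. path_in X p x y \<Longrightarrow> \<sigma> (X.taut_path p) = D x + development cX p - D y"
    "\<And>l x. fst l \<in> S \<Longrightarrow> x \<in> X \<Longrightarrow> \<sigma> (X.taut_jump l x) = D (letter_act X l x) + P.jump l x - D x"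
    using transfer by blast+
  have D_word: "word_value X X.taut_jump w x \<in> X.image \<and>
      \<sigma> (word_value X X.taut_jump w x) = D (word_act X w x) + word_value X P.jump w x - D x"
    if "word_in S w" "x \<in> X" for w x
  proof (rule transfer_word_value[OF X.taut.jumping_rep_axioms P.jumping_rep_axioms X.image_0 X.image_add taut(1)])
    fix l :: "('a \<Rightarrow> 'a) letter" and x assume "fst l \<in> S" "x \<in> X"
    then show "X.taut_jump l x \<in> X.image \<and> \<sigma> (X.taut_jump l x) = D (letter_act X l x) + P.jump l x - D x"
      using X.taut_jump_image taut(3) by simp
  qed (use that in auto)
  have \<tau>X_image: "\<tau>X x x' \<in> X.image" if xx': "x \<in> X" "x' \<in> X" "TX.wd x x' \<le> real a1" for x x'
  proof -
    obtain r p w where r: "jumping_chain X S t x r p w x'" "\<tau>X x x' = X.taut_path p + word_value X X.taut_jump w x'"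
      using rX xx' by blast
    have "0 \<le> t" using TX.t by simp
    note basic = X.jumping_chain_basic[OF r(1) this]
    show ?thesis
      unfolding r(2) using X.taut_path_image[OF basic(2)] D_word[OF basic(1,4)] by blast
  qed
  have \<tau>Y_image: "\<tau>Y y y' \<in> Y.image" if yy': "y \<in> Y" "y' \<in> Y" "TY.wd y y' \<le> real b0" for y y'
  proof -
    obtain r p w where r: "jumping_chain Y T s y r p w y'" "\<tau>Y y y' = Y.taut_path p + word_value Y Y.taut_jump w y'"
      using rY yy' by blast
    have "0 \<le> s" using TY.t by simp
    note basic = Y.jumping_chain_basic[OF r(1) this]
    have "word_value Y Y.taut_jump w y' \<in> Y.image"
      using basic(1)
    proof (induction w)
      case (Cons l w)
      then show ?case
        using Y.taut_jump_image[of l "word_act Y w y'"] Y.word_act_mem[of w y'] basic(4) by auto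
    qed simp
    then show ?thesis
      unfolding r(2) using Y.taut_path_image[OF basic(2)] by blast
  qed
  \<comment> \<open>One chain of length at most a0 evaluates both sides: \<tau>X through the taut
    representation, and \<open>cX\<close> through \<open>jumping_chain_value\<close>.\<close>
  have \<sigma>\<tau>X: "\<sigma> (\<tau>X x x') = D x + cX x x' - D x'" if xx': "x \<in> X" "x' \<in> X" "TX.wd x x' \<le> real a0" for x x'
  proof -
    have "TX.wd x x' \<le> real a1"
      using xx'(3) scales(2) by simp
    then obtain r p w where r: "r \<le> TX.wd x x'" "jumping_chain X S t x r p w x'"
        "\<tau>X x x' = X.taut_path p + word_value X X.taut_jump w x'"
      using rX xx' by blast
    have "0 \<le> t" using TX.t by simp
    note basic = X.jumping_chain_basic[OF r(2) this]
    have "r \<le> real a0"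
      using r(1) xx'(3) by simp
    have "\<sigma> (\<tau>X x x') = \<sigma> (X.taut_path p) + \<sigma> (word_value X X.taut_jump w x')"
      unfolding r(3) using X.taut_path_image[OF basic(2)] D_word[OF basic(1,4)] by (intro taut(1)) auto
    also have "\<dots> = D x + (development cX p + word_value X P.jump w x') - D x'"
      using taut(2)[OF basic(2)] D_word[OF basic(1,4)]
      by (simp add: group_normalize del: add_uminus_conv_diff)
    also have "\<dots> = D x + cX x x' - D x'"
      using P.jumping_chain_value(1)[OF r(2) \<open>r \<le> real a0\<close>] by simp
    finally show ?thesis .
  qed
  \<comment> \<open>The gauge on Y: the gauge of X at f' y, corrected by the value of \<tau>Y from f
    (f' y) to y.\<close>
  define b where "b y = D (f' y) + \<tau>Y (f (f' y)) y" for y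
  have cY: "cY y y' \<in> X.image" "\<sigma> (cY y y') = b y + \<tau>Y y y' - b y'"
    if yy': "y \<in> Y" "y' \<in> Y" "TY.wd y y' \<le> 1" for y y'
  proof -
    have wd: "TX.wd (f' y) (f' y') \<le> real K"
      using lip'[OF yy'(1,2), of 1] yy'(3) by simp
    then have wda: "TX.wd (f' y) (f' y') \<le> real a0"
      using scales(3) by simp
    show "cY y y' \<in> X.image"
      unfolding cY_def using wda scales(2) f' yy' by (intro \<tau>X_image) auto
    have mem: "f (f' y) \<in> Y" "f (f' y') \<in> Y"
      using f f' yy' by auto
    have "TY.wd (f (f' y)) (f (f' y')) \<le> real b0"
      using lip[OF f'[OF yy'(1)] f'[OF yy'(2)] scales(1) wda] b0(1) by simp
    \<comment> \<open>The quadrilateral with corners f (f' y), f (f' y'), y' and y.\<close>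
    then have "\<tau>Y (f (f' y)) (f (f' y')) + \<tau>Y (f (f' y')) y' = \<tau>Y (f (f' y)) y + \<tau>Y y y'"
      using mem yy' close[OF yy'(1)] close[OF yy'(2)] b0(2,3) by (intro TY.W.square) auto
    then have "cX (f' y) (f' y') = \<tau>Y (f (f' y)) y + \<tau>Y y y' - \<tau>Y (f (f' y')) y'"
      by (simp add: cX_def eq_diff_eq)
    then show "\<sigma> (cY y y') = b y + \<tau>Y y y' - b y'"
      using \<sigma>\<tau>X[OF f'[OF yy'(1)] f'[OF yy'(2)] wda]
      by (simp add: cY_def b_def group_normalize del: add_uminus_conv_diff)
  qed
  have paths: "development cY q \<in> X.image \<and> \<sigma> (development cY q) = b y + Y.taut_path q - b y'"
    if q: "path_in Y q y y'" for q y y'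
  proof -
    obtain \<phi> where \<phi>: "develops cY q \<phi>"
      using Q.path_develops[OF q] .
    then obtain \<eta> where \<eta>: "\<eta> > 0" "\<And>u v. u \<in> {0..1} \<Longrightarrow> v \<in> {0..1} \<Longrightarrow> \<bar>u - v\<bar> < \<eta> \<Longrightarrow>
        - \<phi> u + \<phi> v = cY (q u) (q v)"
      unfolding develops_def by blast
    obtain \<eta>1 where \<eta>1: "\<eta>1 > 0" "\<And>u v. u \<in> {0..1} \<Longrightarrow> v \<in> {0..1} \<Longrightarrow> \<bar>u - v\<bar> < \<eta>1 \<Longrightarrow> TY.wd (q u) (q v) \<le> 1"
      using TY.path_small[OF q] by blast
    have img: "- \<phi> 0 + \<phi> u \<in> X.image" if "u \<in> {0..1}" for u
      by (rule Q.development_in[OF X.image_0 X.image_add cY(1) q \<phi> that])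
    \<comment> \<open>The image under \<sigma> of a primitive of \<open>cY\<close>, corrected by the
      gauge, is a primitive of \<tau>Y.\<close>
    define \<psi> where "\<psi> u = - b (q 0) + \<sigma> (- \<phi> 0 + \<phi> u) + b (q u)" for u
    have "develops \<tau>Y q \<psi>"
      unfolding develops_def
    proof (intro exI[of _ "min \<eta> \<eta>1"] conjI ballI impI)
      fix u v :: real assume uv: "u \<in> {0..1}" "v \<in> {0..1}" "\<bar>u - v\<bar> < min \<eta> \<eta>1"
      have qq: "q u \<in> Y" "q v \<in> Y" "TY.wd (q u) (q v) \<le> 1"
        using path_in_image_mem[OF q] \<eta>1(2)[of u v] uv by auto
      have "\<sigma> (- \<phi> 0 + \<phi> v) = \<sigma> ((- \<phi> 0 + \<phi> u) + cY (q u) (q v))"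
        using \<eta>(2)[of u v, symmetric] uv by (simp add: add.assoc)
      also have "\<dots> = \<sigma> (- \<phi> 0 + \<phi> u) + (b (q u) + \<tau>Y (q u) (q v) - b (q v))"
        using taut(1)[OF img[OF uv(1)] cY(1)[OF qq]] cY(2)[OF qq] by simp
      finally show "- \<psi> u + \<psi> v = \<tau>Y (q u) (q v)"
        by (simp add: \<psi>_def group_normalize del: add_uminus_conv_diff)
    qed (use \<eta> \<eta>1 in auto)
    then have "development \<tau>Y q = - \<psi> 0 + \<psi> 1"
      by (rule development_eqI)
    moreover have "\<sigma> 0 = 0"
      using taut(1)[of 0 0] by (simp add: eq_add_self_iff)
    moreover have "q 0 = y" "q 1 = y'"
      using q by (auto simp: path_in_def pathstart_def pathfinish_def)
    moreover have "development \<tau>Y q = Y.taut_path q"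
      using rY q by blast
    moreover have "development cY q = - \<phi> 0 + \<phi> 1"
      by (rule development_eqI[OF \<phi>])
    ultimately show ?thesis
      using img[of 1] by (simp add: \<psi>_def group_normalize del: add_uminus_conv_diff)
  qed
  have jumps: "Q.jump l y \<in> X.image \<and> \<sigma> (Q.jump l y) = b (letter_act Y l y) + Y.taut_jump l y - b y"
    if "fst l \<in> T" "y \<in> Y" for l :: "('b \<Rightarrow> 'b) letter" and y
  proof -
    have "TY.wd (letter_act Y l y) y \<le> 1"
      using Y.warped_metric_space(3)[OF TY.t_pos that] .
    then show ?thesis
      using cY[OF Y.letter_act_mem[OF that] that(2)] rY that by simp
  qed
  have total: "Q.total g \<in> X.image \<and> \<sigma> (Q.total g) = b y0 + Y.taut.total g - b y0"
    if "g \<in> carrier Y.\<Gamma>" for g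
    by (rule transfer_total[OF Q.jumping_rep_axioms Y.taut.jumping_rep_axioms X.image_0 X.image_add taut(1)
          jumps paths that])
  then show "induced_map Y y0 \<beta> (\<lambda>y y'. \<tau>X (f' y) (f' y')) g \<in> \<pi>X ` carrier X.\<Gamma>" if "g \<in> carrier Y.\<Gamma>" for g
    using that by (simp add: cY_def[abs_def] X.image_def)
  \<comment> \<open>The conjugating element has to lie in the image of \<pi>Y: the surjectivity
    argument in \<open>quotients_isomorphic\<close> lifts it to a group element.\<close>
  have "D (f' y0) \<in> Y.image"
  proof -
    have p: "path_in X (X.base (f' y0)) x0 (f' y0)"
      by (rule X.base[OF f'[OF Y.x0_mem]])
    obtain \<phi> where \<phi>: "develops cX (X.base (f' y0)) \<phi>"
      using P.path_develops[OF p] .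
    have "cX x x' \<in> Y.image" if "x \<in> X" "x' \<in> X" "TX.wd x x' \<le> 1" for x x'
      unfolding cX_def using lip[OF that(1,2), of 1] that f b0(3) by (intro \<tau>Y_image) auto
    then have "- \<phi> 0 + \<phi> 1 \<in> Y.image"
      by (intro P.development_in[OF Y.image_0 Y.image_add _ p \<phi>]) auto
    then show ?thesis
      by (simp add: D_def development_eqI[OF \<phi>])
  qed
  moreover have "\<tau>Y (f (f' y0)) y0 \<in> Y.image"
    using close[OF Y.x0_mem] b0(3) f f' by (intro \<tau>Y_image) auto
  ultimately have "b y0 \<in> Y.image"
    unfolding b_def by blast
  moreover have "P.total z = b y0 + \<pi>Y g - b y0"
    if "g \<in> carrier Y.\<Gamma>" "z \<in> carrier X.\<Gamma>" "Q.total g = \<pi>X z" for g z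
    using total[OF that(1)] \<sigma>[OF that(2)] that Y.total_taut by simp
  ultimately show "\<exists>b\<in>\<pi>Y ` carrier Y.\<Gamma>. \<forall>g\<in>carrier Y.\<Gamma>. \<forall>z\<in>carrier X.\<Gamma>.
      induced_map Y y0 \<beta> (\<lambda>y y'. \<tau>X (f' y) (f' y')) g = \<pi>X z \<longrightarrow>
      induced_map X x0 \<alpha> (\<lambda>x x'. \<tau>Y (f x) (f x')) z = b + \<pi>Y g - b"
    by (intro bexI[of _ "b y0"]) (auto simp: cX_def[abs_def] cY_def[abs_def] Y.image_def)
qed

text \<open>\<open>EF\<close> makes the map induced by F surjective, after undoing a conjugation by
  \<open>b\<close>, which therefore must come from H. \<open>FE\<close> makes its kernel equal to N;
  for this the conjugating element \<open>d\<close> may be arbitrary.\<close>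

lemma quotients_isomorphic:
  assumes "N \<lhd> G" "M \<lhd> H"
    and F: "\<And>x y. x \<in> carrier G \<Longrightarrow> y \<in> carrier G \<Longrightarrow> F (x \<otimes>\<^bsub>G\<^esub> y) = F x + F y"
    and F_image: "\<And>x. x \<in> carrier G \<Longrightarrow> F x \<in> quotient_translation H M ` carrier H"
    and F_N: "\<And>x. x \<in> N \<Longrightarrow> F x = 0"
    and E: "\<And>x y. x \<in> carrier H \<Longrightarrow> y \<in> carrier H \<Longrightarrow> E (x \<otimes>\<^bsub>H\<^esub> y) = E x + E y"
    and E_image: "\<And>x. x \<in> carrier H \<Longrightarrow> E x \<in> quotient_translation G N ` carrier G"
    and EF: "b \<in> quotient_translation H M ` carrier H"
      "\<And>x z. x \<in> carrier H \<Longrightarrow> z \<in> carrier G \<Longrightarrow> E x = quotient_translation G N z \<Longrightarrow>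
        F z = b + quotient_translation H M x - b"
    and FE: "\<And>x z. x \<in> carrier G \<Longrightarrow> z \<in> carrier H \<Longrightarrow> F x = quotient_translation H M z \<Longrightarrow>
        E z = d + quotient_translation G N x - d"
  shows "G Mod N \<cong> H Mod M"
proof -
  interpret N: normal N G by fact
  interpret M: normal M H by fact
  let ?m = "quotient_translation H M" and ?n = "quotient_translation G N"
  define k where "k x = (SOME h. h \<in> carrier H \<and> ?m h = F x)" for x
  have k: "k x \<in> carrier H" "?m (k x) = F x" if "x \<in> carrier G" for x
  proof -
    have "\<exists>h. h \<in> carrier H \<and> ?m h = F x"
      using F_image[OF that] by force
    then have "k x \<in> carrier H \<and> ?m (k x) = F x"
      unfolding k_def by (rule someI_ex)
    then show "k x \<in> carrier H" "?m (k x) = F x" by auto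
  qed
  have k_eq: "M #>\<^bsub>H\<^esub> k x = M #>\<^bsub>H\<^esub> h" if "x \<in> carrier G" "h \<in> carrier H" "F x = ?m h" for x h
    using k[OF that(1)] that by (simp flip: M.quotient_translation_eq_iff)
  have m1: "?m \<one>\<^bsub>H\<^esub> = 0"
    by (simp add: M.quotient_translation_eq_0_iff)
  have E1: "E \<one>\<^bsub>H\<^esub> = 0"
    using E[of "\<one>\<^bsub>H\<^esub>" "\<one>\<^bsub>H\<^esub>"] by (simp add: eq_add_self_iff)
  have hom: "(\<lambda>x. M #>\<^bsub>H\<^esub> k x) \<in> hom G (H Mod M)"
  proof (rule homI)
    fix x assume x: "x \<in> carrier G"
    then show "M #>\<^bsub>H\<^esub> k x \<in> carrier (H Mod M)"
      using k(1) by (auto simp: carrier_FactGroup)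
    fix y assume y: "y \<in> carrier G"
    have "F (x \<otimes>\<^bsub>G\<^esub> y) = ?m (k x \<otimes>\<^bsub>H\<^esub> k y)"
      using k x y by (simp add: F M.quotient_translation_mult)
    then have "M #>\<^bsub>H\<^esub> k (x \<otimes>\<^bsub>G\<^esub> y) = M #>\<^bsub>H\<^esub> (k x \<otimes>\<^bsub>H\<^esub> k y)"
      using k x y by (intro k_eq) auto
    then show "M #>\<^bsub>H\<^esub> k (x \<otimes>\<^bsub>G\<^esub> y) = (M #>\<^bsub>H\<^esub> k x) \<otimes>\<^bsub>H Mod M\<^esub> (M #>\<^bsub>H\<^esub> k y)"
      using k(1) x y by (simp add: M.rcos_sum)
  qed
  interpret K: group_hom G "H Mod M" "\<lambda>x. M #>\<^bsub>H\<^esub> k x"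
    by (intro group_hom.intro group_hom_axioms.intro hom N.is_group M.factorgroup_is_group)
  have "(\<lambda>x. M #>\<^bsub>H\<^esub> k x) ` carrier G = carrier (H Mod M)"
  proof
    show "carrier (H Mod M) \<subseteq> (\<lambda>x. M #>\<^bsub>H\<^esub> k x) ` carrier G"
    proof
      fix c assume "c \<in> carrier (H Mod M)"
      then obtain h where h: "h \<in> carrier H" "c = M #>\<^bsub>H\<^esub> h"
        by (auto simp: carrier_FactGroup)
      obtain b' where b': "b' \<in> carrier H" "b = ?m b'"
        using EF(1) by blast
      \<comment> \<open>Conjugating by b' in advance cancels the conjugation by \<open>b\<close> in
        \<open>EF\<close>.\<close>
      define h' where "h' = inv\<^bsub>H\<^esub> b' \<otimes>\<^bsub>H\<^esub> h \<otimes>\<^bsub>H\<^esub> b'"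
      have h': "h' \<in> carrier H"
        using h b' by (simp add: h'_def)
      have "b' \<otimes>\<^bsub>H\<^esub> (inv\<^bsub>H\<^esub> b' \<otimes>\<^bsub>H\<^esub> h) = h"
        using h b' by (simp flip: M.m_assoc)
      then have "?m h = ?m (b' \<otimes>\<^bsub>H\<^esub> h' \<otimes>\<^bsub>H\<^esub> inv\<^bsub>H\<^esub> b')"
        using h b' by (simp add: h'_def M.m_assoc)
      also have "\<dots> = b + ?m h' + ?m (inv\<^bsub>H\<^esub> b')"
        using b' h' by (simp add: M.quotient_translation_mult)
      also have "?m (inv\<^bsub>H\<^esub> b') = - b"
        using M.quotient_translation_mult[of "inv\<^bsub>H\<^esub> b'" b'] b' m1 by (simp add: eq_neg_iff_add_eq_0)
      finally have mh: "?m h = b + ?m h' - b"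
        by simp
      obtain z where z: "z \<in> carrier G" "E h' = ?n z"
        using E_image[OF h'] by blast
      have "F z = ?m h"
        using EF(2)[OF h' z] mh by simp
      then show "c \<in> (\<lambda>x. M #>\<^bsub>H\<^esub> k x) ` carrier G"
        using k_eq[OF z(1) h(1)] h(2) z(1) by auto
    qed
  qed (use k(1) in \<open>auto simp: carrier_FactGroup\<close>)
  moreover have "kernel G (H Mod M) (\<lambda>x. M #>\<^bsub>H\<^esub> k x) = N"
  proof -
    have "M #>\<^bsub>H\<^esub> k x = M \<longleftrightarrow> x \<in> N" if x: "x \<in> carrier G" for x
    proof -
      have "M #>\<^bsub>H\<^esub> k x = M \<longleftrightarrow> M #>\<^bsub>H\<^esub> k x = M #>\<^bsub>H\<^esub> \<one>\<^bsub>H\<^esub>"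
        using M.coset_mult_one[OF M.subset] by simp
      also have "\<dots> \<longleftrightarrow> F x = 0"
        using k[OF x] m1 by (simp flip: M.quotient_translation_eq_iff)
      also have "\<dots> \<longleftrightarrow> x \<in> N"
      proof
        assume "F x = 0"
        then have "d + ?n x - d = 0"
          using FE[OF x M.one_closed] m1 E1 by simp
        then have "?n x = 0"
          by (metis add_diff_cancel add.right_neutral diff_eq_eq add_left_cancel add_0)
        then show "x \<in> N"
          using x by (simp add: N.quotient_translation_eq_0_iff)
      qed (rule F_N)
      finally show ?thesis .
    qed
    then show ?thesis
      using N.subset by (auto simp: kernel_def)
  qed
  ultimately show ?thesis
    using K.FactGroup_iso by simp
qed

section \<open>Stability\<close>

context based_warped_system
begin

lemma pi1_quot_map_coset:
  assumes "\<theta> \<le> \<theta>'" "g \<in> carrier \<Gamma>"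
  shows "pi1_quot_map X S x0 \<alpha> \<theta> \<theta>' (kill \<theta> #>\<^bsub>\<Gamma>\<^esub> g) = kill \<theta>' #>\<^bsub>\<Gamma>\<^esub> g"
proof -
  interpret N: normal "kill \<theta>" \<Gamma> by (rule normal_kill)
  interpret N': normal "kill \<theta>'" \<Gamma> by (rule normal_kill)
  have "kill \<theta>' <#>\<^bsub>\<Gamma>\<^esub> (kill \<theta> #>\<^bsub>\<Gamma>\<^esub> g) = (kill \<theta>' <#>\<^bsub>\<Gamma>\<^esub> kill \<theta>) #>\<^bsub>\<Gamma>\<^esub> g"
    using assms N.subset N'.subset by (simp add: N.setmult_rcos_assoc)
  also have "kill \<theta>' <#>\<^bsub>\<Gamma>\<^esub> kill \<theta> = kill \<theta>'"
  proof
    show "kill \<theta>' <#>\<^bsub>\<Gamma>\<^esub> kill \<theta> \<subseteq> kill \<theta>'"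
      using kill_mono[OF assms(1)] by (auto simp: set_mult_def)
    show "kill \<theta>' \<subseteq> kill \<theta>' <#>\<^bsub>\<Gamma>\<^esub> kill \<theta>"
      using N'.subset by (force simp: set_mult_def intro: bexI[of _ "\<one>\<^bsub>\<Gamma>\<^esub>"])
  qed
  finally show ?thesis
    by (simp add: pi1_quot_map_def)
qed

text \<open>Stability in terms of normal subgroups: the quotient maps beyond level \<theta> are
  isomorphisms exactly when \<open>kill\<close> stops growing there.\<close>

definition stable_from :: "nat \<Rightarrow> bool"
  where "stable_from \<theta> \<longleftrightarrow> 1 \<le> \<theta> \<and> (\<forall>\<theta>'\<ge>\<theta>. kill \<theta>' = kill \<theta>)"

abbreviation limit_rel
  where "limit_rel \<equiv> direct_limit_rel {1..} (pi1_theta X S x0 \<alpha>) (pi1_quot_map X S x0 \<alpha>)"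

lemma limit_rel_iff:
  "((i, a), (j, b)) \<in> limit_rel \<longleftrightarrow> 1 \<le> i \<and> 1 \<le> j \<and>
    (\<exists>g\<in>carrier \<Gamma>. \<exists>h\<in>carrier \<Gamma>. a = kill i #>\<^bsub>\<Gamma>\<^esub> g \<and> b = kill j #>\<^bsub>\<Gamma>\<^esub> h \<and>
      (\<exists>k\<ge>1. i \<le> k \<and> j \<le> k \<and> kill k #>\<^bsub>\<Gamma>\<^esub> g = kill k #>\<^bsub>\<Gamma>\<^esub> h))"
proof -
  have mem: "(i, a) \<in> Sigma {1..} (\<lambda>i. carrier (pi1_theta X S x0 \<alpha> i)) \<longleftrightarrow>
      1 \<le> i \<and> (\<exists>g\<in>carrier \<Gamma>. a = kill i #>\<^bsub>\<Gamma>\<^esub> g)" for i a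
    by (simp add: pi1_theta_def carrier_FactGroup image_iff)
  have "((i, a), (j, b)) \<in> limit_rel \<longleftrightarrow>
      (1 \<le> i \<and> (\<exists>g\<in>carrier \<Gamma>. a = kill i #>\<^bsub>\<Gamma>\<^esub> g)) \<and> (1 \<le> j \<and> (\<exists>h\<in>carrier \<Gamma>. b = kill j #>\<^bsub>\<Gamma>\<^esub> h)) \<and>
      (\<exists>k\<ge>1. i \<le> k \<and> j \<le> k \<and> pi1_quot_map X S x0 \<alpha> i k a = pi1_quot_map X S x0 \<alpha> j k b)"
    unfolding direct_limit_rel_def mem[symmetric] by (auto simp only: mem_Collect_eq case_prod_conv atLeast_iff Bex_def)
  also have "\<dots> \<longleftrightarrow> 1 \<le> i \<and> 1 \<le> j \<and>
    (\<exists>g\<in>carrier \<Gamma>. \<exists>h\<in>carrier \<Gamma>. a = kill i #>\<^bsub>\<Gamma>\<^esub> g \<and> b = kill j #>\<^bsub>\<Gamma>\<^esub> h \<and>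
      (\<exists>k\<ge>1. i \<le> k \<and> j \<le> k \<and> pi1_quot_map X S x0 \<alpha> i k a = pi1_quot_map X S x0 \<alpha> j k b))"
    by blast
  also have "\<dots> \<longleftrightarrow> 1 \<le> i \<and> 1 \<le> j \<and>
    (\<exists>g\<in>carrier \<Gamma>. \<exists>h\<in>carrier \<Gamma>. a = kill i #>\<^bsub>\<Gamma>\<^esub> g \<and> b = kill j #>\<^bsub>\<Gamma>\<^esub> h \<and>
      (\<exists>k\<ge>1. i \<le> k \<and> j \<le> k \<and> kill k #>\<^bsub>\<Gamma>\<^esub> g = kill k #>\<^bsub>\<Gamma>\<^esub> h))"
    by (intro conj_cong bex_cong ex_cong1 refl) (simp add: pi1_quot_map_coset)
  finally show ?thesis .
qed

lemma coset_mono: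
  assumes "N \<lhd> \<Gamma>" "N' \<lhd> \<Gamma>" "N \<subseteq> N'" "g \<in> carrier \<Gamma>" "h \<in> carrier \<Gamma>" "N #>\<^bsub>\<Gamma>\<^esub> g = N #>\<^bsub>\<Gamma>\<^esub> h"
  shows "N' #>\<^bsub>\<Gamma>\<^esub> g = N' #>\<^bsub>\<Gamma>\<^esub> h"
proof -
  interpret N: normal N \<Gamma> by fact
  interpret N': normal N' \<Gamma> by fact
  have "g \<in> N #>\<^bsub>\<Gamma>\<^esub> h"
    using N.rcos_self[OF assms(4) N.subgroup_axioms] assms(6) by simp
  then have "g \<in> N' #>\<^bsub>\<Gamma>\<^esub> h"
    using assms(3) by (auto simp: r_coset_def)
  then show ?thesis
    using group.repr_independence[OF group_jumping_group _ assms(5) N'.subgroup_axioms] by simp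
qed

text \<open>An element of a later \<open>kill \<theta>'\<close> has the same image in the limit as
  the unit, so injectivity at level \<theta> puts it into \<open>kill \<theta>\<close>.\<close>

lemma stable_from_if_stable:
  assumes "stable_discrete_fundamental_group X S x0 \<alpha>"
  obtains \<theta> where "stable_from \<theta>"
proof -
  obtain \<theta> where \<theta>: "1 \<le> \<theta>" "direct_limit_map {1..} (pi1_theta X S x0 \<alpha>) (pi1_quot_map X S x0 \<alpha>) \<theta>
      \<in> iso (pi1_theta X S x0 \<alpha> \<theta>) (pi1_infinity X S x0 \<alpha>)"
    using assms unfolding stable_discrete_fundamental_group_def by blast
  interpret G: group \<Gamma> by (rule group_jumping_group)
  interpret N: normal "kill \<theta>" \<Gamma> by (rule normal_kill)
  have inj: "inj_on (direct_limit_map {1..} (pi1_theta X S x0 \<alpha>) (pi1_quot_map X S x0 \<alpha>) \<theta>)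
      (carrier (\<Gamma> Mod kill \<theta>))"
    using \<theta>(2) by (simp add: iso_def bij_betw_def pi1_theta_def)
  have "g \<in> kill \<theta>" if \<theta>': "\<theta> \<le> \<theta>'" and g: "g \<in> kill \<theta>'" for \<theta>' g
  proof -
    interpret N': normal "kill \<theta>'" \<Gamma> by (rule normal_kill)
    have gG: "g \<in> carrier \<Gamma>"
      using g N'.subset by blast
    have eq: "kill \<theta>' #>\<^bsub>\<Gamma>\<^esub> g = kill \<theta>' #>\<^bsub>\<Gamma>\<^esub> \<one>\<^bsub>\<Gamma>\<^esub>"
      using G.coset_join2[OF gG N'.subgroup_axioms g] G.coset_mult_one[OF N'.subset] by simp
    have "limit_rel `` {(\<theta>, kill \<theta> #>\<^bsub>\<Gamma>\<^esub> g)} = limit_rel `` {(\<theta>, kill \<theta> #>\<^bsub>\<Gamma>\<^esub> \<one>\<^bsub>\<Gamma>\<^esub>)}"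
    proof -
      have *: "limit_rel `` {(\<theta>, kill \<theta> #>\<^bsub>\<Gamma>\<^esub> x)} \<subseteq> limit_rel `` {(\<theta>, kill \<theta> #>\<^bsub>\<Gamma>\<^esub> y)}"
        if xy: "x \<in> carrier \<Gamma>" "y \<in> carrier \<Gamma>" "kill \<theta>' #>\<^bsub>\<Gamma>\<^esub> x = kill \<theta>' #>\<^bsub>\<Gamma>\<^esub> y" for x y
      proof (rule subsetI)
        fix q assume q: "q \<in> limit_rel `` {(\<theta>, kill \<theta> #>\<^bsub>\<Gamma>\<^esub> x)}"
        obtain j b where q_eq: "q = (j, b)" by (cases q)
        then obtain g h k where gh: "1 \<le> j" "g \<in> carrier \<Gamma>" "h \<in> carrier \<Gamma>"
            "kill \<theta> #>\<^bsub>\<Gamma>\<^esub> x = kill \<theta> #>\<^bsub>\<Gamma>\<^esub> g" "b = kill j #>\<^bsub>\<Gamma>\<^esub> h"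
            "\<theta> \<le> k" "j \<le> k" "kill k #>\<^bsub>\<Gamma>\<^esub> g = kill k #>\<^bsub>\<Gamma>\<^esub> h"
          using q unfolding q_eq Image_singleton_iff limit_rel_iff by blast
        \<comment> \<open>A level beyond both witnesses of equality, where the two can be
          combined.\<close>
        define m where "m = max k \<theta>'"
        have m: "\<theta> \<le> m" "j \<le> m" "k \<le> m" "\<theta>' \<le> m" "1 \<le> m"
          using gh \<theta>(1) by (auto simp: m_def)
        have "kill m #>\<^bsub>\<Gamma>\<^esub> y = kill m #>\<^bsub>\<Gamma>\<^esub> x"
          using xy by (intro coset_mono[OF normal_kill normal_kill kill_mono[OF m(4)]]) auto
        also have "\<dots> = kill m #>\<^bsub>\<Gamma>\<^esub> g"
          using gh xy by (intro coset_mono[OF normal_kill normal_kill kill_mono[OF m(1)]]) auto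
        also have "\<dots> = kill m #>\<^bsub>\<Gamma>\<^esub> h"
          using gh by (intro coset_mono[OF normal_kill normal_kill kill_mono[OF m(3)]]) auto
        finally show "q \<in> limit_rel `` {(\<theta>, kill \<theta> #>\<^bsub>\<Gamma>\<^esub> y)}"
          using gh m xy \<theta>(1) unfolding q_eq Image_singleton_iff limit_rel_iff by blast
      qed
      show ?thesis
        using *[OF gG G.one_closed eq] *[OF G.one_closed gG eq[symmetric]] by (rule subset_antisym)
    qed
    then have "kill \<theta> #>\<^bsub>\<Gamma>\<^esub> g = kill \<theta> #>\<^bsub>\<Gamma>\<^esub> \<one>\<^bsub>\<Gamma>\<^esub>"
      using inj_onD[OF inj, of "kill \<theta> #>\<^bsub>\<Gamma>\<^esub> g" "kill \<theta> #>\<^bsub>\<Gamma>\<^esub> \<one>\<^bsub>\<Gamma>\<^esub>"] gG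
      by (simp add: direct_limit_map_def carrier_FactGroup)
    then show ?thesis
      using G.coset_mult_one[OF N.subset] G.coset_join1[OF _ gG N.subgroup_axioms] by simp
  qed
  then have "stable_from \<theta>"
    unfolding stable_from_def using \<theta>(1) kill_mono by blast
  then show ?thesis by (rule that)
qed

text \<open>Equality of cosets at any level implies equality at level \<theta>, so the elements of
  the limit correspond to the cosets of \<open>kill \<theta>\<close>.\<close>

lemma direct_limit_map_iso:
  assumes st: "stable_from \<theta>"
  shows "direct_limit_map {1..} (pi1_theta X S x0 \<alpha>) (pi1_quot_map X S x0 \<alpha>) \<theta>
    \<in> iso (pi1_theta X S x0 \<alpha> \<theta>) (pi1_infinity X S x0 \<alpha>)"
proof -
  interpret G: group \<Gamma> by (rule group_jumping_group)
  interpret N: normal "kill \<theta>" \<Gamma> by (rule normal_kill)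
  have \<theta>: "1 \<le> \<theta>" "\<And>k. \<theta> \<le> k \<Longrightarrow> kill k = kill \<theta>"
    using st unfolding stable_from_def by blast+
  have sub: "kill i \<subseteq> kill \<theta>" for i
    using kill_mono[of i "max i \<theta>"] \<theta>(2)[of "max i \<theta>"] by simp
  let ?c = "\<lambda>i g. kill i #>\<^bsub>\<Gamma>\<^esub> g"
  \<comment> \<open>The class of g in the limit, with membership tested at level \<theta>.\<close>
  define cl where "cl g = {(j, ?c j h) | j h. 1 \<le> j \<and> h \<in> carrier \<Gamma> \<and> ?c \<theta> h = ?c \<theta> g}" for g
  have rel: "((i, ?c i g), (j, b)) \<in> limit_rel \<longleftrightarrow> (j, b) \<in> cl g" if i: "1 \<le> i" and g: "g \<in> carrier \<Gamma>" for i g j b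
  proof
    assume "((i, ?c i g), (j, b)) \<in> limit_rel"
    then obtain g' h k where gh: "1 \<le> j" "g' \<in> carrier \<Gamma>" "h \<in> carrier \<Gamma>" "?c i g = ?c i g'" "b = ?c j h"
        "i \<le> k" "j \<le> k" "?c k g' = ?c k h"
      unfolding limit_rel_iff by blast
    have "?c \<theta> g = ?c \<theta> g'"
      using gh g by (intro coset_mono[OF normal_kill normal_kill sub]) auto
    also have "\<dots> = ?c \<theta> h"
      using gh by (intro coset_mono[OF normal_kill normal_kill sub]) auto
    finally show "(j, b) \<in> cl g"
      unfolding cl_def mem_Collect_eq using gh by (intro exI[of _ j] exI[of _ h] conjI) auto
  next
    assume "(j, b) \<in> cl g"
    then obtain h where h: "1 \<le> j" "h \<in> carrier \<Gamma>" "b = ?c j h" "?c \<theta> h = ?c \<theta> g"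
      by (auto simp: cl_def)
    define k where "k = max \<theta> (max i j)"
    have "\<theta> \<le> k" "i \<le> k" "j \<le> k" "1 \<le> k"
      using i by (auto simp: k_def)
    then show "((i, ?c i g), (j, b)) \<in> limit_rel"
      unfolding limit_rel_iff using i g h \<theta>(2)[of k]
      by (intro conjI bexI[of _ g] bexI[of _ h] exI[of _ k]) auto
  qed
  have cl: "limit_rel `` {(i, ?c i g)} = cl g" if "1 \<le> i" "g \<in> carrier \<Gamma>" for i g
    using rel[OF that] by (auto simp: Image_singleton_iff)
  define F where "F = direct_limit_map {1..} (pi1_theta X S x0 \<alpha>) (pi1_quot_map X S x0 \<alpha>) \<theta>"
  have map: "F (?c \<theta> g) = cl g" if "g \<in> carrier \<Gamma>" for g
    using cl[OF \<theta>(1) that] by (simp add: F_def direct_limit_map_def)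
  have cl_eq: "cl g = cl h" if "?c \<theta> g = ?c \<theta> h" for g h
    using that by (simp add: cl_def)
  have cl_self: "(\<theta>, ?c \<theta> g) \<in> cl g" if "g \<in> carrier \<Gamma>" for g
    unfolding cl_def mem_Collect_eq using that \<theta>(1) by (intro exI[of _ \<theta>] exI[of _ g]) auto
  have cl_inj: "?c \<theta> g = ?c \<theta> h" if gh: "g \<in> carrier \<Gamma>" "h \<in> carrier \<Gamma>" "cl g = cl h" for g h
  proof -
    obtain h' where "h' \<in> carrier \<Gamma>" "?c \<theta> g = ?c \<theta> h'" "?c \<theta> h' = ?c \<theta> h"
      using cl_self[OF gh(1)] unfolding gh(3) by (auto simp: cl_def)
    then show ?thesis by simp
  qed
  have carrier: "carrier (pi1_infinity X S x0 \<alpha>) = cl ` carrier \<Gamma>"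
  proof -
    have "carrier (pi1_infinity X S x0 \<alpha>) = {limit_rel `` {(i, ?c i g)} | i g. 1 \<le> i \<and> g \<in> carrier \<Gamma>}"
      by (auto simp: pi1_infinity_def direct_limit_def quotient_def pi1_theta_def carrier_FactGroup)
    also have "\<dots> = cl ` carrier \<Gamma>"
      using cl \<theta>(1) by (auto simp: image_iff) blast
    finally show ?thesis .
  qed
  have mult: "cl g \<otimes>\<^bsub>pi1_infinity X S x0 \<alpha>\<^esub> cl h = cl (g \<otimes>\<^bsub>\<Gamma>\<^esub> h)"
    if gh: "g \<in> carrier \<Gamma>" "h \<in> carrier \<Gamma>" for g h
  proof -
    define A where "A = {(k, pi1_quot_map X S x0 \<alpha> i k x \<otimes>\<^bsub>pi1_theta X S x0 \<alpha> k\<^esub> pi1_quot_map X S x0 \<alpha> j k y)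
      | i x j y k. (i, x) \<in> cl g \<and> (j, y) \<in> cl h \<and> k \<in> {1..} \<and> i \<le> k \<and> j \<le> k}"
    have A_image: "limit_rel `` {a} = cl (g \<otimes>\<^bsub>\<Gamma>\<^esub> h)" if "a \<in> A" for a
    proof -
      obtain i x j y k where xy: "a = (k, pi1_quot_map X S x0 \<alpha> i k x \<otimes>\<^bsub>pi1_theta X S x0 \<alpha> k\<^esub>
            pi1_quot_map X S x0 \<alpha> j k y)" "(i, x) \<in> cl g" "(j, y) \<in> cl h" "k \<in> {1..}" "i \<le> k" "j \<le> k"
        using \<open>a \<in> A\<close> unfolding A_def by blast
      obtain g' where g': "x = ?c i g'" "g' \<in> carrier \<Gamma>" "?c \<theta> g' = ?c \<theta> g"
        using xy(2) unfolding cl_def by blast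
      obtain h' where h': "y = ?c j h'" "h' \<in> carrier \<Gamma>" "?c \<theta> h' = ?c \<theta> h"
        using xy(3) unfolding cl_def by blast
      interpret Nk: normal "kill k" \<Gamma> by (rule normal_kill)
      have "a = (k, ?c k (g' \<otimes>\<^bsub>\<Gamma>\<^esub> h'))"
        using xy g' h' by (simp add: pi1_quot_map_coset pi1_theta_def Nk.rcos_sum)
      then have "limit_rel `` {a} = cl (g' \<otimes>\<^bsub>\<Gamma>\<^esub> h')"
        using cl[of k "g' \<otimes>\<^bsub>\<Gamma>\<^esub> h'"] xy(4) g' h' by simp
      also have "?c \<theta> (g' \<otimes>\<^bsub>\<Gamma>\<^esub> h') = ?c \<theta> (g \<otimes>\<^bsub>\<Gamma>\<^esub> h)"
        using g' h' gh by (simp flip: N.rcos_sum)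
      then have "cl (g' \<otimes>\<^bsub>\<Gamma>\<^esub> h') = cl (g \<otimes>\<^bsub>\<Gamma>\<^esub> h)"
        by (rule cl_eq)
      finally show ?thesis .
    qed
    \<comment> \<open>All products of representatives yield the same class; one of them has to exist
      for their union to be that class.\<close>
    have "(\<theta>, pi1_quot_map X S x0 \<alpha> \<theta> \<theta> (?c \<theta> g) \<otimes>\<^bsub>pi1_theta X S x0 \<alpha> \<theta>\<^esub> pi1_quot_map X S x0 \<alpha> \<theta> \<theta> (?c \<theta> h)) \<in> A"
      unfolding A_def using cl_self[OF gh(1)] cl_self[OF gh(2)] \<theta>(1) by blast
    then have "limit_rel `` A = cl (g \<otimes>\<^bsub>\<Gamma>\<^esub> h)"
      using A_image by (auto simp: Image_def)
    then show ?thesis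
      by (simp add: pi1_infinity_def direct_limit_def A_def)
  qed
  show ?thesis
    unfolding iso_def F_def[symmetric]
  proof (intro CollectI conjI homI)
    fix x y assume "x \<in> carrier (pi1_theta X S x0 \<alpha> \<theta>)" "y \<in> carrier (pi1_theta X S x0 \<alpha> \<theta>)"
    then obtain g h where gh: "x = ?c \<theta> g" "g \<in> carrier \<Gamma>" "y = ?c \<theta> h" "h \<in> carrier \<Gamma>"
      by (auto simp: pi1_theta_def carrier_FactGroup)
    then have "x \<otimes>\<^bsub>pi1_theta X S x0 \<alpha> \<theta>\<^esub> y = ?c \<theta> (g \<otimes>\<^bsub>\<Gamma>\<^esub> h)"
      by (simp add: pi1_theta_def N.rcos_sum)
    with gh show "F (x \<otimes>\<^bsub>pi1_theta X S x0 \<alpha> \<theta>\<^esub> y) = F x \<otimes>\<^bsub>pi1_infinity X S x0 \<alpha>\<^esub> F y"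
      by (simp add: map mult)
  next
    have "inj_on F (carrier (pi1_theta X S x0 \<alpha> \<theta>))"
    proof (rule inj_onI)
      fix x y assume "x \<in> carrier (pi1_theta X S x0 \<alpha> \<theta>)" "y \<in> carrier (pi1_theta X S x0 \<alpha> \<theta>)" "F x = F y"
      then obtain g h where "x = ?c \<theta> g" "g \<in> carrier \<Gamma>" "y = ?c \<theta> h" "h \<in> carrier \<Gamma>" "cl g = cl h"
        by (auto simp: pi1_theta_def carrier_FactGroup map)
      then show "x = y"
        using cl_inj by blast
    qed
    moreover have "F ` carrier (pi1_theta X S x0 \<alpha> \<theta>) = cl ` carrier \<Gamma>"
      by (simp add: pi1_theta_def carrier_FactGroup image_image map)
    ultimately show "bij_betw F (carrier (pi1_theta X S x0 \<alpha> \<theta>)) (carrier (pi1_infinity X S x0 \<alpha>))"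
      by (simp add: bij_betw_def carrier)
  qed (auto simp: pi1_theta_def carrier_FactGroup map carrier)
qed

lemma pi1_infinity_iso: "stable_from \<theta> \<Longrightarrow> \<Gamma> Mod kill \<theta> \<cong> pi1_infinity X S x0 \<alpha>"
  using direct_limit_map_iso[of \<theta>] unfolding is_iso_def pi1_theta_def by blast

lemma stable_if_stable_from: "stable_from \<theta> \<Longrightarrow> stable_discrete_fundamental_group X S x0 \<alpha>"
  using direct_limit_map_iso[of \<theta>] unfolding stable_discrete_fundamental_group_def stable_from_def
  by blast

lemma quotient_jumping_group_hom: "jumping_group_hom X S x0 \<alpha> (quotient_translation \<Gamma> (kill \<theta>))"
  by unfold_locales (rule normal.quotient_translation_mult[OF normal_kill])

lemma quotient_eq_0_iff: "g \<in> carrier \<Gamma> \<Longrightarrow> quotient_translation \<Gamma> (kill \<theta>) g = 0 \<longleftrightarrow> g \<in> kill \<theta>"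
  by (rule normal.quotient_translation_eq_0_iff[OF normal_kill])

text \<open>The scale n may exceed the level \<theta> of the quotient as long as
  \<open>kill n\<close> has not outgrown \<open>kill \<theta>\<close>. Here stability is turned into
  cocycles of large scale.\<close>

lemma realization_exists:
  assumes "n \<ge> 1" "kill n \<subseteq> kill \<theta>"
  obtains t0 where "\<And>t. t \<ge> t0 \<Longrightarrow> \<exists>\<tau>. taut_realized X S x0 \<alpha> (quotient_translation \<Gamma> (kill \<theta>)) t n \<tau>"
proof -
  interpret H: jumping_group_hom X S x0 \<alpha> "quotient_translation \<Gamma> (kill \<theta>)"
    by (rule quotient_jumping_group_hom)
  have "quotient_translation \<Gamma> (kill \<theta>) g = 0" if "g \<in> kill n" for g
    using that assms(2) subgroup.subset[OF normal_imp_subgroup[OF normal_kill[of n]]] quotient_eq_0_iff[of g \<theta>]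
    by blast
  then have Fix: "word_value X H.taut_jump w z = 0"
    if "word_in S w" "reduced w" "length w \<le> 4 * n" "z \<in> Fix X w" for w z
    using that by (rule H.taut_word_value_Fix)
  show ?thesis
    by (rule H.taut.cocycle_exists[OF assms(1) Fix that])
qed

end

section \<open>Coarse constants, levels and the conclusion\<close>

lemma (in warped_cocycle) total_eq_0_if_kill_scale:
  assumes "real n \<le> \<theta>" "g \<in> kill n"
  shows "total g = 0"
  using total_eq_0_if_kill[OF _ assms(2)] word_value_Fix assms(1) by blast

text \<open>Absolute values are taken because L and A carry no sign condition; n \<ge> 1 lets the
  additive term be multiplied by n.\<close>

lemma coarsely_Lipschitz_scale:
  assumes f: "coarsely_Lipschitz L A Z W f" and K: "\<bar>L\<bar> + \<bar>A\<bar> \<le> real K"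
    and x: "x \<in> mspace Z" "x' \<in> mspace Z" and n: "1 \<le> n" "mdist Z x x' \<le> real n"
  shows "mdist W (f x) (f x') \<le> real (K * n)"
proof -
  have "mdist W (f x) (f x') \<le> L * mdist Z x x' + A"
    using f x by (auto simp: coarsely_Lipschitz_def)
  also have "\<dots> \<le> \<bar>L\<bar> * real n + \<bar>A\<bar> * real n"
  proof (rule add_mono)
    have "L * mdist Z x x' \<le> \<bar>L\<bar> * mdist Z x x'"
      by (intro mult_right_mono) auto
    also have "\<dots> \<le> \<bar>L\<bar> * real n"
      using n(2) by (intro mult_left_mono) auto
    finally show "L * mdist Z x x' \<le> \<bar>L\<bar> * real n" .
    have "A \<le> \<bar>A\<bar> * 1" by simp
    also have "\<dots> \<le> \<bar>A\<bar> * real n"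
      using n(1) by (intro mult_left_mono) auto
    finally show "A \<le> \<bar>A\<bar> * real n" .
  qed
  also have "\<dots> = (\<bar>L\<bar> + \<bar>A\<bar>) * real n"
    by (simp add: distrib_right)
  also have "\<dots> \<le> real K * real n"
    using K by (intro mult_right_mono) auto
  finally show ?thesis by simp
qed

lemma quasi_isometry_scales:
  assumes "quasi_isometry L A Z W f" and K: "\<bar>L\<bar> + \<bar>A\<bar> \<le> real K"
  shows "\<exists>f'. controlled_inverses K (mspace Z) (mdist Z) (mspace W) (mdist W) f f'"
proof -
  obtain f' where f: "coarsely_Lipschitz L A Z W f" and f': "coarsely_Lipschitz L A W Z f'"
    and cl: "\<And>w. w \<in> mspace W \<Longrightarrow> mdist W (f (f' w)) w \<le> A" "\<And>z. z \<in> mspace Z \<Longrightarrow> mdist Z (f' (f z)) z \<le> A"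
    using assms unfolding quasi_isometry_def by blast
  have "A \<le> real K"
    using K by linarith
  then show ?thesis
    using f f' coarsely_Lipschitz_scale[OF f K] coarsely_Lipschitz_scale[OF f' K] cl[THEN order.trans]
    by (intro exI[of _ f']) (auto simp only: controlled_inverses_def coarsely_Lipschitz_def Pi_iff)
qed

lemma incseq_unbounded_large:
  fixes t s :: "nat \<Rightarrow> real"
  assumes "incseq t" "\<not> bdd_above (range t)" "incseq s" "\<not> bdd_above (range s)"
  obtains k where "a \<le> t k" "b \<le> s k"
proof -
  have large: "\<exists>i. c \<le> u i" if "\<not> bdd_above (range u)" for u :: "nat \<Rightarrow> real" and c
    using that by (auto simp: bdd_above_def) (metis linear)
  obtain i where "a \<le> t i"
    using large[OF assms(2)] by blast
  moreover obtain j where "b \<le> s j"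
    using large[OF assms(4)] by blast
  ultimately have "a \<le> t (max i j)" "b \<le> s (max i j)"
    using incseqD[OF assms(1), of i "max i j"] incseqD[OF assms(3), of j "max i j"] by auto
  then show ?thesis by (rule that)
qed

theorem theorem8p10:
  fixes X :: "'a::metric_space set" and S :: "('a \<Rightarrow> 'a) set"
    and x\<^sub>0 :: 'a and \<alpha> :: "('a \<Rightarrow> 'a) \<Rightarrow> real \<Rightarrow> 'a"
    and Y :: "'b::metric_space set" and T :: "('b \<Rightarrow> 'b) set"
    and y\<^sub>0 :: 'b and \<beta> :: "('b \<Rightarrow> 'b) \<Rightarrow> real \<Rightarrow> 'b"
    and t s :: "nat \<Rightarrow> real"
  assumes "warped_system X S" and "warped_system Y T"
    and "connecting_paths X S x\<^sub>0 \<alpha>" and "connecting_paths Y T y\<^sub>0 \<beta>"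
    and "incseq t" and "\<And>k. 1 \<le> t k" and "\<not> bdd_above (range t)"
    and "incseq s" and "\<And>k. 1 \<le> s k" and "\<not> bdd_above (range s)"
    and "coarsely_equivalent (\<lambda>k. warped_metric X S (t k)) (\<lambda>k. warped_metric Y T (s k))"
    and "stable_discrete_fundamental_group X S x\<^sub>0 \<alpha>"
  shows "stable_discrete_fundamental_group Y T y\<^sub>0 \<beta> \<and>
         pi1_infinity X S x\<^sub>0 \<alpha> \<cong> pi1_infinity Y T y\<^sub>0 \<beta>"
proof -
  interpret X: based_warped_system X S x\<^sub>0 \<alpha>
    by (intro based_warped_system.intro based_warped_system_axioms.intro assms)
  interpret Y: based_warped_system Y T y\<^sub>0 \<beta>
    by (intro based_warped_system.intro based_warped_system_axioms.intro assms)
  obtain L A where LA: "\<And>k. \<exists>f. quasi_isometry L A (warped_metric X S (t k)) (warped_metric Y T (s k)) f"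
    using assms(11) unfolding coarsely_equivalent_def by blast
  \<comment> \<open>\<open>Suc\<close> ensures K \<ge> 1, so that multiplication by K never
    decreases a scale.\<close>
  define K where "K = Suc (nat \<lceil>\<bar>L\<bar> + \<bar>A\<bar>\<rceil>)"
  have K: "1 \<le> K" "\<bar>L\<bar> + \<bar>A\<bar> \<le> real K"
    unfolding K_def by linarith+
  have tpos: "t k > 0" "s k > 0" for k
    using assms(6)[of k] assms(9)[of k] by linarith+
  have maps: "\<exists>f f'. controlled_inverses K X (warped_dist X S (t k)) Y (warped_dist Y T (s k)) f f'" for k
  proof -
    obtain f where f: "quasi_isometry L A (warped_metric X S (t k)) (warped_metric Y T (s k)) f"
      using LA by blast
    note simps = X.mdist_warped_metric[OF tpos(1)] X.mspace_warped_metric[OF tpos(1)]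
      Y.mdist_warped_metric[OF tpos(2)] Y.mspace_warped_metric[OF tpos(2)]
    show ?thesis
      using quasi_isometry_scales[OF f K(2)] unfolding simps by blast
  qed
  obtain \<theta>0 where \<theta>0: "X.stable_from \<theta>0"
    using X.stable_from_if_stable[OF assms(12)] .
  \<comment> \<open>A level at which X is already stable and which is at least K, as
    \<open>composition_conjugate\<close> demands of a0.\<close>
  define a where "a = max \<theta>0 K"
  have a: "X.stable_from a" "1 \<le> a" "K \<le> a"
  proof -
    show "1 \<le> a" "K \<le> a"
      using K(1) by (auto simp: a_def)
    moreover have "X.kill \<theta>' = X.kill a" if "a \<le> \<theta>'" for \<theta>'
    proof -
      have "\<theta>0 \<le> \<theta>'" "\<theta>0 \<le> a"
        using that by (auto simp: a_def)
      then show ?thesis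
        using \<theta>0 unfolding X.stable_from_def by metis
    qed
    ultimately show "X.stable_from a"
      unfolding X.stable_from_def by blast
  qed
  have Xa: "X.kill n \<subseteq> X.kill a" for n
    using X.kill_mono[of n "max n a"] a(1) unfolding X.stable_from_def by (metis max.cobounded1 max.cobounded2)
  let ?\<pi>X = "\<lambda>p. quotient_translation X.\<Gamma> (X.kill p)" and ?\<pi>Y = "\<lambda>q. quotient_translation Y.\<Gamma> (Y.kill q)"
  \<comment> \<open>Each realisation exists for all large parameters, so one index k far enough out
    serves both systems; it depends on the four levels.\<close>
  have realizations: "\<exists>k f f' \<tau>X \<tau>Y.
      taut_realized X S x\<^sub>0 \<alpha> (?\<pi>X p) (t k) n \<tau>X \<and>
      taut_realized Y T y\<^sub>0 \<beta> (?\<pi>Y q) (s k) m \<tau>Y \<and>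
      controlled_inverses K X (warped_dist X S (t k)) Y (warped_dist Y T (s k)) f f'"
    if "1 \<le> n" "X.kill n \<subseteq> X.kill p" "1 \<le> m" "Y.kill m \<subseteq> Y.kill q" for n m p q
  proof -
    obtain t0 where t0: "\<And>t. t \<ge> t0 \<Longrightarrow> \<exists>\<tau>. taut_realized X S x\<^sub>0 \<alpha> (?\<pi>X p) t n \<tau>"
      using X.realization_exists[OF \<open>1 \<le> n\<close> \<open>X.kill n \<subseteq> X.kill p\<close>] by blast
    obtain s0 where s0: "\<And>t. t \<ge> s0 \<Longrightarrow> \<exists>\<tau>. taut_realized Y T y\<^sub>0 \<beta> (?\<pi>Y q) t m \<tau>"
      using Y.realization_exists[OF \<open>1 \<le> m\<close> \<open>Y.kill m \<subseteq> Y.kill q\<close>] by blast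
    obtain k where k: "t0 \<le> t k" "s0 \<le> s k"
      using incseq_unbounded_large[OF assms(5,7,8,10)] .
    show ?thesis
      using t0[OF k(1)] s0[OF k(2)] maps[of k] by blast
  qed
  have cocycles: "warped_cocycle X S x\<^sub>0 \<alpha> t' (real n) \<tau>"
    if "taut_realized X S x\<^sub>0 \<alpha> (?\<pi>X p) t' n \<tau>" for p t' n \<tau>
    using that jumping_rep.realized_by_def[OF jumping_group_hom.taut_rep[OF X.quotient_jumping_group_hom]]
    by blast
  have cocycles': "warped_cocycle Y T y\<^sub>0 \<beta> t' (real n) \<tau>"
    if "taut_realized Y T y\<^sub>0 \<beta> (?\<pi>Y p) t' n \<tau>" for p t' n \<tau>
    using that jumping_rep.realized_by_def[OF jumping_group_hom.taut_rep[OF Y.quotient_jumping_group_hom]]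
    by blast
  \<comment> \<open>\<open>composition_conjugate\<close> is applied with a0 = a, a1 = K \<theta>, b0
    = K a and b1 = \<theta>. An element of \<open>Y.kill \<theta>\<close> goes to 0 in the quotient
    of X, hence on to 0, and this final value is conjugate to its projection modulo
    \<open>Y.kill (K * a)\<close>.\<close>
  have "Y.kill \<theta> \<subseteq> Y.kill (K * a)" if \<theta>: "K * a \<le> \<theta>" for \<theta>
  proof
    fix g assume g: "g \<in> Y.kill \<theta>"
    have gG: "g \<in> carrier Y.\<Gamma>"
      using g subgroup.subset[OF normal_imp_subgroup[OF Y.normal_kill]] by blast
    have le: "1 \<le> K * a" "1 \<le> \<theta>" "a \<le> K * \<theta>" "1 \<le> K * \<theta>"
    proof -
      have "1 * a \<le> K * a" "1 * \<theta> \<le> K * \<theta>"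
        using K(1) by (intro mult_le_mono1; simp)+
      then show "1 \<le> K * a" "1 \<le> \<theta>" "a \<le> K * \<theta>" "1 \<le> K * \<theta>"
        using \<theta> a(2) by linarith+
    qed
    from realizations[OF le(4) Xa le(1) subset_refl] obtain k f f' \<tau>X \<tau>Y where
      \<tau>X: "taut_realized X S x\<^sub>0 \<alpha> (?\<pi>X a) (t k) (K * \<theta>) \<tau>X" and
      \<tau>Y: "taut_realized Y T y\<^sub>0 \<beta> (?\<pi>Y (K * a)) (s k) (K * a) \<tau>Y" and
      ctrl: "controlled_inverses K X (warped_dist X S (t k)) Y (warped_dist Y T (s k)) f f'"
      by blast
    have P: "warped_cocycle X S x\<^sub>0 \<alpha> (t k) (real a) (\<lambda>x x'. \<tau>Y (f x) (f x'))"
      using a(2) assms(6)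
      by (intro warped_cocycle_pullback[OF X.based_warped_system_axioms cocycles'[OF \<tau>Y]] controlled_inversesD[OF ctrl]) auto
    have Q: "warped_cocycle Y T y\<^sub>0 \<beta> (s k) (real \<theta>) (\<lambda>y y'. \<tau>X (f' y) (f' y'))"
      using le assms(9)
      by (intro warped_cocycle_pullback[OF Y.based_warped_system_axioms cocycles[OF \<tau>X]] controlled_inversesD[OF ctrl]) auto
    have ker: "induced_map X x\<^sub>0 \<alpha> (\<lambda>x x'. \<tau>Y (f x) (f x')) z = 0" if "z \<in> carrier X.\<Gamma>" "?\<pi>X a z = 0" for z
      using warped_cocycle.total_eq_0_if_kill_scale[OF P, of a z] X.quotient_eq_0_iff[OF that(1)] that(2) by simp
    obtain b where b: "\<And>g z. g \<in> carrier Y.\<Gamma> \<Longrightarrow> z \<in> carrier X.\<Gamma> \<Longrightarrow>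
        induced_map Y y\<^sub>0 \<beta> (\<lambda>y y'. \<tau>X (f' y) (f' y')) g = ?\<pi>X a z \<Longrightarrow>
        induced_map X x\<^sub>0 \<alpha> (\<lambda>x x'. \<tau>Y (f x) (f x')) z = b + ?\<pi>Y (K * a) g - b"
      using composition_conjugate(2)[OF X.quotient_jumping_group_hom Y.quotient_jumping_group_hom \<tau>X \<tau>Y ctrl
          a(2) le(3) a(3) order_refl le(2) order_refl ker]
      by blast
    \<comment> \<open>The unit is a preimage of 0 under the projection of X, so the conjugacy
      statement applies to g and this unit.\<close>
    have one: "\<one>\<^bsub>X.\<Gamma>\<^esub> \<in> carrier X.\<Gamma>" "\<one>\<^bsub>X.\<Gamma>\<^esub> \<in> X.kill a"
      using monoid.one_closed[OF group.is_monoid[OF X.group_jumping_group]]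
        subgroup.one_closed[OF normal_imp_subgroup[OF X.normal_kill]] by blast+
    then have "?\<pi>X a \<one>\<^bsub>X.\<Gamma>\<^esub> = 0"
      using X.quotient_eq_0_iff by blast
    moreover have "induced_map Y y\<^sub>0 \<beta> (\<lambda>y y'. \<tau>X (f' y) (f' y')) g = 0"
      using warped_cocycle.total_eq_0_if_kill_scale[OF Q, of \<theta> g] g by simp
    ultimately have "b + ?\<pi>Y (K * a) g - b = 0"
      using b[OF gG one(1)] ker[OF one(1)] by simp
    then have "b = b + ?\<pi>Y (K * a) g"
      by simp
    then have "?\<pi>Y (K * a) g = 0"
      by (simp only: eq_add_self_iff)
    then show "g \<in> Y.kill (K * a)"
      using Y.quotient_eq_0_iff[OF gG] by blast
  qed
  then have Y_eq: "Y.kill \<theta> = Y.kill (K * a)" if "K * a \<le> \<theta>" for \<theta>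
    using that Y.kill_mono[OF that] by blast
  \<comment> \<open>Both systems are stable from m on. The two applications of
    \<open>composition_conjugate\<close>, one in each direction, take a0 = b1 = m and a1 = b0 = K
    m.\<close>
  define m where "m = K * a"
  have m: "1 \<le> m" "a \<le> m" "K \<le> m" "m \<le> K * m"
  proof -
    have "1 * a \<le> K * a" "1 * m \<le> K * m"
      using K(1) by (intro mult_le_mono1; simp)+
    then show "1 \<le> m" "a \<le> m" "K \<le> m" "m \<le> K * m"
      using a(2,3) unfolding m_def by linarith+
  qed
  have X_eq: "X.kill \<theta> = X.kill m" if "m \<le> \<theta>" for \<theta>
    using a(1) m(2) that unfolding X.stable_from_def by (metis order.trans)
  have stX: "X.stable_from m"
    unfolding X.stable_from_def using m(1) X_eq by blast
  have stY: "Y.stable_from m"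
    unfolding Y.stable_from_def using m(1) Y_eq unfolding m_def by blast
  have Km: "1 \<le> K * m"
    using m by linarith
  from realizations[OF Km equalityD1[OF X_eq[OF m(4)]] Km equalityD1[OF Y_eq[of "K * m", folded m_def, OF m(4)]]]
  obtain k f f' \<tau>X \<tau>Y where
    \<tau>X: "taut_realized X S x\<^sub>0 \<alpha> (?\<pi>X m) (t k) (K * m) \<tau>X" and
    \<tau>Y: "taut_realized Y T y\<^sub>0 \<beta> (?\<pi>Y m) (s k) (K * m) \<tau>Y" and
    ctrl: "controlled_inverses K X (warped_dist X S (t k)) Y (warped_dist Y T (s k)) f f'"
    by blast
  interpret P: warped_cocycle X S x\<^sub>0 \<alpha> "t k" "real m" "\<lambda>x x'. \<tau>Y (f x) (f x')"
    using m(1) assms(6)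
    by (intro warped_cocycle_pullback[OF X.based_warped_system_axioms cocycles'[OF \<tau>Y]] controlled_inversesD[OF ctrl]) auto
  interpret Q: warped_cocycle Y T y\<^sub>0 \<beta> "s k" "real m" "\<lambda>y y'. \<tau>X (f' y) (f' y')"
    using m(1) assms(9)
    by (intro warped_cocycle_pullback[OF Y.based_warped_system_axioms cocycles[OF \<tau>X]] controlled_inversesD[OF ctrl]) auto
  have ker: "P.total z = 0" if "z \<in> carrier X.\<Gamma>" "?\<pi>X m z = 0" for z
    using P.total_eq_0_if_kill_scale[of m z] X.quotient_eq_0_iff[OF that(1)] that(2) by simp
  have ker': "Q.total z = 0" if "z \<in> carrier Y.\<Gamma>" "?\<pi>Y m z = 0" for z
    using Q.total_eq_0_if_kill_scale[of m z] Y.quotient_eq_0_iff[OF that(1)] that(2) by simp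
  note c1 = composition_conjugate[OF X.quotient_jumping_group_hom Y.quotient_jumping_group_hom \<tau>X \<tau>Y ctrl
      m(1) m(4) m(3) order_refl m(1) order_refl ker]
  note c2 = composition_conjugate[OF Y.quotient_jumping_group_hom X.quotient_jumping_group_hom \<tau>Y \<tau>X
      controlled_inverses_sym[OF ctrl]
      m(1) m(4) m(3) order_refl m(1) order_refl ker']
  obtain b where b: "b \<in> ?\<pi>Y m ` carrier Y.\<Gamma>" "\<And>g z. g \<in> carrier Y.\<Gamma> \<Longrightarrow> z \<in> carrier X.\<Gamma> \<Longrightarrow>
      Q.total g = ?\<pi>X m z \<Longrightarrow> P.total z = b + ?\<pi>Y m g - b"
    using c1(2) by blast
  obtain d where d: "\<And>g z. g \<in> carrier X.\<Gamma> \<Longrightarrow> z \<in> carrier Y.\<Gamma> \<Longrightarrow>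
      P.total g = ?\<pi>Y m z \<Longrightarrow> Q.total z = d + ?\<pi>X m g - d"
    using c2(2) by blast
  have "X.\<Gamma> Mod X.kill m \<cong> Y.\<Gamma> Mod Y.kill m"
  proof (rule quotients_isomorphic[OF X.normal_kill Y.normal_kill, where F = P.total and E = Q.total
        and b = b and d = d])
    show "P.total x \<in> ?\<pi>Y m ` carrier Y.\<Gamma>" if "x \<in> carrier X.\<Gamma>" for x
      using c2(1) that by blast
    show "Q.total x \<in> ?\<pi>X m ` carrier X.\<Gamma>" if "x \<in> carrier Y.\<Gamma>" for x
      using c1(1) that by blast
    show "P.total x = 0" if "x \<in> X.kill m" for x
      by (rule P.total_eq_0_if_kill_scale[OF order_refl that])
  qed (fact P.total_mult Q.total_mult b d)+
  then have "pi1_infinity X S x\<^sub>0 \<alpha> \<cong> pi1_infinity Y T y\<^sub>0 \<beta>"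
    by (rule iso_trans[OF group.iso_sym[OF normal.factorgroup_is_group[OF X.normal_kill] X.pi1_infinity_iso[OF stX]]
          iso_trans[OF _ Y.pi1_infinity_iso[OF stY]]])
  then show ?thesis
    using Y.stable_if_stable_from[OF stY] by blast
qed

end
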